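(* Let $Y_i=(y_{ir})_{1\le r\le4,\,r\ne i}$, $i=1,2,3,4$, be four triangles in $\mathbb{CH}^n$, and let $J_i\in\mathcal{CPP}$, $i=1,\dots,4$, be three dimensional with $RK(J_i)=\{j_{ir}:1\le r\le 4,\ r\ne i\}$, such that for each $i$ the space $J_i$ is a rescaling of $DA(Y_i)$ with $j_{ir}$ matched to $k_{y_{ir}}$. Then the following are equivalent: (a) there is a tetrahedron $X=(x_1,x_2,x_3,x_4)$ in $\mathbb{CH}^m$ for some $m$ such that for each $i$ the triangle $Y_i$ is congruent to $(x_r)_{r\neq i}$ with $y_{ir}$ corresponding to $x_r$; (b) there is a four dimensional $H\in\mathcal{CPP}$ with $RK(H)=\{h_1,h_2,h_3,h_4\}$ such that for each $i$ the space $J_i$ is a rescaling of the regular subspace of $H$ spanned by $\{h_r:r\ne i\}$ with $j_{ir}$ matched to $h_r$. In that case $H$ and $X$ satisfy that $H$ is a rescaling of $DA(X)$ (with $h_r$ matched to $k_{x_r}$).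
   Context: $\mathbb{CH}^n$ is the open unit ball $\mathbb{B}_n\subset\mathbb{C}^n$ with its group of biholomorphic automorphisms. A triangle (tetrahedron) is an ordered triple (quadruple) of distinct points of some $\mathbb{CH}^n$. Ordered tuples are congruent if an automorphism takes one to the other respecting the order; tuples in balls of different dimensions are first placed in a common ball via the natural inclusions $\mathbb{B}_r\subset\mathbb{B}_{r'}$. A finite dimensional reproducing kernel Hilbert space (RKHS) is a finite dimensional complex Hilbert space $H$ together with a distinguished basis $RK(H)$ whose elements are called reproducing kernels. $H\in\mathcal{RK}$ means that $H$ is finite dimensional and irreducible, i.e. no two elements of $RK(H)$ are orthogonal. A regular subspace of $H$ is the span $J$ of a subset $S\subset RK(H)$, made an RKHS by $RK(J)=S$. $G$ is a rescaling of $H$ if there are a bijection $\theta:RK(H)\to RK(G)$ and a nonvanishing complex function $\gamma$ on $RK(H)$ with $\langle h,h'\rangle=\gamma(h)\overline{\gamma(h')}\langle\theta(h),\theta(h')\rangle$ for all $h,h'\in RK(H)$; $h$ is then said to be matched to $\theta(h)$. A multiplier on $H$ is a linear operator $M$ whose adjoint $M^*$ has each element of $RK(H)$ as an eigenvector. If $J$ is a regular subspace, a multiplier $M$ on $H$ extends a multiplier $M_J$ on $J$ if $M^*$ restricted to $J$ is $M_J^*$. $H\in\mathcal{RK}$ has the complete Pick property, written $H\in\mathcal{CPP}$, if for every regular subspace $J$ of $H$ and all $s,t\ge1$, every $s\times t$ matrix of multipliers on $J$, acting from $J^t$ to $J^s$, extends entrywise to an $s\times t$ matrix of multipliers on $H$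 with the same operator norm. For a finite tuple $Z$ of distinct points of $\mathbb{B}_n$, $DA(Z)$ is the regular subspace of the Drury–Arveson space spanned by the kernel functions $k_z$, $z\in Z$; i.e. the finite dimensional RKHS with reproducing kernels $\{k_z\}_{z\in Z}$ and $\langle k_s,k_t\rangle=k_s(t)=\frac{1}{1-\langle\langle t,s\rangle\rangle}$, where $\langle\langle t,s\rangle\rangle=\sum_i t_i\overline{s_i}$. *)

theory Defs
  imports "HOL-Analysis.Analysis" "HOL-Library.Function_Algebras"
begin

(* A point of C^n is a sequence that vanishes from index n on, so that the natural inclusion
   of B_r into B_r' (r <= r') is the identity map. *)

type_synonym point = "nat \<Rightarrow> complex"

definition hinner :: "nat \<Rightarrow> point \<Rightarrow> point \<Rightarrow> complex" where
  "hinner n t s = (\<Sum>i<n. t i * cnj (s i))"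

definition pnorm :: "nat \<Rightarrow> point \<Rightarrow> real" where
  "pnorm n z = sqrt (\<Sum>i<n. (cmod (z i))\<^sup>2)"

definition complex_ball :: "nat \<Rightarrow> point set" where
  "complex_ball n = {z. (\<forall>i\<ge>n. z i = 0) \<and> pnorm n z < 1}"

(* Complex Frechet differentiability at each point; a i is the i-th complex partial derivative. *)
definition holomorphic_on_ball :: "nat \<Rightarrow> (point \<Rightarrow> complex) \<Rightarrow> bool" where
  "holomorphic_on_ball n f \<longleftrightarrow>
     (\<forall>z\<in>complex_ball n. \<exists>a :: nat \<Rightarrow> complex. \<forall>\<epsilon>>0. \<exists>\<delta>>0. \<forall>w\<in>complex_ball n.
        pnorm n (w - z) < \<delta> \<longrightarrow>
        cmod (f w - f z - (\<Sum>i<n. a i * (w i - z i))) \<le> \<epsilon> * pnorm n (w - z))"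

definition ball_automorphism :: "nat \<Rightarrow> (point \<Rightarrow> point) \<Rightarrow> bool" where
  "ball_automorphism n f \<longleftrightarrow>
     bij_betw f (complex_ball n) (complex_ball n) \<and>
     (\<forall>i<n. holomorphic_on_ball n (\<lambda>z. f z i)) \<and>
     (\<forall>i<n. holomorphic_on_ball n (\<lambda>z. inv_into (complex_ball n) f z i))"

definition distinct_points :: "nat \<Rightarrow> nat set \<Rightarrow> (nat \<Rightarrow> point) \<Rightarrow> bool" where
  "distinct_points n I x \<longleftrightarrow> inj_on x I \<and> x ` I \<subseteq> complex_ball n"

definition congruent_tuples ::
  "nat set \<Rightarrow> nat \<Rightarrow> (nat \<Rightarrow> point) \<Rightarrow> nat \<Rightarrow> (nat \<Rightarrow> point) \<Rightarrow> bool" where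
  "congruent_tuples I n x m y \<longleftrightarrow>
     (\<exists>N f. n \<le> N \<and> m \<le> N \<and> ball_automorphism N f \<and> (\<forall>r\<in>I. f (x r) = y r))"


(* The underlying space of H is the span of the basis RK H inside the ambient vector space
   with scalar multiplication scl H.  Only the values of ip H on that span matter;
   ip H is linear in its first argument. *)

record 'v rkhs_data =
  scl :: "complex \<Rightarrow> 'v \<Rightarrow> 'v"
  ip :: "'v \<Rightarrow> 'v \<Rightarrow> complex"
  RK :: "'v set"

definition hspace :: "'v::ab_group_add rkhs_data \<Rightarrow> 'v set" where
  "hspace H = module.span (scl H) (RK H)"

definition hdim :: "'v::ab_group_add rkhs_data \<Rightarrow> nat" where
  "hdim H = vector_space.dim (scl H) (hspace H)"

definition hnorm :: "'v rkhs_data \<Rightarrow> 'v \<Rightarrow> real" where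
  "hnorm H x = sqrt (Re (ip H x x))"

locale rkhs = vector_space "scl H" for H :: "'v::ab_group_add rkhs_data" +
  assumes finite_RK: "finite (RK H)"
    and independent_RK: "\<not> module.dependent (scl H) (RK H)"
    and ip_add: "\<lbrakk>x \<in> hspace H; y \<in> hspace H; z \<in> hspace H\<rbrakk> \<Longrightarrow> ip H (x + y) z = ip H x z + ip H y z"
    and ip_scl: "\<lbrakk>x \<in> hspace H; z \<in> hspace H\<rbrakk> \<Longrightarrow> ip H (scl H c x) z = c * ip H x z"
    and ip_cnj: "\<lbrakk>x \<in> hspace H; z \<in> hspace H\<rbrakk> \<Longrightarrow> ip H z x = cnj (ip H x z)"
    and ip_pos: "\<lbrakk>x \<in> hspace H; x \<noteq> 0\<rbrakk> \<Longrightarrow> 0 < Re (ip H x x)"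

definition irreducible_rkhs :: "'v::ab_group_add rkhs_data set" where
  "irreducible_rkhs = {H. rkhs H \<and> (\<forall>h\<in>RK H. \<forall>h'\<in>RK H. ip H h h' \<noteq> 0)}"

definition regular_subspace :: "'v rkhs_data \<Rightarrow> 'v set \<Rightarrow> 'v rkhs_data" where
  "regular_subspace H S = H\<lparr>RK := S\<rparr>"

definition rescaling_via ::
  "('w \<Rightarrow> 'v) \<Rightarrow> 'v rkhs_data \<Rightarrow> 'w rkhs_data \<Rightarrow> bool" where
  "rescaling_via \<theta> G H \<longleftrightarrow>
     bij_betw \<theta> (RK H) (RK G) \<and>
     (\<exists>\<gamma>. (\<forall>h\<in>RK H. \<gamma> h \<noteq> 0) \<and>
          (\<forall>h\<in>RK H. \<forall>h'\<in>RK H. ip H h h' = \<gamma> h * cnj (\<gamma> h') * ip G (\<theta> h) (\<theta> h')))"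

(* G is a rescaling of H in which h r is matched to g r. *)
definition rescaling_matching ::
  "nat set \<Rightarrow> 'v rkhs_data \<Rightarrow> (nat \<Rightarrow> 'v) \<Rightarrow> 'w rkhs_data \<Rightarrow> (nat \<Rightarrow> 'w) \<Rightarrow> bool" where
  "rescaling_matching I G g H h \<longleftrightarrow> (\<exists>\<theta>. rescaling_via \<theta> G H \<and> (\<forall>r\<in>I. \<theta> (h r) = g r))"


definition linear_operator :: "'v::ab_group_add rkhs_data \<Rightarrow> ('v \<Rightarrow> 'v) \<Rightarrow> bool" where
  "linear_operator H M \<longleftrightarrow>
     M ` hspace H \<subseteq> hspace H \<and>
     (\<forall>x\<in>hspace H. \<forall>y\<in>hspace H. M (x + y) = M x + M y) \<and>
     (\<forall>c. \<forall>x\<in>hspace H. M (scl H c x) = scl H c (M x))"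

definition adj :: "'v::ab_group_add rkhs_data \<Rightarrow> ('v \<Rightarrow> 'v) \<Rightarrow> 'v \<Rightarrow> 'v" where
  "adj H M y = (THE z. z \<in> hspace H \<and> (\<forall>x\<in>hspace H. ip H (M x) y = ip H x z))"

definition multiplier :: "'v::ab_group_add rkhs_data \<Rightarrow> ('v \<Rightarrow> 'v) \<Rightarrow> bool" where
  "multiplier H M \<longleftrightarrow> linear_operator H M \<and> (\<forall>k\<in>RK H. \<exists>c. adj H M k = scl H c k)"

(* M on H extends MJ on the regular subspace J. *)
definition extends_multiplier ::
  "'v::ab_group_add rkhs_data \<Rightarrow> ('v \<Rightarrow> 'v) \<Rightarrow> 'v rkhs_data \<Rightarrow> ('v \<Rightarrow> 'v) \<Rightarrow> bool" where
  "extends_multiplier H M J MJ \<longleftrightarrow> (\<forall>x\<in>hspace J. adj H M x = adj J MJ x)"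

(* Norm of (v_j)_{j<t} -> (sum_{j<t} M i j (v_j))_{i<s} from H^t to H^s, both with the
   direct-sum Hilbert space norm. *)
definition matrix_opnorm ::
  "'v::ab_group_add rkhs_data \<Rightarrow> nat \<Rightarrow> nat \<Rightarrow> (nat \<Rightarrow> nat \<Rightarrow> 'v \<Rightarrow> 'v) \<Rightarrow> real" where
  "matrix_opnorm H s t M =
     Sup ((\<lambda>v. sqrt (\<Sum>i<s. (hnorm H (\<Sum>j<t. M i j (v j)))\<^sup>2)) `
          {v. (\<forall>j<t. v j \<in> hspace H) \<and> sqrt (\<Sum>j<t. (hnorm H (v j))\<^sup>2) \<le> 1})"

definition CPP :: "'v::ab_group_add rkhs_data set" where
  "CPP = {H \<in> irreducible_rkhs.
     \<forall>S\<subseteq>RK H. \<forall>s\<ge>1. \<forall>t\<ge>1. \<forall>M.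
       (\<forall>i<s. \<forall>j<t. multiplier (regular_subspace H S) (M i j)) \<longrightarrow>
       (\<exists>N. (\<forall>i<s. \<forall>j<t. multiplier H (N i j) \<and>
                extends_multiplier H (N i j) (regular_subspace H S) (M i j)) \<and>
            matrix_opnorm H s t N = matrix_opnorm (regular_subspace H S) s t M)}"


definition DA_kernel :: "nat \<Rightarrow> point \<Rightarrow> point \<Rightarrow> complex" where
  "DA_kernel n s = (\<lambda>t. if t \<in> complex_ball n then 1 / (1 - hinner n t s) else 0)"

definition fun_scale :: "complex \<Rightarrow> ('a \<Rightarrow> complex) \<Rightarrow> 'a \<Rightarrow> complex" where
  "fun_scale c f = (\<lambda>t. c * f t)"

(* The inner product is the sesquilinear extension of <k_s, k_t> = k_s(t) from the basis of
   kernel functions. *)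
definition DA :: "nat \<Rightarrow> point set \<Rightarrow> (point \<Rightarrow> complex) rkhs_data" where
  "DA n Z = \<lparr>scl = fun_scale,
     ip = (\<lambda>f g. let coef = module.representation fun_scale (DA_kernel n ` Z) in
        \<Sum>s\<in>Z. \<Sum>t\<in>Z. coef f (DA_kernel n s) * cnj (coef g (DA_kernel n t)) * DA_kernel n s t),
     RK = DA_kernel n ` Z\<rparr>"


abbreviation face :: "nat \<Rightarrow> nat set" where
  "face i \<equiv> {1..4} - {i}"

definition tetrahedron_with_faces ::
  "nat \<Rightarrow> (nat \<Rightarrow> nat \<Rightarrow> point) \<Rightarrow> nat \<Rightarrow> (nat \<Rightarrow> point) \<Rightarrow> bool" where
  "tetrahedron_with_faces n y m x \<longleftrightarrow>
     distinct_points m {1..4} x \<and> (\<forall>i\<in>{1..4}. congruent_tuples (face i) n (y i) m x)"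

definition CPP_space_with_faces ::
  "(nat \<Rightarrow> 'v::ab_group_add rkhs_data) \<Rightarrow> (nat \<Rightarrow> nat \<Rightarrow> 'v) \<Rightarrow>
   'w::ab_group_add rkhs_data \<Rightarrow> (nat \<Rightarrow> 'w) \<Rightarrow> bool" where
  "CPP_space_with_faces J j H h \<longleftrightarrow>
     H \<in> CPP \<and> hdim H = 4 \<and> RK H = h ` {1..4} \<and>
     (\<forall>i\<in>{1..4}. rescaling_matching (face i) (J i) (j i) (regular_subspace H (h ` face i)) h)"

end

theory Submission
  imports Defs "HOL-Complex_Analysis.Conformal_Mappings"
begin

text \<open>Congruence of tuples in the ball and rescaling of spaces are both equivalence of Gram matrices
  in the sense \<open>K r s = \<gamma> r * cnj (\<gamma> s) * L r s\<close>: automorphisms multiply \<open>1 - \<langle>z, w\<rangle>\<close> by such factors,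
  and conversely tuples with equivalent matrices \<open>1 / (1 - \<langle>x, y\<rangle>)\<close> are moved to each other by
  reflections of the form of signature \<open>(1, n)\<close>. By the theorem of McCullough and Quiggin, an
  irreducible space has the complete Pick property iff its matrix is equivalent to some
  \<open>1 / (1 - \<langle>x, y\<rangle>)\<close>. Hence (a) and (b) both say that one such matrix of four points restricts to the
  given matrices on the faces. It is determined up to equivalence by its faces, because its
  normalization at a vertex only involves triples of points.\<close>

section \<open>Positive semidefinite kernels on finite index sets\<close>

text \<open>The complete Pick property speaks of operators and norms, the kernels of numbers. The
  bridge is that adjoints of multipliers are diagonal in the basis of kernel functions, so a norm
  bound is semidefiniteness of a matrix indexed by pairs of a kernel function and a row index. For
  necessity, a representation of the kernel on fewer points is itself the test multiplier; each new
  point brings a representation normalized at that point. For sufficiency, multipliers are extended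
  by one point at a time, and the kernel has to be normalized at the point being added; such a
  normalization exists at every base point because automorphisms act transitively on the ball.
  Automorphisms are given abstractly, as biholomorphic bijections; that each of them rescales the
  kernel rests on the Schwarz lemma, whereas the maps needed for existence are written down
  explicitly. Four points enter through a count: a base vertex and two further labels are at most
  three, hence lie in a common face.\<close>

definition sform :: "'a set \<Rightarrow> ('a \<Rightarrow> 'a \<Rightarrow> complex) \<Rightarrow> ('a \<Rightarrow> complex) \<Rightarrow> ('a \<Rightarrow> complex) \<Rightarrow> complex" where
  "sform A Q a b = (\<Sum>x\<in>A. \<Sum>y\<in>A. a x * cnj (b y) * Q x y)"

abbreviation qform :: "'a set \<Rightarrow> ('a \<Rightarrow> 'a \<Rightarrow> complex) \<Rightarrow> ('a \<Rightarrow> complex) \<Rightarrow> complex" where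
  "qform A Q a \<equiv> sform A Q a a"

definition hermitian :: "'a set \<Rightarrow> ('a \<Rightarrow> 'a \<Rightarrow> complex) \<Rightarrow> bool" where
  "hermitian A Q \<longleftrightarrow> (\<forall>x\<in>A. \<forall>y\<in>A. Q y x = cnj (Q x y))"

definition psd :: "'a set \<Rightarrow> ('a \<Rightarrow> 'a \<Rightarrow> complex) \<Rightarrow> bool" where
  "psd A Q \<longleftrightarrow> hermitian A Q \<and> (\<forall>a. 0 \<le> Re (qform A Q a))"

definition pd :: "'a set \<Rightarrow> ('a \<Rightarrow> 'a \<Rightarrow> complex) \<Rightarrow> bool" where
  "pd A Q \<longleftrightarrow> hermitian A Q \<and> (\<forall>a. (\<exists>x\<in>A. a x \<noteq> 0) \<longrightarrow> 0 < Re (qform A Q a))"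

lemma hermitianD: "\<lbrakk>hermitian A Q; x \<in> A; y \<in> A\<rbrakk> \<Longrightarrow> Q y x = cnj (Q x y)"
  unfolding hermitian_def by blast

lemma psd_hermitian: "psd A Q \<Longrightarrow> hermitian A Q"
  by (simp add: psd_def)

lemma psd_nonneg: "psd A Q \<Longrightarrow> 0 \<le> Re (qform A Q a)"
  by (simp add: psd_def)

lemma pd_hermitian: "pd A Q \<Longrightarrow> hermitian A Q"
  by (simp add: pd_def)

lemma pd_pos: "\<lbrakk>pd A Q; \<exists>x\<in>A. a x \<noteq> 0\<rbrakk> \<Longrightarrow> 0 < Re (qform A Q a)"
  unfolding pd_def by blast

lemma sform_cong:
  assumes "\<And>x. x \<in> A \<Longrightarrow> a x = a' x" "\<And>x. x \<in> A \<Longrightarrow> b x = b' x"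
    and "\<And>x y. \<lbrakk>x \<in> A; y \<in> A\<rbrakk> \<Longrightarrow> Q x y = Q' x y"
  shows "sform A Q a b = sform A Q' a' b'"
  unfolding sform_def using assms by (intro sum.cong) auto

lemma psd_cong:
  assumes "\<And>x y. \<lbrakk>x \<in> A; y \<in> A\<rbrakk> \<Longrightarrow> Q x y = Q' x y"
  shows "psd A Q \<longleftrightarrow> psd A Q'"
proof -
  have "qform A Q a = qform A Q' a" for a by (intro sform_cong assms) auto
  moreover have "hermitian A Q \<longleftrightarrow> hermitian A Q'" using assms by (simp add: hermitian_def)
  ultimately show ?thesis by (simp add: psd_def)
qed

lemma pd_imp_psd: "pd A Q \<Longrightarrow> psd A Q"
proof -
  assume pd: "pd A Q"
  have "0 \<le> Re (qform A Q a)" for a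
  proof (cases "\<exists>x\<in>A. a x \<noteq> 0")
    case True then show ?thesis using pd by (auto simp: pd_def intro: less_imp_le)
  next
    case False then show ?thesis by (simp add: sform_def)
  qed
  then show ?thesis using pd by (simp add: psd_def pd_def)
qed

lemma sform_left: "sform A Q a b = (\<Sum>x\<in>A. a x * (\<Sum>y\<in>A. cnj (b y) * Q x y))"
  unfolding sform_def by (simp add: sum_distrib_left mult.assoc)

lemma sform_right: "sform A Q a b = (\<Sum>y\<in>A. cnj (b y) * (\<Sum>x\<in>A. a x * Q x y))"
  unfolding sform_def by (subst sum.swap) (simp add: sum_distrib_left mult_ac)

lemma sform_add_left: "sform A Q (\<lambda>x. a x + b x) c = sform A Q a c + sform A Q b c"
  by (simp add: sform_left algebra_simps sum.distrib)

lemma sform_add_right: "sform A Q c (\<lambda>x. a x + b x) = sform A Q c a + sform A Q c b"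
  by (simp add: sform_right algebra_simps sum.distrib)

lemma sform_scale_left: "sform A Q (\<lambda>x. t * a x) c = t * sform A Q a c"
  by (simp add: sform_left sum_distrib_left mult_ac)

lemma sform_scale_right: "sform A Q c (\<lambda>x. t * a x) = cnj t * sform A Q c a"
  by (simp add: sform_right sum_distrib_left mult_ac)

lemma sform_kernel_add: "sform A (\<lambda>x y. P x y + Q x y) a b = sform A P a b + sform A Q a b"
  by (simp add: sform_def algebra_simps sum.distrib)

lemma sform_kernel_diff: "sform A (\<lambda>x y. P x y - Q x y) a b = sform A P a b - sform A Q a b"
  by (simp add: sform_def algebra_simps sum_subtractf)

lemma sform_kernel_scale: "sform A (\<lambda>x y. c * Q x y) a b = c * sform A Q a b"
  by (simp add: sform_def sum_distrib_left mult_ac)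

lemma sform_kernel_sum:
  "sform A (\<lambda>x y. \<Sum>k\<in>B. Q k x y) a b = (\<Sum>k\<in>B. sform A (Q k) a b)"
proof -
  have "sform A (\<lambda>x y. \<Sum>k\<in>B. Q k x y) a b = (\<Sum>x\<in>A. \<Sum>k\<in>B. \<Sum>y\<in>A. a x * cnj (b y) * Q k x y)"
    unfolding sform_def sum_distrib_left by (intro sum.cong refl, subst sum.swap) simp
  also have "\<dots> = (\<Sum>k\<in>B. sform A (Q k) a b)"
    unfolding sform_def by (subst sum.swap) simp
  finally show ?thesis .
qed

lemma sform_kernel_conj:
  "sform A (\<lambda>x y. c x * cnj (d y) * Q x y) a b = sform A Q (\<lambda>x. a x * c x) (\<lambda>x. b x * d x)"
  by (simp add: sform_def mult_ac)

lemma sform_rank_one: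
  "sform A (\<lambda>x y. c x * cnj (d y)) a b = (\<Sum>x\<in>A. a x * c x) * cnj (\<Sum>x\<in>A. b x * d x)"
  by (simp add: sform_def sum_product mult_ac)

lemma sform_cnj:
  assumes "hermitian A Q"
  shows "sform A Q b a = cnj (sform A Q a b)"
proof -
  have "cnj (sform A Q a b) = (\<Sum>x\<in>A. \<Sum>y\<in>A. cnj (a x) * b y * Q y x)"
    unfolding sform_def by (auto intro!: sum.cong simp flip: hermitianD[OF assms])
  then show ?thesis unfolding sform_def by (subst sum.swap) (simp add: mult_ac)
qed

lemma sform_supported:
  assumes "finite B" "A \<subseteq> B" "\<And>x. x \<in> B - A \<Longrightarrow> a x = 0" "\<And>x. x \<in> B - A \<Longrightarrow> b x = 0"
  shows "sform B Q a b = sform A Q a b"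
proof -
  have "(\<Sum>y\<in>B. a x * cnj (b y) * Q x y) = (\<Sum>y\<in>A. a x * cnj (b y) * Q x y)" for x
    by (rule sum.mono_neutral_right) (use assms in auto)
  then show ?thesis
    unfolding sform_def by simp (rule sum.mono_neutral_right, use assms in auto)
qed

lemma sform_indicator:
  assumes "finite A" "e \<in> A"
  shows "sform A Q (\<lambda>x. if x = e then t else 0) b = t * (\<Sum>y\<in>A. cnj (b y) * Q e y)"
    and "sform A Q b (\<lambda>x. if x = e then t else 0) = cnj t * (\<Sum>x\<in>A. b x * Q x e)"
proof -
  have "(\<Sum>x\<in>A. (if x = e then t else 0) * (\<Sum>y\<in>A. cnj (b y) * Q x y)) =
      (\<Sum>x\<in>A. if x = e then t * (\<Sum>y\<in>A. cnj (b y) * Q x y) else 0)"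
    by (rule sum.cong) auto
  then show "sform A Q (\<lambda>x. if x = e then t else 0) b = t * (\<Sum>y\<in>A. cnj (b y) * Q e y)"
    using assms by (simp add: sform_left)
  have "(\<Sum>x\<in>A. cnj (if x = e then t else 0) * (\<Sum>y\<in>A. b y * Q y x)) =
      (\<Sum>x\<in>A. if x = e then cnj t * (\<Sum>y\<in>A. b y * Q y x) else 0)"
    by (rule sum.cong) auto
  then show "sform A Q b (\<lambda>x. if x = e then t else 0) = cnj t * (\<Sum>x\<in>A. b x * Q x e)"
    using assms by (simp add: sform_right)
qed

lemma hermitian_subset: "\<lbrakk>hermitian B Q; A \<subseteq> B\<rbrakk> \<Longrightarrow> hermitian A Q"
  by (auto simp: hermitian_def)

lemma psd_subset:
  assumes "psd B Q" "A \<subseteq> B" "finite B"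
  shows "psd A Q"
proof -
  have "0 \<le> Re (qform A Q a)" for a
  proof -
    let ?a = "\<lambda>x. if x \<in> A then a x else 0"
    have "qform B Q ?a = qform A Q ?a" by (rule sform_supported) (use assms in auto)
    also have "\<dots> = qform A Q a" by (rule sform_cong) auto
    finally show ?thesis using psd_nonneg[OF assms(1)] by metis
  qed
  then show ?thesis using hermitian_subset[OF psd_hermitian[OF assms(1)] assms(2)] by (simp add: psd_def)
qed

lemma pd_subset:
  assumes "pd B Q" "A \<subseteq> B" "finite B"
  shows "pd A Q"
proof -
  have "0 < Re (qform A Q a)" if "\<exists>x\<in>A. a x \<noteq> 0" for a
  proof -
    let ?a = "\<lambda>x. if x \<in> A then a x else 0"
    have "qform B Q ?a = qform A Q ?a" by (rule sform_supported) (use assms in auto)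
    also have "\<dots> = qform A Q a" by (rule sform_cong) auto
    finally have "qform B Q ?a = qform A Q a" .
    moreover have "\<exists>x\<in>B. ?a x \<noteq> 0" using that assms(2) by auto
    then have "0 < Re (qform B Q ?a)" by (rule pd_pos[OF assms(1)])
    ultimately show ?thesis by simp
  qed
  then show ?thesis using hermitian_subset[OF pd_hermitian[OF assms(1)] assms(2)] by (simp add: pd_def)
qed

text \<open>Adding \<open>t\<close> times the unit vector of \<open>e\<close> to a null vector
  changes the form to first order by twice the real part of \<open>t u\<close>. A nonzero
  \<open>u\<close> would allow a phase and a step length that make the form negative.\<close>

lemma psd_null:
  assumes "finite A" "psd A Q" "Re (qform A Q a) = 0" "e \<in> A"
  shows "(\<Sum>y\<in>A. cnj (a y) * Q e y) = 0"
proof (rule ccontr)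
  define u where "u = (\<Sum>y\<in>A. cnj (a y) * Q e y)"
  define q where "q = Re (Q e e)"
  assume "\<not> ?thesis"
  then have u: "cmod u > 0" by (simp add: u_def)
  let ?d = "\<lambda>t x. if x = e then t else (0::complex)"
  have h: "hermitian A Q" using assms by (simp add: psd_hermitian)
  have dd: "qform A Q (?d t) = t * cnj t * Q e e" for t
    unfolding sform_indicator(1)[OF assms(1,4)]
  proof -
    have "(\<Sum>y\<in>A. cnj (?d t y) * Q e y) = (\<Sum>y\<in>A. if y = e then cnj t * Q e y else 0)"
      by (rule sum.cong) auto
    then show "t * (\<Sum>y\<in>A. cnj (?d t y) * Q e y) = t * cnj t * Q e e"
      using assms(1,4) by simp
  qed
  have key: "0 \<le> 2 * Re (t * u) + (cmod t)\<^sup>2 * q" for t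
  proof -
    have "0 \<le> Re (qform A Q (\<lambda>x. a x + ?d t x))"
      using assms(2) by (rule psd_nonneg)
    also have "qform A Q (\<lambda>x. a x + ?d t x) =
       qform A Q a + sform A Q a (?d t) + sform A Q (?d t) a + qform A Q (?d t)"
      by (simp add: sform_add_left sform_add_right)
    also have "sform A Q a (?d t) = cnj (sform A Q (?d t) a)" by (rule sform_cnj[OF h])
    also have "sform A Q (?d t) a = t * u" unfolding u_def using assms by (intro sform_indicator) auto
    finally show ?thesis
      using assms(3) by (simp add: dd q_def flip: complex_norm_square)
  qed
  have q0: "0 \<le> q"
    using psd_nonneg[OF assms(2), of "?d 1"] by (simp add: dd q_def)
  \<comment> \<open>The minimizing step length is \<open>1 / q\<close>; the \<open>+ 1\<close>
    covers \<open>q = 0\<close> and still makes the value negative.\<close>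
  let ?r = "1 / (q + 1)"
  have "0 \<le> 2 * Re (- of_real ?r * cnj u * u) + (cmod (- of_real ?r * cnj u))\<^sup>2 * q"
    by (rule key)
  also have "- of_real ?r * cnj u * u = - of_real (?r * (cmod u)\<^sup>2)"
    by (metis complex_norm_square mult.assoc mult.commute mult_minus_left of_real_mult)
  also have "(cmod (- of_real ?r * cnj u))\<^sup>2 = ?r\<^sup>2 * (cmod u)\<^sup>2"
    by (simp only: norm_mult norm_minus_cancel norm_of_real complex_mod_cnj power_mult_distrib power2_abs)
  finally have "0 \<le> (cmod u)\<^sup>2 * (- 2 * ?r + ?r\<^sup>2 * q)" by (simp add: algebra_simps)
  then have "0 \<le> - 2 * ?r + ?r\<^sup>2 * q" using u by (simp add: zero_le_mult_iff)
  also have "- 2 * ?r + ?r\<^sup>2 * q = - (q + 2) / (q + 1)\<^sup>2"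
    using q0 by (simp add: power2_eq_square divide_simps)
  also have "\<dots> < 0" using q0 by (simp add: divide_simps)
  finally show False by simp
qed

section \<open>Schur complements\<close>

lemma hermitian_diag_real: "\<lbrakk>hermitian A Q; e \<in> A\<rbrakk> \<Longrightarrow> Q e e = of_real (Re (Q e e))"
  using hermitianD[of A Q e e] by (simp add: complex_eq_iff)

text \<open>Schur complement at a nonzero pivot \<open>Q e e\<close>: for a Gram matrix it is the
  Gram matrix of the components orthogonal to the vector with index \<open>e\<close>.\<close>

definition schur :: "'a \<Rightarrow> ('a \<Rightarrow> 'a \<Rightarrow> complex) \<Rightarrow> 'a \<Rightarrow> 'a \<Rightarrow> complex" where
  "schur e Q x y = Q x y - Q x e * Q e y / Q e e"

lemma sform_insert:
  assumes "finite A" "e \<notin> A"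
  shows "sform (insert e A) Q a b = sform A Q a b + a e * (\<Sum>y\<in>A. cnj (b y) * Q e y)
     + cnj (b e) * (\<Sum>x\<in>A. a x * Q x e) + a e * cnj (b e) * Q e e"
  using assms by (simp add: sform_def sum.distrib sum_distrib_left algebra_simps)

text \<open>Completing the square in the coefficient \<open>a e\<close>.\<close>

lemma sform_insert_schur:
  assumes "finite A" "e \<notin> A" "hermitian (insert e A) Q" "Q e e \<noteq> 0"
  defines "s a \<equiv> \<Sum>x\<in>A. a x * Q x e"
  shows "qform (insert e A) Q a =
    qform A (schur e Q) a + (a e * Q e e + s a) * cnj (a e * Q e e + s a) / Q e e"
proof -
  have c: "cnj (Q e e) = Q e e" using hermitianD[OF assms(3), of e e] by simp
  have s: "(\<Sum>y\<in>A. cnj (a y) * Q e y) = cnj (s a)"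
    unfolding s_def cnj_sum by (rule sum.cong) (auto simp flip: hermitianD[OF assms(3)])
  have 1: "qform A (\<lambda>x y. Q x e * Q e y / Q e e) a = s a * cnj (s a) / Q e e"
  proof -
    have "qform A (\<lambda>x y. Q x e * Q e y / Q e e) a = qform A (\<lambda>x y. 1 / Q e e * (Q x e * cnj (Q y e))) a"
      by (intro sform_cong) (auto simp flip: hermitianD[OF assms(3)])
    then show ?thesis unfolding sform_kernel_scale sform_rank_one s_def by simp
  qed
  show ?thesis
    unfolding schur_def sform_kernel_diff 1 sform_insert[OF assms(1,2)] s s_def[symmetric]
    using assms(4) by (simp add: c field_simps)
qed

text \<open>The new coefficient at \<open>e\<close> is the one for which the completed square
  vanishes. This is how positivity passes to the Schur complement.\<close>

lemma sform_schur:
  assumes "finite A" "e \<notin> A" "hermitian (insert e A) Q" "Q e e \<noteq> 0"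
  shows "qform A (schur e Q) a = qform (insert e A) Q (a(e := - (\<Sum>x\<in>A. a x * Q x e) / Q e e))"
proof -
  let ?a = "a(e := - (\<Sum>x\<in>A. a x * Q x e) / Q e e)"
  have "(\<Sum>x\<in>A. ?a x * Q x e) = (\<Sum>x\<in>A. a x * Q x e)" using assms(2) by (intro sum.cong) auto
  moreover have "qform A (schur e Q) ?a = qform A (schur e Q) a" using assms(2) by (intro sform_cong) auto
  ultimately show ?thesis unfolding sform_insert_schur[OF assms] using assms(4) by simp
qed

text \<open>The completed square is nonnegative because the pivot is positive. Dropping it removes
  all dependence on the coefficient at \<open>e\<close>.\<close>

lemma sform_schur_le:
  assumes "finite A" "e \<notin> A" "hermitian (insert e A) Q" "0 < Re (Q e e)"
  shows "Re (qform A (schur e Q) a) \<le> Re (qform (insert e A) Q a)"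
proof -
  define q z where "q = Re (Q e e)" and "z = a e * Q e e + (\<Sum>x\<in>A. a x * Q x e)"
  have Q: "Q e e = of_real q" unfolding q_def by (rule hermitian_diag_real[OF assms(3)]) simp
  have "Q e e \<noteq> 0" using assms(4) by auto
  from sform_insert_schur[OF assms(1-3) this, of a]
  have "qform (insert e A) Q a = qform A (schur e Q) a + z * cnj z / of_real q"
    by (simp only: z_def[symmetric] Q[symmetric])
  also have "z * cnj z / of_real q = of_real ((cmod z)\<^sup>2 / q)"
    by (simp only: complex_norm_square of_real_divide)
  finally show ?thesis using assms(4) by (simp add: q_def)
qed

lemma hermitian_schur:
  assumes "hermitian (insert e A) Q" shows "hermitian A (schur e Q)"
  unfolding hermitian_def schur_def
proof (intro ballI)
  fix x y assume "x \<in> A" "y \<in> A"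
  then have "Q y x = cnj (Q x y)" "Q y e = cnj (Q e y)" "Q e x = cnj (Q x e)" "cnj (Q e e) = Q e e"
    by (auto simp flip: hermitianD[OF assms])
  then show "Q y x - Q y e * Q e x / Q e e = cnj (Q x y - Q x e * Q e y / Q e e)"
    by (simp only: complex_cnj_diff complex_cnj_divide complex_cnj_mult mult.commute)
qed

lemma psd_schur:
  assumes "finite A" "e \<notin> A" "psd (insert e A) Q" "Q e e \<noteq> 0"
  shows "psd A (schur e Q)"
  unfolding psd_def sform_schur[OF assms(1,2) psd_hermitian[OF assms(3)] assms(4)]
  using hermitian_schur[OF psd_hermitian[OF assms(3)]] psd_nonneg[OF assms(3)] by blast

text \<open>The indicator of \<open>e\<close> is a null vector, so \<open>psd_null\<close> applies
  to it.\<close>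

lemma psd_diag_zero:
  assumes "finite A" "psd A Q" "e \<in> A" "Q e e = 0" "x \<in> A"
  shows "Q x e = 0" "Q e x = 0"
proof -
  let ?a = "\<lambda>x. if x = e then 1 else (0::complex)"
  have s: "(\<Sum>y\<in>A. cnj (?a y) * Q x y) = Q x e" for x
    using assms by (simp add: if_distrib[of cnj] if_distrib[of "\<lambda>x. x * _"] cong: if_cong)
  have "qform A Q ?a = 1 * (\<Sum>y\<in>A. cnj (?a y) * Q e y)"
    using assms by (intro sform_indicator) auto
  also have "\<dots> = 0" unfolding s using assms by simp
  finally have "Re (qform A Q ?a) = 0" by simp
  from psd_null[OF assms(1,2) this assms(5)] show 1: "Q x e = 0" unfolding s .
  then show "Q e x = 0" using hermitianD[OF psd_hermitian[OF assms(2)] assms(5,3)] by simp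
qed

lemma psd_solve:
  assumes "finite A" "psd A Q"
    and "\<And>a. Re (qform A Q a) = 0 \<Longrightarrow> (\<Sum>y\<in>A. cnj (a y) * b y) = 0"
  shows "\<exists>z. \<forall>y\<in>A. b y = (\<Sum>x\<in>A. z x * Q x y)"
  using assms
proof (induction A arbitrary: Q b rule: finite_induct)
  case (insert e A)
  note psd = insert.prems(1) and null = insert.prems(2)
  have h: "hermitian (insert e A) Q" using psd by (rule psd_hermitian)
  show ?case
  proof (cases "Q e e = 0")
    case True
    have z: "Q x e = 0" "Q e x = 0" if "x \<in> insert e A" for x
      using psd_diag_zero[OF _ psd _ True that] insert.hyps by auto
    have fm: "qform (insert e A) Q a = qform A Q a" for a
      unfolding sform_insert[OF insert.hyps] using z by simp
    have "\<exists>z. \<forall>y\<in>A. b y = (\<Sum>x\<in>A. z x * Q x y)"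
    proof (rule insert.IH)
      show "psd A Q" using psd by (rule psd_subset) (use insert.hyps in auto)
      fix a assume "Re (qform A Q a) = 0"
      moreover have "qform A Q (a(e := 0)) = qform A Q a"
        using insert.hyps by (intro sform_cong) auto
      ultimately have "(\<Sum>y\<in>insert e A. cnj ((a(e := 0)) y) * b y) = 0" by (intro null) (simp add: fm del: fun_upd_apply)
      then have "(\<Sum>y\<in>A. cnj ((a(e := 0)) y) * b y) = 0" using insert.hyps by simp
      also have "(\<Sum>y\<in>A. cnj ((a(e := 0)) y) * b y) = (\<Sum>y\<in>A. cnj (a y) * b y)"
        using insert.hyps by (intro sum.cong) auto
      finally show "(\<Sum>y\<in>A. cnj (a y) * b y) = 0" .
    qed
    then obtain z0 where z0: "\<forall>y\<in>A. b y = (\<Sum>x\<in>A. z0 x * Q x y)" ..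
    \<comment> \<open>The indicator of \<open>e\<close> is a null vector here, so the compatibility
      condition will give \<open>b e = 0\<close>.\<close>
    have "qform A Q (\<lambda>x. if x = e then 1 else 0) = qform A Q (\<lambda>_. 0)"
      using insert.hyps by (intro sform_cong) auto
    also have "\<dots> = 0" by (simp add: sform_def)
    finally have "(\<Sum>y\<in>insert e A. cnj (if y = e then 1 else 0) * b y) = 0"
      by (intro null) (simp add: fm)
    then have "b e = 0"
      using insert.hyps by (simp add: if_distrib[of cnj] if_distrib[of "\<lambda>x. x * _"] cong: if_cong)
    then have "\<forall>y\<in>insert e A. b y = (\<Sum>x\<in>insert e A. z0 x * Q x y)"
      using z0 z insert.hyps by auto
    then show ?thesis by blast
  next
    case False
    \<comment> \<open>Right-hand side after elimination of the unknown at \<open>e\<close>. Null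
      vectors of the Schur complement lift to null vectors of \<open>Q\<close>, which keeps the
      reduced system compatible.\<close>
    define b' where "b' y = b y - b e * Q e y / Q e e" for y
    have "\<exists>z. \<forall>y\<in>A. b' y = (\<Sum>x\<in>A. z x * schur e Q x y)"
    proof (rule insert.IH)
      show "psd A (schur e Q)" using insert.hyps psd False by (rule psd_schur)
      fix a assume a: "Re (qform A (schur e Q) a) = 0"
      define s where "s = (\<Sum>x\<in>A. a x * Q x e)"
      have s: "(\<Sum>y\<in>A. cnj (a y) * Q e y) = cnj s"
        unfolding s_def cnj_sum by (rule sum.cong) (auto simp flip: hermitianD[OF h])
      have "(\<Sum>y\<in>insert e A. cnj ((a(e := - s / Q e e)) y) * b y) = 0"
        by (rule null) (use a sform_schur[OF insert.hyps h False, of a] in \<open>simp add: s_def del: fun_upd_apply\<close>)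
      then have "cnj (- s / Q e e) * b e + (\<Sum>y\<in>A. cnj ((a(e := - s / Q e e)) y) * b y) = 0"
        using insert.hyps by simp
      also have "(\<Sum>y\<in>A. cnj ((a(e := - s / Q e e)) y) * b y) = (\<Sum>y\<in>A. cnj (a y) * b y)"
        using insert.hyps by (intro sum.cong) auto
      finally have 1: "(\<Sum>y\<in>A. cnj (a y) * b y) = cnj s / Q e e * b e"
        using hermitianD[OF h, of e e] by (simp add: field_simps add_eq_0_iff)
      have "(\<Sum>y\<in>A. cnj (a y) * b' y) = (\<Sum>y\<in>A. cnj (a y) * b y) - (\<Sum>y\<in>A. cnj (a y) * Q e y) * b e / Q e e"
        by (simp add: b'_def right_diff_distrib sum_subtractf sum_distrib_left sum_distrib_right sum_divide_distrib mult_ac)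
      then show "(\<Sum>y\<in>A. cnj (a y) * b' y) = 0" unfolding 1 s by simp
    qed
    then obtain z where z: "\<And>y. y \<in> A \<Longrightarrow> b' y = (\<Sum>x\<in>A. z x * schur e Q x y)" by blast
    \<comment> \<open>Back substitution: the equation at \<open>e\<close> determines the remaining
      unknown.\<close>
    define z' where "z' = z(e := b e / Q e e - (\<Sum>x\<in>A. z x * Q x e) / Q e e)"
    have zz: "(\<Sum>x\<in>A. z' x * Q x y) = (\<Sum>x\<in>A. z x * Q x y)" for y
      using insert.hyps by (intro sum.cong) (auto simp: z'_def)
    have "b y = (\<Sum>x\<in>insert e A. z' x * Q x y)" if "y \<in> insert e A" for y
    proof (cases "y = e")
      case True
      then show ?thesis using insert.hyps False by (simp add: zz) (simp add: z'_def algebra_simps)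
    next
      case ne: False
      then have "b y = b e * Q e y / Q e e + (\<Sum>x\<in>A. z x * schur e Q x y)"
        using z[of y] that by (simp add: b'_def algebra_simps)
      also have "(\<Sum>x\<in>A. z x * schur e Q x y) =
          (\<Sum>x\<in>A. z x * Q x y) - (\<Sum>x\<in>A. z x * Q x e) * Q e y / Q e e"
        by (simp add: schur_def right_diff_distrib sum_subtractf sum_distrib_left sum_divide_distrib mult_ac)
      finally show ?thesis
        using insert.hyps by (simp add: zz) (simp add: z'_def algebra_simps diff_divide_distrib)
    qed
    then show ?thesis by blast
  qed
qed auto

text \<open>Cholesky factorization: each nonzero pivot contributes one new coordinate, a zero pivot
  the zero vector.\<close>

lemma psd_factor:
  assumes "finite A" "psd A Q"
  shows "\<exists>m g. \<forall>x\<in>A. \<forall>y\<in>A. Q x y = (\<Sum>k<(m::nat). g x k * cnj (g y k))"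
  using assms
proof (induction A arbitrary: Q rule: finite_induct)
  case (insert e A)
  note psd = insert.prems
  have h: "hermitian (insert e A) Q" using psd by (rule psd_hermitian)
  show ?case
  proof (cases "Q e e = 0")
    case True
    have z: "Q x e = 0" "Q e x = 0" if "x \<in> insert e A" for x
      using psd_diag_zero[OF _ psd _ True that] insert.hyps by auto
    have "psd A Q" using psd by (rule psd_subset) (use insert.hyps in auto)
    then obtain m g where "\<forall>x\<in>A. \<forall>y\<in>A. Q x y = (\<Sum>k<(m::nat). g x k * cnj (g y k))"
      using insert.IH by blast
    then have "\<forall>x\<in>insert e A. \<forall>y\<in>insert e A.
        Q x y = (\<Sum>k<m. (g(e := \<lambda>_. 0)) x k * cnj ((g(e := \<lambda>_. 0)) y k))"
      using z insert.hyps by auto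
    then show ?thesis by blast
  next
    case False
    obtain m g where g: "\<forall>x\<in>A. \<forall>y\<in>A. schur e Q x y = (\<Sum>k<(m::nat). g x k * cnj (g y k))"
      using insert.IH[OF psd_schur[OF insert.hyps psd False]] by blast
    define q where "q = Re (Q e e)"
    have qe: "Q e e = of_real q" unfolding q_def by (rule hermitian_diag_real[OF h]) simp
    have "0 \<le> Re (qform {e} Q (\<lambda>_. 1))"
      using psd_subset[OF psd, of "{e}"] insert.hyps by (intro psd_nonneg) auto
    then have q: "q > 0" using False qe by (simp add: sform_def)
    define w where "w = complex_of_real (sqrt q)"
    have w: "w * cnj w = Q e e" "w \<noteq> 0" "cnj w = w" using q by (simp_all add: w_def qe flip: of_real_mult)
    \<comment> \<open>The old coordinates vanish at \<open>e\<close>; the new one, of index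
      \<open>m\<close>, accounts for the rank one term that \<open>schur\<close> subtracts.\<close>
    define g' where "g' x k = (if k < m then (if x = e then 0 else g x k) else Q x e / w)" for x k
    have "Q x y = (\<Sum>k<Suc m. g' x k * cnj (g' y k))" if xy: "x \<in> insert e A" "y \<in> insert e A" for x y
    proof -
      have cy: "cnj (Q y e) = Q e y" using hermitianD[OF h, of y e] xy by simp
      have last: "g' x m * cnj (g' y m) = Q x e * Q e y / Q e e"
        unfolding w(1)[symmetric] using cy by (simp add: g'_def)
      have "(\<Sum>k<m. g' x k * cnj (g' y k)) = schur e Q x y"
      proof (cases "x = e \<or> y = e")
        case True
        then show ?thesis using False by (auto simp: g'_def schur_def)
      next
        case ne: False
        then have "schur e Q x y = (\<Sum>k<m. g x k * cnj (g y k))" using g xy by auto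
        then show ?thesis using ne by (simp add: g'_def)
      qed
      then show ?thesis by (simp add: last schur_def)
    qed
    then show ?thesis by blast
  qed
qed auto

text \<open>The vectors \<open>l x\<close> are the images of the index basis under a linear map; it is extended by
  composing it with the \<open>Q\<close>-orthogonal projection onto the span of \<open>A\<close>.\<close>

lemma psd_extend_one:
  fixes l :: "'a \<Rightarrow> nat \<Rightarrow> complex"
  assumes "finite A" "e \<notin> A" "psd (insert e A) Q"
    and "psd A (\<lambda>x y. Q x y - (\<Sum>j<t. l x j * cnj (l y j)))"
  shows "\<exists>v. psd (insert e A) (\<lambda>x y. Q x y - (\<Sum>j<t. (l(e := v)) x j * cnj ((l(e := v)) y j)))"
proof -
  have h: "hermitian (insert e A) Q" using assms(3) by (rule psd_hermitian)
  have psdA: "psd A Q" using assms(3) by (rule psd_subset) (use assms(1) in auto)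
  \<comment> \<open>\<open>z\<close> holds the coefficients of the projection of \<open>e\<close> to
    the span of \<open>A\<close>. Null vectors of the form on \<open>A\<close> remain null on
    \<open>insert e A\<close>, which makes the system solvable.\<close>
  have "\<exists>z. \<forall>y\<in>A. Q e y = (\<Sum>x\<in>A. z x * Q x y)"
  proof (rule psd_solve[OF assms(1) psdA])
    fix a assume a: "Re (qform A Q a) = 0"
    have "qform (insert e A) Q (a(e := 0)) = qform A Q (a(e := 0))"
      by (rule sform_supported) (use assms(1,2) in auto)
    also have "\<dots> = qform A Q a" using assms(2) by (intro sform_cong) auto
    finally have "(\<Sum>y\<in>insert e A. cnj ((a(e := 0)) y) * Q e y) = 0"
      using a assms(1) by (intro psd_null[OF _ assms(3)]) (simp_all del: fun_upd_apply)
    then have "(\<Sum>y\<in>A. cnj ((a(e := 0)) y) * Q e y) = 0" using assms by simp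
    also have "(\<Sum>y\<in>A. cnj ((a(e := 0)) y) * Q e y) = (\<Sum>y\<in>A. cnj (a y) * Q e y)"
      using assms(2) by (intro sum.cong) auto
    finally show "(\<Sum>y\<in>A. cnj (a y) * Q e y) = 0" .
  qed
  then obtain z where z: "\<And>y. y \<in> A \<Longrightarrow> Q e y = (\<Sum>x\<in>A. z x * Q x y)" by blast
  define v where "v j = (\<Sum>x\<in>A. z x * l x j)" for j
  define l' where "l' = l(e := v)"
  define P where "P x y = Q x y - (\<Sum>j<t. l' x j * cnj (l' y j))" for x y
  \<comment> \<open>Squared distance of \<open>e\<close> from the span of \<open>A\<close>: the
    value of the form at \<open>e\<close> minus its projection.\<close>
  define p where "p = Q e e - (\<Sum>x\<in>A. z x * Q x e)"
  have p: "0 \<le> Re p"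
  proof -
    let ?a = "(\<lambda>x. - z x)(e := 1)"
    have "0 \<le> Re (qform (insert e A) Q ?a)" by (rule psd_nonneg[OF assms(3)])
    also have "qform (insert e A) Q ?a =
        (\<Sum>y\<in>insert e A. cnj (?a y) * (Q e y - (\<Sum>x\<in>A. z x * Q x y)))"
    proof -
      have "(\<Sum>x\<in>insert e A. ?a x * Q x y) = Q e y - (\<Sum>x\<in>A. z x * Q x y)" for y
      proof -
        have "(\<Sum>x\<in>A. ?a x * Q x y) = (\<Sum>x\<in>A. - (z x * Q x y))" using assms(2) by (intro sum.cong) auto
        then show ?thesis using assms(1,2) by (simp add: sum_negf)
      qed
      then show ?thesis by (simp add: sform_right)
    qed
    also have "\<dots> = p + (\<Sum>y\<in>A. cnj (?a y) * (Q e y - (\<Sum>x\<in>A. z x * Q x y)))"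
      using assms(1,2) by (simp add: p_def)
    also have "(\<Sum>y\<in>A. cnj (?a y) * (Q e y - (\<Sum>x\<in>A. z x * Q x y))) = 0"
      using z by (intro sum.neutral) auto
    finally show ?thesis by simp
  qed
  have "0 \<le> Re (qform (insert e A) P a)" for a
  proof -
    \<comment> \<open>Coefficients on \<open>A\<close> of the projected vector. The form of
      \<open>Q\<close> at \<open>a\<close> exceeds the form at the projection by \<open>p\<close>
      times the squared modulus of \<open>a e\<close>, and \<open>l'\<close> does not distinguish
      the two vectors.\<close>
    define a' where "a' x = a x + a e * z x" for x
    have lv: "(\<Sum>x\<in>insert e A. a x * l' x j) = (\<Sum>x\<in>A. a' x * l x j)" for j
    proof -
      have "(\<Sum>x\<in>A. a x * l' x j) = (\<Sum>x\<in>A. a x * l x j)"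
        using assms(2) by (intro sum.cong) (auto simp: l'_def)
      then show ?thesis
        using assms(1,2) by (simp add: a'_def l'_def v_def algebra_simps sum.distrib sum_distrib_left)
    qed
    have cz: "Q x e = (\<Sum>y\<in>A. cnj (z y) * Q x y)" if "x \<in> A" for x
    proof -
      have "Q x e = cnj (Q e x)" using hermitianD[OF h, of e x] that by simp
      also have "\<dots> = (\<Sum>y\<in>A. cnj (z y) * cnj (Q y x))" by (simp add: z[OF that])
      also have "\<dots> = (\<Sum>y\<in>A. cnj (z y) * Q x y)"
        using that by (intro sum.cong) (auto simp flip: hermitianD[OF h])
      finally show ?thesis .
    qed
    have q: "qform (insert e A) Q a = qform A Q a' + a e * cnj (a e) * p"
    proof -
      have 1: "(\<Sum>y\<in>A. cnj (b y) * Q e y) = sform A Q z b" for b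
        by (simp add: sform_right z)
      have 2: "(\<Sum>x\<in>A. b x * Q x e) = sform A Q b z" for b
        by (simp add: sform_left cz)
      show ?thesis
        unfolding sform_insert[OF assms(1,2)] p_def 1 2 a'_def sform_add_left sform_add_right
          sform_scale_left sform_scale_right
        by (simp add: algebra_simps)
    qed
    have l1: "qform B (\<lambda>x y. \<Sum>j\<in>T. f x j * cnj (f y j)) c = (\<Sum>j\<in>T. (\<Sum>x\<in>B. c x * f x j) * cnj (\<Sum>x\<in>B. c x * f x j))"
      for B c T and f :: "'a \<Rightarrow> nat \<Rightarrow> complex"
      by (simp add: sform_kernel_sum sform_rank_one)
    have l2: "qform (insert e A) (\<lambda>x y. \<Sum>j<t. l' x j * cnj (l' y j)) a =
        qform A (\<lambda>x y. \<Sum>j<t. l x j * cnj (l y j)) a'"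
      unfolding l1[where f = l'] l1[where f = l] lv ..
    have "qform (insert e A) P a =
       qform A (\<lambda>x y. Q x y - (\<Sum>j<t. l x j * cnj (l y j))) a' + a e * cnj (a e) * p"
      unfolding P_def sform_kernel_diff q l2 by simp
    also have "Re \<dots> = Re (qform A (\<lambda>x y. Q x y - (\<Sum>j<t. l x j * cnj (l y j))) a') + (cmod (a e))\<^sup>2 * Re p"
      by (simp flip: complex_norm_square)
    finally show ?thesis using psd_nonneg[OF assms(4), of a'] p by simp
  qed
  moreover have "hermitian (insert e A) P"
    unfolding hermitian_def P_def by (auto simp: mult.commute simp flip: hermitianD[OF h])
  ultimately have "psd (insert e A) P" by (simp add: psd_def)
  then show ?thesis unfolding P_def l'_def by blast
qed

lemma psd_extend:
  fixes l :: "'a \<Rightarrow> nat \<Rightarrow> complex"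
  assumes "finite E" "finite A" "A \<inter> E = {}" "psd (A \<union> E) Q"
    and "psd A (\<lambda>x y. Q x y - (\<Sum>j<t. l x j * cnj (l y j)))"
  shows "\<exists>l'. (\<forall>x\<in>A. l' x = l x) \<and> psd (A \<union> E) (\<lambda>x y. Q x y - (\<Sum>j<t. l' x j * cnj (l' y j)))"
  using assms
proof (induction E rule: finite_induct)
  case empty then show ?case by auto
next
  case (insert e E)
  have "psd (A \<union> E) Q" using insert.prems(3) by (rule psd_subset) (use insert in auto)
  then obtain l' where l': "\<forall>x\<in>A. l' x = l x"
      "psd (A \<union> E) (\<lambda>x y. Q x y - (\<Sum>j<t. l' x j * cnj (l' y j)))"
    using insert by auto
  have "\<exists>v. psd (insert e (A \<union> E)) (\<lambda>x y. Q x y - (\<Sum>j<t. (l'(e := v)) x j * cnj ((l'(e := v)) y j)))"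
    by (rule psd_extend_one) (use insert l' in auto)
  then obtain v where "psd (insert e (A \<union> E)) (\<lambda>x y. Q x y - (\<Sum>j<t. (l'(e := v)) x j * cnj ((l'(e := v)) y j)))" ..
  then show ?case using l'(1) insert.prems(2) by (intro exI[of _ "l'(e := v)"]) auto
qed

section \<open>Multipliers and their norms\<close>

text \<open>Squared norm on the direct sum of \<open>t\<close> copies; square roots of norms are
  confined to the passage to \<open>matrix_opnorm\<close>.\<close>

definition tnorm2 :: "'v rkhs_data \<Rightarrow> nat \<Rightarrow> (nat \<Rightarrow> 'v) \<Rightarrow> real" where
  "tnorm2 H t v = (\<Sum>j<t. Re (ip H (v j) (v j)))"

definition apply_matrix :: "nat \<Rightarrow> (nat \<Rightarrow> nat \<Rightarrow> 'v \<Rightarrow> 'v::comm_monoid_add) \<Rightarrow> (nat \<Rightarrow> 'v) \<Rightarrow> nat \<Rightarrow> 'v" where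
  "apply_matrix t M v i = (\<Sum>j<t. M i j (v j))"

text \<open>The exchanged indices make this the adjoint of the operator that \<open>M\<close>
  defines between the direct sums.\<close>

definition adj_matrix :: "'v::ab_group_add rkhs_data \<Rightarrow> (nat \<Rightarrow> nat \<Rightarrow> 'v \<Rightarrow> 'v) \<Rightarrow> nat \<Rightarrow> nat \<Rightarrow> 'v \<Rightarrow> 'v" where
  "adj_matrix H M j i = adj H (M i j)"

context rkhs
begin

section \<open>Coordinates in the basis of kernel functions\<close>

definition comb :: "('v \<Rightarrow> complex) \<Rightarrow> 'v" where
  "comb a = (\<Sum>x\<in>RK H. scl H (a x) x)"

definition coef :: "'v \<Rightarrow> 'v \<Rightarrow> complex" where
  "coef v = representation (RK H) v"

lemma subspace_hspace: "subspace (hspace H)"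
  unfolding hspace_def by (rule subspace_span)

lemmas hspace_add = subspace_add[OF subspace_hspace]
  and hspace_diff = subspace_diff[OF subspace_hspace]
  and hspace_scale = subspace_scale[OF subspace_hspace]
  and hspace_zero = subspace_0[OF subspace_hspace]
  and hspace_sum = subspace_sum[OF subspace_hspace]

lemma RK_hspace: "x \<in> RK H \<Longrightarrow> x \<in> hspace H"
  unfolding hspace_def by (rule span_base)

lemma comb_hspace: "comb a \<in> hspace H"
  unfolding comb_def by (intro hspace_sum hspace_scale RK_hspace)

lemma comb_coef: "v \<in> hspace H \<Longrightarrow> comb (coef v) = v"
  unfolding comb_def coef_def hspace_def
  by (rule sum_representation_eq) (use finite_RK independent_RK in auto)

lemma comb_cong: "(\<And>x. x \<in> RK H \<Longrightarrow> a x = b x) \<Longrightarrow> comb a = comb b"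
  unfolding comb_def by (intro sum.cong) auto

lemma comb_add: "comb a + comb b = comb (\<lambda>x. a x + b x)"
  by (simp add: comb_def scale_left_distrib sum.distrib)

lemma comb_scale: "scl H c (comb a) = comb (\<lambda>x. c * a x)"
  by (simp add: comb_def scale_sum_right)

lemma coef_comb:
  assumes "x \<in> RK H" shows "coef (comb a) x = a x"
proof -
  have "representation (RK H) (comb a) = (\<lambda>x. if x \<in> RK H then a x else 0)"
  proof (rule representation_eqI)
    show "independent (RK H)" by (rule independent_RK)
    show "comb a \<in> span (RK H)" using comb_hspace by (simp add: hspace_def)
    show "finite {b. (if b \<in> RK H then a b else 0) \<noteq> 0}"
      using finite_RK by (rule rev_finite_subset) auto
    have "(\<Sum>b | (if b \<in> RK H then a b else 0) \<noteq> 0. scl H (if b \<in> RK H then a b else 0) b) =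
        (\<Sum>b\<in>RK H. scl H (if b \<in> RK H then a b else 0) b)"
      using finite_RK by (intro sum.mono_neutral_left) (auto split: if_splits)
    also have "\<dots> = comb a" unfolding comb_def by (intro sum.cong) auto
    finally show "(\<Sum>b | (if b \<in> RK H then a b else 0) \<noteq> 0. scl H (if b \<in> RK H then a b else 0) b) = comb a" .
  qed (auto split: if_splits)
  then show ?thesis using assms by (simp add: coef_def)
qed

lemma comb_indicator: "y \<in> RK H \<Longrightarrow> comb (\<lambda>x. if x = y then c else 0) = scl H c y"
proof -
  assume y: "y \<in> RK H"
  have "comb (\<lambda>x. if x = y then c else 0) = (\<Sum>x\<in>RK H. if x = y then scl H c x else 0)"
    unfolding comb_def by (intro sum.cong) auto
  then show ?thesis using y finite_RK by simp
qed

section \<open>Inner products of sums, the Gram matrix and adjoints\<close>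

lemma ip_sum_left:
  assumes "finite A" "\<And>k. k \<in> A \<Longrightarrow> u k \<in> hspace H" "z \<in> hspace H"
  shows "ip H (\<Sum>k\<in>A. u k) z = (\<Sum>k\<in>A. ip H (u k) z)"
  using assms(1,2)
proof (induction A rule: finite_induct)
  case empty
  have "ip H (scl H 0 0) z = 0 * ip H 0 z" by (rule ip_scl[OF hspace_zero assms(3)])
  then show ?case by simp
next
  case (insert e A)
  then show ?case using assms(3) by (simp add: ip_add hspace_sum)
qed

lemma ip_sum_right:
  assumes "finite A" "\<And>k. k \<in> A \<Longrightarrow> u k \<in> hspace H" "z \<in> hspace H"
  shows "ip H z (\<Sum>k\<in>A. u k) = (\<Sum>k\<in>A. ip H z (u k))"
proof -
  have "ip H z (\<Sum>k\<in>A. u k) = cnj (ip H (\<Sum>k\<in>A. u k) z)"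
    using assms by (intro ip_cnj hspace_sum) auto
  also have "\<dots> = (\<Sum>k\<in>A. cnj (ip H (u k) z))" using assms by (simp add: ip_sum_left)
  also have "\<dots> = (\<Sum>k\<in>A. ip H z (u k))"
    using assms by (intro sum.cong refl ip_cnj[symmetric]) auto
  finally show ?thesis .
qed

lemma ip_scl_right: "\<lbrakk>x \<in> hspace H; z \<in> hspace H\<rbrakk> \<Longrightarrow> ip H z (scl H c x) = cnj c * ip H z x"
  by (subst ip_cnj) (auto simp: ip_scl hspace_scale intro: ip_cnj[symmetric])

lemma ip_add_right:
  "\<lbrakk>x \<in> hspace H; y \<in> hspace H; z \<in> hspace H\<rbrakk> \<Longrightarrow> ip H z (x + y) = ip H z x + ip H z y"
  using ip_cnj[of "x + y" z] ip_cnj[of x z] ip_cnj[of y z] by (simp add: ip_add hspace_add)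

lemma ip_diff: 
  assumes "x \<in> hspace H" "y \<in> hspace H" "z \<in> hspace H"
  shows "ip H (x - y) z = ip H x z - ip H y z"
  using ip_add[of "x - y" y z] assms by (simp add: hspace_diff)

lemma ip_diff_right: 
  assumes "x \<in> hspace H" "y \<in> hspace H" "z \<in> hspace H"
  shows "ip H z (x - y) = ip H z x - ip H z y"
  using ip_add_right[of "x - y" y z] assms by (simp add: hspace_diff)

lemma ip_zero: "z \<in> hspace H \<Longrightarrow> ip H 0 z = 0"
  using ip_sum_left[of "{}" "\<lambda>_. 0" z] by simp

lemma ip_comb_left: "z \<in> hspace H \<Longrightarrow> ip H (comb a) z = (\<Sum>x\<in>RK H. a x * ip H x z)"
  unfolding comb_def using finite_RK
  by (simp add: ip_sum_left ip_scl RK_hspace hspace_scale)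

lemma ip_comb_right: "z \<in> hspace H \<Longrightarrow> ip H z (comb a) = (\<Sum>x\<in>RK H. cnj (a x) * ip H z x)"
  unfolding comb_def using finite_RK
  by (simp add: ip_sum_right ip_scl_right RK_hspace hspace_scale)

lemma ip_comb: "ip H (comb a) (comb b) = sform (RK H) (ip H) a b"
  by (subst ip_comb_left[OF comb_hspace]) (simp add: sform_left ip_comb_right RK_hspace)

lemma ip_nonneg: "x \<in> hspace H \<Longrightarrow> 0 \<le> Re (ip H x x)"
  using ip_pos[of x] ip_zero[OF hspace_zero] by (cases "x = 0") auto

lemma ip_self_eq_0: "x \<in> hspace H \<Longrightarrow> Re (ip H x x) = 0 \<Longrightarrow> x = 0"
  using ip_pos[of x] by fastforce

lemma ip_self_real: "x \<in> hspace H \<Longrightarrow> ip H x x = of_real (Re (ip H x x))"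
  using ip_cnj[of x x] by (simp add: complex_eq_iff)

lemma hnorm_power2: "x \<in> hspace H \<Longrightarrow> (hnorm H x)\<^sup>2 = Re (ip H x x)"
  by (simp add: hnorm_def ip_nonneg)

lemma hermitian_gram: "hermitian (RK H) (ip H)"
  unfolding hermitian_def by (intro ballI ip_cnj RK_hspace)

lemma pd_gram: "pd (RK H) (ip H)"
proof -
  have "0 < Re (qform (RK H) (ip H) a)" if "\<exists>x\<in>RK H. a x \<noteq> 0" for a
  proof -
    from that obtain x where x: "x \<in> RK H" "a x \<noteq> 0" by blast
    have "comb a \<noteq> comb (\<lambda>_. 0)" using coef_comb[OF x(1)] x(2) by metis
    then have "comb a \<noteq> 0" by (simp add: comb_def)
    then show ?thesis using ip_pos[OF comb_hspace] by (simp add: ip_comb)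
  qed
  then show ?thesis using hermitian_gram by (simp add: pd_def)
qed

text \<open>The Gram matrix is definite, so it has no null vectors and \<open>psd_solve\<close>
  applies to every right-hand side. The conjugates in the proof arise because \<open>z\<close>
  stands in the second argument.\<close>

lemma riesz: "\<exists>z\<in>hspace H. \<forall>x\<in>RK H. ip H x z = b x"
proof -
  have "\<exists>z. \<forall>y\<in>RK H. cnj (b y) = (\<Sum>x\<in>RK H. z x * ip H x y)"
  proof (rule psd_solve[OF finite_RK pd_imp_psd[OF pd_gram]])
    fix a assume "Re (qform (RK H) (ip H) a) = 0"
    then have "\<forall>x\<in>RK H. a x = 0" using pd_pos[OF pd_gram, of a] by force
    then show "(\<Sum>y\<in>RK H. cnj (a y) * cnj (b y)) = 0" by simp
  qed
  then obtain z where z: "\<And>y. y \<in> RK H \<Longrightarrow> cnj (b y) = ip H (comb z) y"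
    by (auto simp: ip_comb_left RK_hspace)
  have "ip H x (comb z) = b x" if "x \<in> RK H" for x
    using z[OF that] ip_cnj[OF comb_hspace RK_hspace[OF that]] by (metis complex_cnj_cnj)
  then show ?thesis using comb_hspace by blast
qed

lemma hspace_eqI:
  assumes "z \<in> hspace H" "z' \<in> hspace H" "\<And>x. x \<in> hspace H \<Longrightarrow> ip H x z = ip H x z'"
  shows "z = z'"
proof -
  have "ip H (z - z') (z - z') = 0"
    using assms by (simp add: ip_diff_right hspace_diff)
  then show ?thesis using ip_self_eq_0[of "z - z'"] assms by (simp add: hspace_diff)
qed

lemma linear_operator_hspace: "linear_operator H M \<Longrightarrow> x \<in> hspace H \<Longrightarrow> M x \<in> hspace H"
  by (auto simp: linear_operator_def)

lemma linear_operator_sum: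
  assumes "linear_operator H M" "finite A" "\<And>k. k \<in> A \<Longrightarrow> u k \<in> hspace H"
  shows "M (\<Sum>k\<in>A. scl H (a k) (u k)) = (\<Sum>k\<in>A. scl H (a k) (M (u k)))"
  using assms(2,3)
proof (induction A rule: finite_induct)
  case empty
  have "M (scl H 0 0) = scl H 0 (M 0)"
    using assms(1) hspace_zero unfolding linear_operator_def by blast
  then show ?case by simp
next
  case (insert e A)
  then have "M (scl H (a e) (u e) + (\<Sum>k\<in>A. scl H (a k) (u k))) =
      M (scl H (a e) (u e)) + M (\<Sum>k\<in>A. scl H (a k) (u k))"
    using assms(1) unfolding linear_operator_def by (blast intro: hspace_sum hspace_scale)
  moreover have "M (scl H (a e) (u e)) = scl H (a e) (M (u e))"
    using assms(1) insert.prems unfolding linear_operator_def by blast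
  ultimately show ?case using insert by simp
qed

lemma linear_operator_comb:
  assumes "linear_operator H M"
  shows "M (comb a) = (\<Sum>x\<in>RK H. scl H (a x) (M x))"
  unfolding comb_def by (rule linear_operator_sum[OF assms finite_RK RK_hspace])

lemma adj_unique:
  assumes "z \<in> hspace H" "\<And>x. x \<in> hspace H \<Longrightarrow> ip H (M x) y = ip H x z"
  shows "adj H M y = z"
  unfolding adj_def
proof (rule the_equality)
  show "z \<in> hspace H \<and> (\<forall>x\<in>hspace H. ip H (M x) y = ip H x z)" using assms by blast
  fix z' assume "z' \<in> hspace H \<and> (\<forall>x\<in>hspace H. ip H (M x) y = ip H x z')"
  then show "z' = z" using assms by (intro hspace_eqI) auto
qed

text \<open>Justifies the definite description in \<open>adj\<close>: Riesz on the basis gives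
  existence, nondegeneracy gives uniqueness.\<close>

lemma adj_hspace_ip:
  assumes M: "linear_operator H M" and y: "y \<in> hspace H"
  shows "adj H M y \<in> hspace H \<and> (\<forall>x\<in>hspace H. ip H (M x) y = ip H x (adj H M y))"
proof -
  obtain z where z: "z \<in> hspace H" "\<And>x. x \<in> RK H \<Longrightarrow> ip H x z = ip H (M x) y"
    using riesz[of "\<lambda>x. ip H (M x) y"] by blast
  have "ip H (M v) y = ip H v z" if v: "v \<in> hspace H" for v
  proof -
    have "ip H (M (comb (coef v))) y = (\<Sum>x\<in>RK H. coef v x * ip H (M x) y)"
      unfolding linear_operator_comb[OF M] using finite_RK M y
      by (simp add: ip_sum_left ip_scl hspace_scale linear_operator_hspace RK_hspace)
    also have "\<dots> = ip H (comb (coef v)) z" using z by (simp add: ip_comb_left)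
    finally show ?thesis by (simp add: comb_coef v)
  qed
  with adj_unique[of z M y] z(1) show ?thesis by auto
qed

lemmas adj_hspace = adj_hspace_ip[THEN conjunct1]
  and adj_ip = adj_hspace_ip[THEN conjunct2, rule_format]

lemma linear_operator_adj:
  assumes M: "linear_operator H M" shows "linear_operator H (adj H M)"
  unfolding linear_operator_def
proof (intro conjI ballI allI)
  show "adj H M ` hspace H \<subseteq> hspace H" using adj_hspace[OF M] by blast
  fix x y assume "x \<in> hspace H" "y \<in> hspace H"
  then show "adj H M (x + y) = adj H M x + adj H M y"
    using adj_hspace[OF M] adj_ip[OF M] linear_operator_hspace[OF M]
    by (intro adj_unique) (auto simp: ip_add_right hspace_add)
next
  fix c x assume "x \<in> hspace H"
  then show "adj H M (scl H c x) = scl H c (adj H M x)"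
    using adj_hspace[OF M] adj_ip[OF M] linear_operator_hspace[OF M]
    by (intro adj_unique) (auto simp: ip_scl_right hspace_scale)
qed

lemma adj_adj:
  assumes M: "linear_operator H M" and "y \<in> hspace H"
  shows "adj H (adj H M) y = M y"
proof (rule adj_unique)
  show "M y \<in> hspace H" using assms linear_operator_hspace by blast
  fix x assume x: "x \<in> hspace H"
  have "ip H (adj H M x) y = cnj (ip H y (adj H M x))"
    using adj_hspace[OF M x] assms by (intro ip_cnj)
  also have "\<dots> = cnj (ip H (M y) x)" using adj_ip[OF M x assms(2)] by simp
  also have "\<dots> = ip H x (M y)" using assms x linear_operator_hspace by (intro ip_cnj[symmetric]) auto
  finally show "ip H (adj H M x) y = ip H x (M y)" .
qed

text \<open>Kernel functions form a basis, so the eigenvalues can be prescribed freely: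
  \<open>D\<close> is diagonal with entries \<open>c\<close>, and the multiplier is
  \<open>adj H D\<close>, whose adjoint is \<open>D\<close> again.\<close>

lemma ex_multiplier:
  "\<exists>M. multiplier H M \<and> (\<forall>x\<in>RK H. adj H M x = scl H (c x) x)"
proof -
  define D where "D v = comb (\<lambda>x. c x * coef v x)" for v
  have Dc: "D (comb a) = comb (\<lambda>x. c x * a x)" for a
    unfolding D_def by (rule comb_cong) (simp add: coef_comb)
  have D: "linear_operator H D"
    unfolding linear_operator_def
  proof (intro conjI ballI allI)
    show "D ` hspace H \<subseteq> hspace H" using comb_hspace by (auto simp: D_def)
    fix x y assume "x \<in> hspace H" "y \<in> hspace H"
    then have "D (x + y) = D (comb (coef x) + comb (coef y))" by (simp add: comb_coef)
    also have "\<dots> = D x + D y"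
      unfolding comb_add Dc by (simp add: D_def comb_add algebra_simps)
    finally show "D (x + y) = D x + D y" .
  next
    fix t x assume "x \<in> hspace H"
    then have "D (scl H t x) = D (scl H t (comb (coef x)))" by (simp add: comb_coef)
    also have "\<dots> = scl H t (D x)"
      unfolding comb_scale Dc by (simp add: D_def comb_scale algebra_simps)
    finally show "D (scl H t x) = scl H t (D x)" .
  qed
  have "adj H (adj H D) x = scl H (c x) x" if x: "x \<in> RK H" for x
  proof -
    have "adj H (adj H D) x = D (comb (\<lambda>y. if y = x then 1 else 0))"
      using x by (simp add: adj_adj[OF D RK_hspace[OF x]] comb_indicator)
    also have "\<dots> = comb (\<lambda>y. if y = x then c x else 0)"
      unfolding Dc by (rule comb_cong) auto
    finally show ?thesis using x by (simp add: comb_indicator)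
  qed
  then show ?thesis using linear_operator_adj[OF D] unfolding multiplier_def by blast
qed

lemma adj_comb:
  assumes "linear_operator H M" "\<And>x. x \<in> RK H \<Longrightarrow> adj H M x = scl H (c x) x"
  shows "adj H M (comb a) = comb (\<lambda>x. a x * c x)"
  unfolding linear_operator_comb[OF linear_operator_adj[OF assms(1)]]
  by (simp add: comb_def assms(2))

section \<open>Boundedness of operators and norms of matrices\<close>

lemma cauchy_schwarz:
  assumes v: "v \<in> hspace H" and w: "w \<in> hspace H"
  shows "(cmod (ip H v w))\<^sup>2 \<le> Re (ip H v v) * Re (ip H w w)"
proof (cases "w = 0")
  case True
  then show ?thesis using ip_cnj[OF hspace_zero v] ip_zero[OF v] ip_zero[OF hspace_zero]
    by simp
next
  case False
  define n where "n = Re (ip H w w)"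
  have n: "n > 0" "ip H w w = of_real n" using ip_pos[OF w False] ip_self_real[OF w] by (simp_all add: n_def)
  define c where "c = ip H v w / of_real n"
  have "0 \<le> Re (ip H (v - scl H c w) (v - scl H c w))"
    by (intro ip_nonneg hspace_diff hspace_scale v w)
  also have "ip H (v - scl H c w) (v - scl H c w) =
      ip H v v - cnj c * ip H v w - c * ip H w v + c * cnj c * ip H w w"
    using v w by (simp add: ip_diff ip_diff_right hspace_diff hspace_scale ip_scl ip_scl_right algebra_simps)
  also have "ip H w v = cnj (ip H v w)" by (rule ip_cnj[OF v w])
  also have "ip H v v - cnj c * ip H v w - c * cnj (ip H v w) + c * cnj c * ip H w w =
      ip H v v - ip H v w * cnj (ip H v w) / of_real n"
    using n by (simp add: c_def field_simps)
  also have "Re \<dots> = Re (ip H v v) - (cmod (ip H v w))\<^sup>2 / n"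
    by (simp flip: complex_norm_square of_real_divide of_real_power)
  finally show ?thesis using n(1) by (simp add: n_def[symmetric] field_simps)
qed

text \<open>A crude constant, from the parallelogram inequality applied once per summand; any finite
  bound serves to show that operators are bounded.\<close>

lemma ip_sum_bound:
  assumes "finite A" "\<And>k. k \<in> A \<Longrightarrow> u k \<in> hspace H"
  shows "Re (ip H (\<Sum>k\<in>A. u k) (\<Sum>k\<in>A. u k)) \<le> 2 ^ card A * (\<Sum>k\<in>A. Re (ip H (u k) (u k)))"
  using assms
proof (induction A rule: finite_induct)
  case empty then show ?case by (simp add: ip_zero hspace_zero)
next
  case (insert e A)
  define v where "v = (\<Sum>k\<in>A. u k)"
  have v: "v \<in> hspace H" unfolding v_def using insert by (intro hspace_sum) auto
  have e: "u e \<in> hspace H" using insert by simp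
  have "0 \<le> Re (ip H (u e - v) (u e - v))" by (intro ip_nonneg hspace_diff e v)
  then have "Re (ip H (u e + v) (u e + v)) \<le> 2 * Re (ip H (u e) (u e)) + 2 * Re (ip H v v)"
    using e v by (simp add: ip_add ip_add_right ip_diff ip_diff_right hspace_diff hspace_add)
  also have "Re (ip H v v) \<le> 2 ^ card A * (\<Sum>k\<in>A. Re (ip H (u k) (u k)))"
    unfolding v_def using insert by auto
  also have "2 * Re (ip H (u e) (u e)) \<le> 2 ^ Suc (card A) * Re (ip H (u e) (u e))"
    using ip_nonneg[OF e] by (intro mult_right_mono) auto
  finally show ?case using insert.hyps by (simp add: v_def algebra_simps)
qed

text \<open>Finite dimension enters here. Without a bound the supremum in
  \<open>matrix_opnorm\<close> would be an unspecified number.\<close>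

lemma linear_operator_bounded:
  assumes M: "linear_operator H M"
  shows "\<exists>C\<ge>0. \<forall>v\<in>hspace H. Re (ip H (M v) (M v)) \<le> C * Re (ip H v v)"
proof -
  \<comment> \<open>The vectors \<open>d x\<close> form the dual basis, so each coefficient is an
    inner product and Cauchy-Schwarz bounds it.\<close>
  have "\<exists>d\<in>hspace H. \<forall>y\<in>RK H. ip H y d = (if y = x then 1 else 0)" for x by (rule riesz)
  then obtain d where d: "\<And>x. d x \<in> hspace H" "\<And>x y. y \<in> RK H \<Longrightarrow> ip H y (d x) = (if y = x then 1 else 0)"
    by metis
  have coef: "coef v x = ip H v (d x)" if v: "v \<in> hspace H" and x: "x \<in> RK H" for v x
  proof -
    have "ip H v (d x) = ip H (comb (coef v)) (d x)" by (simp add: comb_coef v)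
    also have "\<dots> = (\<Sum>y\<in>RK H. if y = x then coef v y else 0)"
      unfolding ip_comb_left[OF d(1)] by (intro sum.cong) (auto simp: d(2))
    also have "\<dots> = coef v x" using x finite_RK by simp
    finally show ?thesis by simp
  qed
  let ?n = "\<lambda>v. Re (ip H v v)"
  define C where "C = 2 ^ card (RK H) * (\<Sum>x\<in>RK H. ?n (d x) * ?n (M x))"
  have nM: "0 \<le> ?n (M x)" if "x \<in> RK H" for x
    using that by (intro ip_nonneg linear_operator_hspace[OF M] RK_hspace)
  have "?n (M v) \<le> C * ?n v" if v: "v \<in> hspace H" for v
  proof -
    have "?n (M v) = ?n (M (comb (coef v)))" by (simp add: comb_coef v)
    also have "\<dots> \<le> 2 ^ card (RK H) * (\<Sum>x\<in>RK H. ?n (scl H (coef v x) (M x)))"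
      unfolding linear_operator_comb[OF M]
      by (intro ip_sum_bound finite_RK hspace_scale linear_operator_hspace[OF M] RK_hspace)
    also have "(\<Sum>x\<in>RK H. ?n (scl H (coef v x) (M x))) \<le> (\<Sum>x\<in>RK H. ?n v * (?n (d x) * ?n (M x)))"
    proof (rule sum_mono)
      fix x assume x: "x \<in> RK H"
      have Mx: "M x \<in> hspace H" by (intro linear_operator_hspace[OF M] RK_hspace x)
      have "ip H (scl H (coef v x) (M x)) (scl H (coef v x) (M x)) = (coef v x * cnj (coef v x)) * ip H (M x) (M x)"
        using Mx by (simp add: ip_scl ip_scl_right hspace_scale)
      then have "?n (scl H (coef v x) (M x)) = (cmod (coef v x))\<^sup>2 * ?n (M x)"
        by (simp flip: complex_norm_square)
      also have "\<dots> \<le> (?n v * ?n (d x)) * ?n (M x)"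
        unfolding coef[OF v x] using nM[OF x] by (intro mult_right_mono cauchy_schwarz v d)
      finally show "?n (scl H (coef v x) (M x)) \<le> ?n v * (?n (d x) * ?n (M x))" by (simp add: mult.assoc)
    qed
    finally show ?thesis by (simp add: C_def sum_distrib_left mult_ac)
  qed
  moreover have "C \<ge> 0" unfolding C_def
    using nM ip_nonneg[OF d(1)] by (intro mult_nonneg_nonneg sum_nonneg) auto
  ultimately show ?thesis by blast
qed

lemma tnorm2_nonneg: "\<forall>j<t. v j \<in> hspace H \<Longrightarrow> 0 \<le> tnorm2 H t v"
  unfolding tnorm2_def by (intro sum_nonneg ip_nonneg) auto

lemma apply_matrix_hspace:
  assumes "\<forall>i<s. \<forall>j<t. linear_operator H (M i j)" "\<forall>j<t. v j \<in> hspace H" "i < s"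
  shows "apply_matrix t M v i \<in> hspace H"
  unfolding apply_matrix_def
proof (rule hspace_sum)
  fix j assume "j \<in> {..<t}"
  then show "M i j (v j) \<in> hspace H" using assms linear_operator_hspace[of "M i j" "v j"] by simp
qed

lemma apply_matrix_bounded:
  assumes M: "\<forall>i<s. \<forall>j<t. linear_operator H (M i j)"
  shows "\<exists>C\<ge>0. \<forall>v. (\<forall>j<t. v j \<in> hspace H) \<longrightarrow> tnorm2 H s (apply_matrix t M v) \<le> C * tnorm2 H t v"
proof -
  have "\<exists>C\<ge>0. \<forall>v\<in>hspace H. Re (ip H (M i j v) (M i j v)) \<le> C * Re (ip H v v)" if "i < s" "j < t" for i j
    using M that by (intro linear_operator_bounded) blast
  then obtain C where C: "\<And>i j. \<lbrakk>i < s; j < t\<rbrakk> \<Longrightarrow> C i j \<ge> 0"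
    "\<And>i j v. \<lbrakk>i < s; j < t; v \<in> hspace H\<rbrakk> \<Longrightarrow> Re (ip H (M i j v) (M i j v)) \<le> C i j * Re (ip H v v)"
    by metis
  define K where "K = (\<Sum>i<s. \<Sum>j<t. 2 ^ t * C i j)"
  have "tnorm2 H s (apply_matrix t M v) \<le> K * tnorm2 H t v" if v: "\<forall>j<t. v j \<in> hspace H" for v
  proof -
    have "Re (ip H (apply_matrix t M v i) (apply_matrix t M v i)) \<le> (\<Sum>j<t. 2 ^ t * C i j) * tnorm2 H t v"
      if i: "i < s" for i
    proof -
      have "Re (ip H (apply_matrix t M v i) (apply_matrix t M v i)) \<le>
          2 ^ card {..<t} * (\<Sum>j<t. Re (ip H (M i j (v j)) (M i j (v j))))"
        unfolding apply_matrix_def using M i v by (intro ip_sum_bound) (auto intro: linear_operator_hspace)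
      also have "\<dots> \<le> 2 ^ t * (\<Sum>j<t. C i j * tnorm2 H t v)"
      proof (simp, rule sum_mono)
        fix j assume j: "j \<in> {..<t}"
        then have "Re (ip H (M i j (v j)) (M i j (v j))) \<le> C i j * Re (ip H (v j) (v j))"
          using C(2) i v by simp
        also have "\<dots> \<le> C i j * tnorm2 H t v"
          unfolding tnorm2_def using j v C(1)[OF i, of j]
          by (intro mult_left_mono member_le_sum) (auto intro: ip_nonneg)
        finally show "Re (ip H (M i j (v j)) (M i j (v j))) \<le> C i j * tnorm2 H t v" .
      qed
      finally show ?thesis by (simp add: sum_distrib_left sum_distrib_right mult_ac)
    qed
    then have "(\<Sum>i<s. Re (ip H (apply_matrix t M v i) (apply_matrix t M v i)))
        \<le> (\<Sum>i<s. (\<Sum>j<t. 2 ^ t * C i j) * tnorm2 H t v)"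
      by (intro sum_mono) auto
    then show ?thesis by (simp add: tnorm2_def[of H s] K_def sum_distrib_right)
  qed
  moreover have "K \<ge> 0" unfolding K_def using C(1) by (intro sum_nonneg mult_nonneg_nonneg) auto
  ultimately show ?thesis by blast
qed

lemma apply_matrix_scale:
  assumes "\<forall>i<s. \<forall>j<t. linear_operator H (M i j)" "\<forall>j<t. v j \<in> hspace H" "i < s"
  shows "apply_matrix t M (\<lambda>j. scl H c (v j)) i = scl H c (apply_matrix t M v i)"
  unfolding apply_matrix_def scale_sum_right
proof (rule sum.cong)
  fix j assume j: "j \<in> {..<t}"
  then have "linear_operator H (M i j)" using assms(1,3) by simp
  then show "M i j (scl H c (v j)) = scl H c (M i j (v j))"
    using assms(2) j unfolding linear_operator_def by blast
qed simp

lemma tnorm2_scale: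
  assumes "\<forall>j<t. v j \<in> hspace H"
  shows "tnorm2 H t (\<lambda>j. scl H c (v j)) = (cmod c)\<^sup>2 * tnorm2 H t v"
  unfolding tnorm2_def sum_distrib_left
proof (rule sum.cong)
  fix j assume j: "j \<in> {..<t}"
  have "ip H (scl H c (v j)) (scl H c (v j)) = (c * cnj c) * ip H (v j) (v j)"
    using assms j by (simp add: ip_scl ip_scl_right hspace_scale)
  then show "Re (ip H (scl H c (v j)) (scl H c (v j))) = (cmod c)\<^sup>2 * Re (ip H (v j) (v j))"
    by (simp flip: complex_norm_square)
qed simp

lemma tnorm2_eq_0:
  assumes "\<forall>j<t. v j \<in> hspace H" "tnorm2 H t v = 0" "j < t"
  shows "v j = 0"
proof -
  have "\<forall>j\<in>{..<t}. Re (ip H (v j) (v j)) = 0"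
    using assms(2) unfolding tnorm2_def
    by (subst (asm) sum_nonneg_eq_0_iff) (use assms(1) ip_nonneg in auto)
  then show ?thesis using assms by (intro ip_self_eq_0) auto
qed

text \<open>Replaces the supremum over the unit ball by a homogeneous inequality. The supremum is
  controlled once the set of values is known to be nonempty and bounded; the rest is
  scaling.\<close>

lemma matrix_opnorm_le_iff:
  assumes M: "\<forall>i<s. \<forall>j<t. linear_operator H (M i j)" and r: "0 \<le> r"
  shows "matrix_opnorm H s t M \<le> r \<longleftrightarrow>
    (\<forall>v. (\<forall>j<t. v j \<in> hspace H) \<longrightarrow> tnorm2 H s (apply_matrix t M v) \<le> r\<^sup>2 * tnorm2 H t v)"
    (is "_ \<longleftrightarrow> ?R")
proof -
  let ?B = "{v. (\<forall>j<t. v j \<in> hspace H) \<and> sqrt (\<Sum>j<t. (hnorm H (v j))\<^sup>2) \<le> 1}"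
  let ?f = "\<lambda>v. sqrt (\<Sum>i<s. (hnorm H (\<Sum>j<t. M i j (v j)))\<^sup>2)"
  have B: "v \<in> ?B \<longleftrightarrow> (\<forall>j<t. v j \<in> hspace H) \<and> tnorm2 H t v \<le> 1" for v
  proof -
    have "(\<Sum>j<t. (hnorm H (v j))\<^sup>2) = tnorm2 H t v" if "\<forall>j<t. v j \<in> hspace H"
      unfolding tnorm2_def using that by (intro sum.cong) (auto simp: hnorm_power2)
    then show ?thesis by auto
  qed
  have f: "?f v = sqrt (tnorm2 H s (apply_matrix t M v))" if "\<forall>j<t. v j \<in> hspace H" for v
  proof -
    have "(hnorm H (\<Sum>j<t. M i j (v j)))\<^sup>2 = Re (ip H (apply_matrix t M v i) (apply_matrix t M v i))"
      if "i < s" for i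
      using hnorm_power2[OF apply_matrix_hspace[OF M \<open>\<forall>j<t. v j \<in> hspace H\<close> that]]
      by (simp only: apply_matrix_def)
    then show ?thesis unfolding tnorm2_def by simp
  qed
  obtain C where C: "C \<ge> 0"
    "\<And>v. \<forall>j<t. v j \<in> hspace H \<Longrightarrow> tnorm2 H s (apply_matrix t M v) \<le> C * tnorm2 H t v"
    using apply_matrix_bounded[OF M] by metis
  have bdd: "bdd_above (?f ` ?B)"
  proof (rule bdd_aboveI2)
    fix v assume v: "v \<in> ?B"
    have v1: "\<forall>j<t. v j \<in> hspace H" and v2: "tnorm2 H t v \<le> 1" using v B[of v] by blast+
    have "tnorm2 H s (apply_matrix t M v) \<le> C * 1"
      using C(2)[OF v1] mult_left_mono[OF v2 C(1)] by linarith
    then show "?f v \<le> sqrt C" unfolding f[OF v1] by simp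
  qed
  have ne: "?f ` ?B \<noteq> {}"
  proof
    have z: "(\<lambda>_. 0) \<in> ?B" by (simp only: B) (simp add: hspace_zero tnorm2_def ip_zero)
    assume "?f ` ?B = {}"
    then have e: "?B = {}" by (rule image_is_empty[THEN iffD1])
    from z show False unfolding e by (rule emptyE)
  qed
  have "matrix_opnorm H s t M \<le> r \<longleftrightarrow> (\<forall>v\<in>?B. ?f v \<le> r)"
    unfolding matrix_opnorm_def cSup_le_iff[OF ne bdd] by (rule ball_simps)
  also have "\<dots> \<longleftrightarrow> ?R"
  proof
    assume le: "\<forall>v\<in>?B. ?f v \<le> r"
    show ?R
    proof (intro allI impI)
      fix v assume v: "\<forall>j<t. v j \<in> hspace H"
      show "tnorm2 H s (apply_matrix t M v) \<le> r\<^sup>2 * tnorm2 H t v"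
      \<comment> \<open>A vector of norm zero cannot be normalized; the crude bound \<open>C\<close>
        shows that its image has norm zero as well.\<close>
      proof (cases "tnorm2 H t v = 0")
        case True
        then have "tnorm2 H s (apply_matrix t M v) \<le> 0" using C(2)[OF v] by simp
        then show ?thesis using True by simp
      next
        case False
        define n where "n = tnorm2 H t v"
        have n: "n > 0" using False tnorm2_nonneg[of t v] v by (simp add: n_def)
        define c where "c = complex_of_real (1 / sqrt n)"
        have c: "(cmod c)\<^sup>2 = 1 / n" using n by (simp add: c_def norm_divide power_divide)
        let ?v = "\<lambda>j. scl H c (v j)"
        have v': "\<forall>j<t. ?v j \<in> hspace H" using v by (simp add: hspace_scale)
        have "tnorm2 H t ?v = 1" using v n by (simp add: tnorm2_scale c n_def[symmetric])
        then have "?v \<in> ?B" using v' by (simp only: B) simp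
        with le have "?f ?v \<le> r" by (rule bspec)
        then have "sqrt (tnorm2 H s (apply_matrix t M ?v)) \<le> r" by (simp only: f[OF v'])
        moreover have "tnorm2 H s (apply_matrix t M ?v) = (1 / n) * tnorm2 H s (apply_matrix t M v)"
        proof -
          have "tnorm2 H s (apply_matrix t M ?v) = tnorm2 H s (\<lambda>i. scl H c (apply_matrix t M v i))"
            unfolding tnorm2_def using apply_matrix_scale[OF M v] by (intro sum.cong) auto
          then show ?thesis
            using apply_matrix_hspace[OF M, of v] v by (simp add: tnorm2_scale c)
        qed
        ultimately have "sqrt (1 / n * tnorm2 H s (apply_matrix t M v)) \<le> r" by simp
        then have "1 / n * tnorm2 H s (apply_matrix t M v) \<le> r\<^sup>2" by (rule sqrt_le_D)
        then show ?thesis using n by (simp add: n_def[symmetric] field_simps)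
      qed
    qed
  next
    assume R: ?R
    show "\<forall>v\<in>?B. ?f v \<le> r"
    proof
      fix v assume v: "v \<in> ?B"
      have v1: "\<forall>j<t. v j \<in> hspace H" and v2: "tnorm2 H t v \<le> 1" using v B[of v] by blast+
      have "tnorm2 H s (apply_matrix t M v) \<le> r\<^sup>2 * tnorm2 H t v" using R v1 by blast
      also have "\<dots> \<le> r\<^sup>2 * 1" using v2 by (intro mult_left_mono) auto
      finally have "tnorm2 H s (apply_matrix t M v) \<le> r\<^sup>2" by simp
      then show "?f v \<le> r" unfolding f[OF v1] using r by (intro real_le_lsqrt)
    qed
  qed
  finally show ?thesis .
qed

text \<open>If the supremum were negative, the criterion with bound \<open>0\<close> would make all
  values vanish, and then the supremum would be \<open>0\<close>.\<close>

lemma matrix_opnorm_nonneg: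
  assumes M: "\<forall>i<s. \<forall>j<t. linear_operator H (M i j)"
  shows "0 \<le> matrix_opnorm H s t M"
proof (rule ccontr)
  let ?B = "{v. (\<forall>j<t. v j \<in> hspace H) \<and> sqrt (\<Sum>j<t. (hnorm H (v j))\<^sup>2) \<le> 1}"
  let ?f = "\<lambda>v. sqrt (\<Sum>i<s. (hnorm H (\<Sum>j<t. M i j (v j)))\<^sup>2)"
  assume neg: "\<not> 0 \<le> matrix_opnorm H s t M"
  then have "matrix_opnorm H s t M \<le> 0" by simp
  then have le: "\<forall>v. (\<forall>j<t. v j \<in> hspace H) \<longrightarrow> tnorm2 H s (apply_matrix t M v) \<le> 0"
    using matrix_opnorm_le_iff[OF M, of 0] by simp
  then have f: "?f v = 0" if "v \<in> ?B" for v
  proof -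
    have v: "\<forall>j<t. v j \<in> hspace H" using that by blast
    have hs: "\<forall>i<s. apply_matrix t M v i \<in> hspace H" using apply_matrix_hspace[OF M v] by blast
    have "?f v = sqrt (tnorm2 H s (apply_matrix t M v))"
    proof -
      have "(hnorm H (\<Sum>j<t. M i j (v j)))\<^sup>2 = Re (ip H (apply_matrix t M v i) (apply_matrix t M v i))"
        if "i < s" for i
        using hnorm_power2[of "apply_matrix t M v i"] hs that by (simp only: apply_matrix_def)
      then show ?thesis unfolding tnorm2_def by simp
    qed
    also have "tnorm2 H s (apply_matrix t M v) = 0"
      using le[rule_format, of v] v tnorm2_nonneg[OF hs] by (intro antisym) auto
    finally show ?thesis by simp
  qed
  have "(\<lambda>_. 0) \<in> ?B" by (simp add: hspace_zero hnorm_def ip_zero)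
  then have z: "(\<lambda>_. 0 :: real) ` ?B = {0}" by (rule image_constant)
  have "?f ` ?B = (\<lambda>_. 0) ` ?B" by (rule image_cong[OF refl f])
  then have "?f ` ?B = {0}" unfolding z .
  then have "matrix_opnorm H s t M = 0" unfolding matrix_opnorm_def by simp
  then show False using neg by simp
qed

text \<open>A bound for an operator holds for its adjoint, by expanding the squared norm of
  \<open>r\<^sup>2 w - F (G w)\<close>. \<open>F\<close> and \<open>G\<close> are kept abstract so
  that the lemma can be applied with their roles exchanged.\<close>

lemma adjoint_bound:
  assumes F: "\<And>v i. \<lbrakk>\<forall>j<t. v j \<in> hspace H; i < s\<rbrakk> \<Longrightarrow> F v i \<in> hspace H"
    and G: "\<And>w j. \<lbrakk>\<forall>i<s. w i \<in> hspace H; j < t\<rbrakk> \<Longrightarrow> G w j \<in> hspace H"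
    and FG: "\<And>v w. \<lbrakk>\<forall>j<t. v j \<in> hspace H; \<forall>i<s. w i \<in> hspace H\<rbrakk> \<Longrightarrow>
        (\<Sum>i<s. ip H (F v i) (w i)) = (\<Sum>j<t. ip H (v j) (G w j))"
    and bound: "\<And>v. \<forall>j<t. v j \<in> hspace H \<Longrightarrow> tnorm2 H s (F v) \<le> r\<^sup>2 * tnorm2 H t v"
    and w: "\<forall>i<s. w i \<in> hspace H"
  shows "tnorm2 H t (G w) \<le> r\<^sup>2 * tnorm2 H s w"
proof -
  define u where "u = F (G w)"
  have Gw: "\<forall>j<t. G w j \<in> hspace H" using G w by blast
  have u: "\<forall>i<s. u i \<in> hspace H" unfolding u_def using F Gw by blast
  have uw: "(\<Sum>i<s. Re (ip H (u i) (w i))) = tnorm2 H t (G w)"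
    unfolding tnorm2_def u_def Re_sum[symmetric] FG[OF Gw w] ..
  have ub: "tnorm2 H s u \<le> r\<^sup>2 * tnorm2 H t (G w)" unfolding u_def by (rule bound[OF Gw])
  show ?thesis
  \<comment> \<open>The general case ends by cancelling \<open>r\<^sup>2\<close>. For
    \<open>r = 0\<close> the vector \<open>u\<close> vanishes, and with it its pairing with
    \<open>w\<close>, which is the squared norm of \<open>G w\<close>.\<close>
  proof (cases "r = 0")
    case True
    then have "tnorm2 H s u = 0" using ub tnorm2_nonneg[of s u] u by simp
    then have "u i = 0" if "i < s" for i by (rule tnorm2_eq_0[OF u _ that])
    then have "tnorm2 H t (G w) = 0" unfolding uw[symmetric] using w by (simp add: ip_zero)
    then show ?thesis using True by (simp only: power2_eq_square)
  next
    case False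
    define c where "c = complex_of_real (r\<^sup>2)"
    have cnj_c: "cnj c = c" by (simp add: c_def)
    have "0 \<le> tnorm2 H s (\<lambda>i. scl H c (w i) - u i)"
      using w u by (intro tnorm2_nonneg allI impI hspace_diff hspace_scale) auto
    also have "\<dots> = (\<Sum>i<s. r\<^sup>2 * r\<^sup>2 * Re (ip H (w i) (w i)) - 2 * r\<^sup>2 * Re (ip H (u i) (w i)) + Re (ip H (u i) (u i)))"
      unfolding tnorm2_def
    proof (rule sum.cong)
      fix i assume "i \<in> {..<s}"
      then have wi: "w i \<in> hspace H" and ui: "u i \<in> hspace H" using w u by auto
      have "ip H (scl H c (w i) - u i) (scl H c (w i) - u i) =
          c * c * ip H (w i) (w i) - c * cnj (ip H (u i) (w i)) - c * ip H (u i) (w i) + ip H (u i) (u i)"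
        using wi ui ip_cnj[OF ui wi]
        by (simp add: ip_diff ip_diff_right hspace_diff hspace_scale ip_scl ip_scl_right algebra_simps cnj_c)
      then show "Re (ip H (scl H c (w i) - u i) (scl H c (w i) - u i)) =
          r\<^sup>2 * r\<^sup>2 * Re (ip H (w i) (w i)) - 2 * r\<^sup>2 * Re (ip H (u i) (w i)) + Re (ip H (u i) (u i))"
        by (simp add: c_def flip: of_real_mult)
    qed simp
    also have "\<dots> = r\<^sup>2 * r\<^sup>2 * tnorm2 H s w - 2 * r\<^sup>2 * tnorm2 H t (G w) + tnorm2 H s u"
      by (simp add: sum.distrib sum_subtractf uw[symmetric] tnorm2_def[of H s] sum_distrib_left)
    finally have "0 \<le> r\<^sup>2 * (r\<^sup>2 * tnorm2 H s w - tnorm2 H t (G w))"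
      using ub by (simp add: algebra_simps)
    moreover have "r\<^sup>2 > 0" using False by simp
    ultimately show ?thesis by (simp add: zero_le_mult_iff)
  qed
qed

lemma adj_matrix_ip:
  assumes M: "\<forall>i<s. \<forall>j<t. linear_operator H (M i j)"
    and v: "\<forall>j<t. v j \<in> hspace H" and w: "\<forall>i<s. w i \<in> hspace H"
  shows "(\<Sum>i<s. ip H (apply_matrix t M v i) (w i)) = (\<Sum>j<t. ip H (v j) (apply_matrix s (adj_matrix H M) w j))"
proof -
  have "(\<Sum>i<s. ip H (apply_matrix t M v i) (w i)) = (\<Sum>i<s. \<Sum>j<t. ip H (M i j (v j)) (w i))"
    unfolding apply_matrix_def using M v w by (intro sum.cong ip_sum_left) (auto intro: linear_operator_hspace)
  also have "\<dots> = (\<Sum>i<s. \<Sum>j<t. ip H (v j) (adj H (M i j) (w i)))"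
    using M v w by (intro sum.cong adj_ip) auto
  also have "\<dots> = (\<Sum>j<t. \<Sum>i<s. ip H (v j) (adj H (M i j) (w i)))" by (rule sum.swap)
  also have "\<dots> = (\<Sum>j<t. ip H (v j) (apply_matrix s (adj_matrix H M) w j))"
    unfolding apply_matrix_def adj_matrix_def using M v w
    by (intro sum.cong ip_sum_right[symmetric]) (auto intro: adj_hspace)
  finally show ?thesis .
qed

text \<open>Multipliers are known through the eigenvectors of their adjoints, so norms are computed
  on the adjoint side.\<close>

lemma matrix_opnorm_le_adj_iff:
  assumes M: "\<forall>i<s. \<forall>j<t. linear_operator H (M i j)" and r: "0 \<le> r"
  shows "matrix_opnorm H s t M \<le> r \<longleftrightarrow>
    (\<forall>w. (\<forall>i<s. w i \<in> hspace H) \<longrightarrow> tnorm2 H t (apply_matrix s (adj_matrix H M) w) \<le> r\<^sup>2 * tnorm2 H s w)"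
proof -
  have A: "\<forall>j<t. \<forall>i<s. linear_operator H (adj_matrix H M j i)"
    unfolding adj_matrix_def using M by (auto intro: linear_operator_adj)
  let ?F = "apply_matrix t M" and ?G = "apply_matrix s (adj_matrix H M)"
  have F: "?F v i \<in> hspace H" if "\<forall>j<t. v j \<in> hspace H" "i < s" for v i
    using apply_matrix_hspace[OF M that] .
  have G: "?G w j \<in> hspace H" if "\<forall>i<s. w i \<in> hspace H" "j < t" for w j
    using apply_matrix_hspace[OF A that] .
  have FG: "(\<Sum>i<s. ip H (?F v i) (w i)) = (\<Sum>j<t. ip H (v j) (?G w j))"
    if "\<forall>j<t. v j \<in> hspace H" "\<forall>i<s. w i \<in> hspace H" for v w
    by (rule adj_matrix_ip[OF M that])
  have GF: "(\<Sum>j<t. ip H (?G w j) (v j)) = (\<Sum>i<s. ip H (w i) (?F v i))"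
    if "\<forall>i<s. w i \<in> hspace H" "\<forall>j<t. v j \<in> hspace H" for v w
  proof -
    have "(\<Sum>j<t. ip H (?G w j) (v j)) = cnj (\<Sum>j<t. ip H (v j) (?G w j))"
      unfolding cnj_sum using that G by (intro sum.cong ip_cnj) auto
    also have "\<dots> = cnj (\<Sum>i<s. ip H (?F v i) (w i))" by (simp add: FG[OF that(2,1)])
    also have "\<dots> = (\<Sum>i<s. ip H (w i) (?F v i))"
      unfolding cnj_sum using that F by (intro sum.cong ip_cnj[symmetric]) auto
    finally show ?thesis .
  qed
  show ?thesis unfolding matrix_opnorm_le_iff[OF M r]
    using adjoint_bound[of t s ?F ?G r, OF F G FG] adjoint_bound[of s t ?G ?F r, OF G F GF] by blast
qed

end

section \<open>Contractive matrices of multipliers\<close>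

lemma psd_gram: "psd A (\<lambda>x y. \<Sum>k<m::nat. g x k * cnj (g y k))"
proof -
  have "0 \<le> Re (qform A (\<lambda>x y. \<Sum>k<m. g x k * cnj (g y k)) a)" for a
    unfolding sform_kernel_sum sform_rank_one Re_sum complex_norm_square[symmetric]
    by (intro sum_nonneg) simp
  then show ?thesis by (simp add: psd_def hermitian_def mult.commute)
qed

lemma psd_add:
  assumes "psd A P" "psd A Q" shows "psd A (\<lambda>x y. P x y + Q x y)"
proof -
  have "hermitian A (\<lambda>x y. P x y + Q x y)"
    unfolding hermitian_def
    by (auto simp flip: hermitianD[OF psd_hermitian[OF assms(1)]] hermitianD[OF psd_hermitian[OF assms(2)]])
  then show ?thesis
    using psd_nonneg[OF assms(1)] psd_nonneg[OF assms(2)] by (simp add: psd_def sform_kernel_add)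
qed

text \<open>Schur product theorem for a factor already written as a Gram matrix: each summand is
  \<open>P\<close> conjugated by a diagonal matrix.\<close>

lemma psd_gram_mult:
  assumes "psd A P" shows "psd A (\<lambda>x y. (\<Sum>k<m::nat. g x k * cnj (g y k)) * P x y)"
proof -
  have "hermitian A (\<lambda>x y. (\<Sum>k<m. g x k * cnj (g y k)) * P x y)"
    unfolding hermitian_def
    by (auto simp: mult.commute simp flip: hermitianD[OF psd_hermitian[OF assms(1)]])
  moreover have "0 \<le> Re (qform A (\<lambda>x y. (\<Sum>k<m. g x k * cnj (g y k)) * P x y) a)" for a
    unfolding sum_distrib_right sform_kernel_sum sform_kernel_conj Re_sum
    by (intro sum_nonneg psd_nonneg[OF assms])
  ultimately show ?thesis by (simp add: psd_def)
qed

lemma psd_extend_zero: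
  assumes "psd A P" "finite B" "A \<subseteq> B" "\<And>x y. \<lbrakk>x \<in> B; y \<in> B; x \<notin> A \<or> y \<notin> A\<rbrakk> \<Longrightarrow> P x y = 0"
  shows "psd B P"
proof -
  have "qform B P a = qform A P a" for a
  proof -
    have "qform B P a = (\<Sum>x\<in>B. \<Sum>y\<in>A. a x * cnj (a y) * P x y)"
      unfolding sform_def
      by (intro sum.cong refl sum.mono_neutral_right) (use assms in auto)
    also have "\<dots> = qform A P a"
      unfolding sform_def by (intro sum.mono_neutral_right) (use assms in \<open>auto intro!: sum.neutral\<close>)
    finally show ?thesis .
  qed
  moreover have "hermitian B P"
    unfolding hermitian_def
  proof (intro ballI)
    fix x y assume xy: "x \<in> B" "y \<in> B"
    show "P y x = cnj (P x y)"
    proof (cases "x \<in> A \<and> y \<in> A")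
      case True then show ?thesis using hermitianD[OF psd_hermitian[OF assms(1)], of x y] by blast
    next
      case False
      then have "P x y = 0" "P y x = 0" using assms(4) xy by blast+
      then show ?thesis by simp
    qed
  qed
  ultimately show ?thesis using assms(1) by (simp add: psd_def)
qed

text \<open>The weights depend on the pair but the kernel on first components alone, so the sum over
  \<open>B\<close> can be carried out separately in each argument.\<close>

lemma sform_times:
  "sform (A \<times> B) (\<lambda>p q. f p * cnj (f' q) * K (fst p) (fst q)) a b =
   sform A K (\<lambda>x. \<Sum>i\<in>B. a (x, i) * f (x, i)) (\<lambda>x. \<Sum>i\<in>B. b (x, i) * f' (x, i))"
proof -
  have "sform (A \<times> B) (\<lambda>p q. f p * cnj (f' q) * K (fst p) (fst q)) a b =
     (\<Sum>p\<in>A \<times> B. a p * f p * (\<Sum>q\<in>A \<times> B. cnj (b q * f' q) * K (fst p) (fst q)))"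
    unfolding sform_def sum_distrib_left by (simp add: mult_ac)
  also have "\<dots> = (\<Sum>x\<in>A. \<Sum>i\<in>B. a (x, i) * f (x, i) * (\<Sum>y\<in>A. \<Sum>k\<in>B. cnj (b (y, k) * f' (y, k)) * K x y))"
    by (simp add: sum.cartesian_product case_prod_unfold)
  also have "\<dots> = (\<Sum>x\<in>A. (\<Sum>i\<in>B. a (x, i) * f (x, i)) * (\<Sum>y\<in>A. cnj (\<Sum>k\<in>B. b (y, k) * f' (y, k)) * K x y))"
    by (simp add: sum_distrib_right)
  finally show ?thesis unfolding sform_left .
qed

text \<open>If \<open>M i j\<close> are multipliers whose adjoints have eigenvalue \<open>c i j x\<close> at the kernel function \<open>x\<close>,
  then \<open>contractive K A s t r c\<close> says that the matrix \<open>M\<close> has norm at most \<open>r\<close>.\<close>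

definition contractive ::
  "('a \<Rightarrow> 'a \<Rightarrow> complex) \<Rightarrow> 'a set \<Rightarrow> nat \<Rightarrow> nat \<Rightarrow> real \<Rightarrow> (nat \<Rightarrow> nat \<Rightarrow> 'a \<Rightarrow> complex) \<Rightarrow> bool" where
  "contractive K A s t r c \<longleftrightarrow> psd (A \<times> {..<s}) (\<lambda>p q.
     ((if snd p = snd q then of_real (r\<^sup>2) else 0) -
      (\<Sum>j<t. c (snd p) j (fst p) * cnj (c (snd q) j (fst q)))) * K (fst p) (fst q))"

text \<open>In this form the diagonal term of \<open>contractive\<close> is a sum of rank one
  kernels over unit vectors, like the term subtracted from it.\<close>

lemma diagonal_gram:
  assumes "p \<in> A \<times> {..<s :: nat}"
  shows "(if snd p = snd q then of_real (r\<^sup>2) else 0) =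
    (\<Sum>k<s. (if snd p = k then of_real r else 0) * cnj (if snd q = k then complex_of_real r else 0))"
proof -
  have "(\<Sum>k<s. (if snd p = k then of_real r else 0) * cnj (if snd q = k then complex_of_real r else 0)) =
      (\<Sum>k<s. if k = snd p then (if snd p = snd q then of_real (r\<^sup>2) else 0) else 0)"
    by (rule sum.cong) (auto simp: power2_eq_square)
  also have "\<dots> = (if snd p = snd q then of_real (r\<^sup>2) else 0)"
    by (subst sum.delta) (use assms in auto)
  finally show ?thesis by simp
qed

text \<open>Semidefiniteness on pairs is the norm inequality for the adjoint matrix in coordinates:
  \<open>a i\<close> holds the coefficients of the \<open>i\<close>-th component, and each
  \<open>c i j\<close> acts on them diagonally.\<close>

lemma contractive_iff:
  assumes "hermitian A K"
  shows "contractive K A s t r c \<longleftrightarrow> (\<forall>a :: nat \<Rightarrow> 'a \<Rightarrow> complex.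
    (\<Sum>j<t. Re (qform A K (\<lambda>x. \<Sum>i<s. a i x * c i j x)))
      \<le> r\<^sup>2 * (\<Sum>i<s. Re (qform A K (a i))))"
proof -
  let ?P = "\<lambda>p q. ((if snd p = snd q then of_real (r\<^sup>2) else 0) -
      (\<Sum>j<t. c (snd p) j (fst p) * cnj (c (snd q) j (fst q)))) * K (fst p) (fst q)"
  have form: "Re (qform (A \<times> {..<s}) ?P a) = r\<^sup>2 * (\<Sum>i<s. Re (qform A K (\<lambda>x. a (x, i))))
      - (\<Sum>j<t. Re (qform A K (\<lambda>x. \<Sum>i<s. a (x, i) * c i j x)))" for a
  proof -
    let ?d = "\<lambda>k p. if snd p = k then complex_of_real r else 0"
    have "qform (A \<times> {..<s}) ?P a = qform (A \<times> {..<s}) (\<lambda>p q.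
        (\<Sum>k<s. ?d k p * cnj (?d k q) * K (fst p) (fst q)) -
        (\<Sum>j<t. c (snd p) j (fst p) * cnj (c (snd q) j (fst q)) * K (fst p) (fst q))) a"
      by (intro sform_cong refl) (simp only: diagonal_gram left_diff_distrib sum_distrib_right)
    also have "\<dots> = (\<Sum>k<s. qform A K (\<lambda>x. \<Sum>i<s. a (x, i) * ?d k (x, i)))
        - (\<Sum>j<t. qform A K (\<lambda>x. \<Sum>i<s. a (x, i) * c i j x))"
      unfolding sform_kernel_diff sform_kernel_sum
      by (simp only: sform_times[of A "{..<s}" _ _ K] sform_times[of A "{..<s}" "\<lambda>p. c (snd p) _ (fst p)" "\<lambda>p. c (snd p) _ (fst p)" K] fst_conv snd_conv)
    also have "(\<Sum>k<s. qform A K (\<lambda>x. \<Sum>i<s. a (x, i) * ?d k (x, i))) =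
        of_real (r\<^sup>2) * (\<Sum>k<s. qform A K (\<lambda>x. a (x, k)))"
      unfolding sum_distrib_left
    proof (rule sum.cong)
      fix k assume k: "k \<in> {..<s}"
      have "(\<Sum>i<s. a (x, i) * ?d k (x, i)) = of_real r * a (x, k)" for x
      proof -
        have "(\<Sum>i<s. a (x, i) * ?d k (x, i)) = (\<Sum>i<s. if i = k then of_real r * a (x, k) else 0)"
          by (rule sum.cong) auto
        then show ?thesis using k by simp
      qed
      then show "qform A K (\<lambda>x. \<Sum>i<s. a (x, i) * ?d k (x, i)) =
          of_real (r\<^sup>2) * qform A K (\<lambda>x. a (x, k))"
        by (simp add: sform_scale_left sform_scale_right power2_eq_square)
    qed simp
    finally show ?thesis by simp
  qed
  have herm: "hermitian (A \<times> {..<s}) ?P"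
    unfolding hermitian_def by (auto simp: mult.commute simp flip: hermitianD[OF assms])
  show ?thesis
    unfolding contractive_def psd_def
  proof (intro iffI conjI allI herm)
    fix a :: "nat \<Rightarrow> 'a \<Rightarrow> complex"
    assume "hermitian (A \<times> {..<s}) ?P \<and> (\<forall>a. 0 \<le> Re (qform (A \<times> {..<s}) ?P a))"
    then have "0 \<le> Re (qform (A \<times> {..<s}) ?P (\<lambda>p. a (snd p) (fst p)))" by blast
    then show "(\<Sum>j<t. Re (qform A K (\<lambda>x. \<Sum>i<s. a i x * c i j x)))
      \<le> r\<^sup>2 * (\<Sum>i<s. Re (qform A K (a i)))"
      unfolding form by simp
  next
    fix a :: "'a \<times> nat \<Rightarrow> complex"
    assume "\<forall>a :: nat \<Rightarrow> 'a \<Rightarrow> complex.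
      (\<Sum>j<t. Re (qform A K (\<lambda>x. \<Sum>i<s. a i x * c i j x)))
      \<le> r\<^sup>2 * (\<Sum>i<s. Re (qform A K (a i)))"
    from this[rule_format, of "\<lambda>i x. a (x, i)"] show "0 \<le> Re (qform (A \<times> {..<s}) ?P a)"
      unfolding form by simp
  qed
qed

lemma contractive_subset:
  "\<lbrakk>contractive K B s t r c; A \<subseteq> B; finite B\<rbrakk> \<Longrightarrow> contractive K A s t r c"
  unfolding contractive_def by (erule psd_subset) auto

lemma contractive_cong:
  assumes "\<And>i j x. \<lbrakk>i < s; j < t; x \<in> A\<rbrakk> \<Longrightarrow> c i j x = c' i j x"
  shows "contractive K A s t r c \<longleftrightarrow> contractive K A s t r c'"
  unfolding contractive_def by (intro psd_cong) (auto simp: assms)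

lemma regular_subspace_simps [simp]:
  "scl (regular_subspace H S) = scl H" "ip (regular_subspace H S) = ip H" "RK (regular_subspace H S) = S"
  by (simp_all add: regular_subspace_def)

context rkhs
begin

text \<open>The adjoint of each entry multiplies coefficients by its eigenvalues, so the inequality
  for the adjoint matrix becomes the one in \<open>contractive_iff\<close>.\<close>

lemma matrix_opnorm_le_contractive:
  assumes M: "\<forall>i<s. \<forall>j<t. linear_operator H (M i j)" and r: "0 \<le> r"
    and c: "\<And>i j x. \<lbrakk>i < s; j < t; x \<in> RK H\<rbrakk> \<Longrightarrow> adj H (M i j) x = scl H (c i j x) x"
  shows "matrix_opnorm H s t M \<le> r \<longleftrightarrow> contractive (ip H) (RK H) s t r c"
proof -
  have A: "apply_matrix s (adj_matrix H M) (\<lambda>i. comb (a i)) j = comb (\<lambda>x. \<Sum>i<s. a i x * c i j x)"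
    if j: "j < t" for a j
  proof -
    have "apply_matrix s (adj_matrix H M) (\<lambda>i. comb (a i)) j = (\<Sum>i<s. comb (\<lambda>x. a i x * c i j x))"
      unfolding apply_matrix_def adj_matrix_def
    proof (rule sum.cong)
      fix i assume "i \<in> {..<s}"
      then show "adj H (M i j) (comb (a i)) = comb (\<lambda>x. a i x * c i j x)"
        using M j by (intro adj_comb c) auto
    qed simp
    also have "\<dots> = comb (\<lambda>x. \<Sum>i<s. a i x * c i j x)"
      unfolding comb_def by (subst sum.swap) (simp add: scale_sum_left)
    finally show ?thesis .
  qed
  have n1: "tnorm2 H t (apply_matrix s (adj_matrix H M) (\<lambda>i. comb (a i))) =
     (\<Sum>j<t. Re (qform (RK H) (ip H) (\<lambda>x. \<Sum>i<s. a i x * c i j x)))" for a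
    unfolding tnorm2_def by (intro sum.cong refl) (simp only: A lessThan_iff ip_comb)
  have n2: "tnorm2 H s (\<lambda>i. comb (a i)) = (\<Sum>i<s. Re (qform (RK H) (ip H) (a i)))" for a
    unfolding tnorm2_def ip_comb ..
  show ?thesis
    unfolding matrix_opnorm_le_adj_iff[OF M r] contractive_iff[OF hermitian_gram] n1[symmetric] n2[symmetric]
  proof (intro iffI allI impI)
    fix a
    assume "\<forall>w. (\<forall>i<s. w i \<in> hspace H) \<longrightarrow> tnorm2 H t (apply_matrix s (adj_matrix H M) w) \<le> r\<^sup>2 * tnorm2 H s w"
    then show "tnorm2 H t (apply_matrix s (adj_matrix H M) (\<lambda>i. comb (a i))) \<le> r\<^sup>2 * tnorm2 H s (\<lambda>i. comb (a i))"
      using comb_hspace by (elim allE[of _ "\<lambda>i. comb (a i)"]) simp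
  next
    fix w
    assume le: "\<forall>a. tnorm2 H t (apply_matrix s (adj_matrix H M) (\<lambda>i. comb (a i))) \<le> r\<^sup>2 * tnorm2 H s (\<lambda>i. comb (a i))"
      and w: "\<forall>i<s. w i \<in> hspace H"
    have cw: "comb (coef (w i)) = w i" if "i < s" for i using w that by (simp add: comb_coef)
    have "tnorm2 H s (\<lambda>i. comb (coef (w i))) = tnorm2 H s w"
      unfolding tnorm2_def by (intro sum.cong refl) (simp add: cw)
    moreover have "apply_matrix s (adj_matrix H M) (\<lambda>i. comb (coef (w i))) = apply_matrix s (adj_matrix H M) w"
      unfolding apply_matrix_def by (intro ext sum.cong refl) (simp add: cw)
    ultimately show "tnorm2 H t (apply_matrix s (adj_matrix H M) w) \<le> r\<^sup>2 * tnorm2 H s w"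
      using le[rule_format, of "\<lambda>i. coef (w i)"] by simp
  qed
qed

lemma RK_nonzero: "x \<in> RK H \<Longrightarrow> x \<noteq> 0"
  using independent_RK dependent_zero by blast

lemma rkhs_regular_subspace:
  assumes "S \<subseteq> RK H" shows "rkhs (regular_subspace H S)"
proof -
  have sub: "hspace (regular_subspace H S) \<subseteq> hspace H"
    unfolding hspace_def regular_subspace_def using span_mono[OF assms] by simp
  have "vector_space (scl H)" by unfold_locales
  moreover have "finite S" "independent S"
    using finite_subset[OF assms finite_RK] independent_mono[OF independent_RK assms] by blast+
  ultimately show ?thesis
    unfolding rkhs_def rkhs_axioms_def regular_subspace_simps
    by (intro conjI allI impI) 
      (simp_all add: ip_add ip_scl ip_pos subsetD[OF sub], rule ip_cnj[OF subsetD[OF sub] subsetD[OF sub]])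
qed

end

section \<open>The complete Pick property in terms of eigenvalues\<close>

lemma multiplier_eigenvalues:
  assumes "\<forall>i<s. \<forall>j<t. multiplier H (M i j)"
  obtains c where "\<And>i j x. \<lbrakk>i < s; j < t; x \<in> RK H\<rbrakk> \<Longrightarrow> adj H (M i j) x = scl H (c i j x) x"
proof -
  have "\<exists>d. \<forall>x\<in>RK H. adj H (M i j) x = scl H (d x) x" if "i < s" "j < t" for i j
  proof -
    have "\<forall>k\<in>RK H. \<exists>c. adj H (M i j) k = scl H c k" using assms that by (auto simp: multiplier_def)
    then show ?thesis by (rule bchoice)
  qed
  then show ?thesis using that by metis
qed

text \<open>The Pick property as a statement about numbers. Every array \<open>c\<close> on
  \<open>S\<close> belongs to multipliers of the subspace, and since kernel functions are nonzero
  the eigenvalues of an extension agree with \<open>c\<close> on \<open>S\<close>.\<close>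

lemma CPP_extend:
  assumes H: "H \<in> CPP" and S: "S \<subseteq> RK H" and st: "1 \<le> s" "1 \<le> t" and r: "0 \<le> r"
    and c: "contractive (ip H) S s t r c"
  shows "\<exists>c'. (\<forall>i<s. \<forall>j<t. \<forall>x\<in>S. c' i j x = c i j x) \<and> contractive (ip H) (RK H) s t r c'"
proof -
  let ?J = "regular_subspace H S"
  interpret rkhs H using H by (simp add: CPP_def irreducible_rkhs_def)
  interpret J: rkhs ?J using S by (rule rkhs_regular_subspace)
  have "\<forall>i j. \<exists>M. multiplier ?J M \<and> (\<forall>x\<in>S. adj ?J M x = scl H (c i j x) x)"
    using J.ex_multiplier by simp
  then obtain M where M: "\<And>i j. multiplier ?J (M i j)"
    "\<And>i j x. x \<in> S \<Longrightarrow> adj ?J (M i j) x = scl H (c i j x) x"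
    by metis
  have "matrix_opnorm ?J s t M \<le> r"
    by (subst J.matrix_opnorm_le_contractive[where c = c]) (use M c r in \<open>simp_all add: multiplier_def\<close>)
  moreover have "\<exists>N. (\<forall>i<s. \<forall>j<t. multiplier H (N i j) \<and> extends_multiplier H (N i j) ?J (M i j)) \<and>
      matrix_opnorm H s t N = matrix_opnorm ?J s t M"
  proof -
    have "\<forall>i<s. \<forall>j<t. multiplier ?J (M i j)" using M(1) by blast
    moreover from H have "\<forall>S\<subseteq>RK H. \<forall>s\<ge>1. \<forall>t\<ge>1. \<forall>M.
       (\<forall>i<s. \<forall>j<t. multiplier (regular_subspace H S) (M i j)) \<longrightarrow>
       (\<exists>N. (\<forall>i<s. \<forall>j<t. multiplier H (N i j) \<and>
                extends_multiplier H (N i j) (regular_subspace H S) (M i j)) \<and>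
            matrix_opnorm H s t N = matrix_opnorm (regular_subspace H S) s t M)"
      unfolding CPP_def mem_Collect_eq by (rule conjunct2)
    ultimately show ?thesis using S st by simp
  qed
  ultimately obtain N where N0: "\<forall>i<s. \<forall>j<t. multiplier H (N i j) \<and> extends_multiplier H (N i j) ?J (M i j)"
    "matrix_opnorm H s t N \<le> r"
    by auto
  then have N: "\<forall>i<s. \<forall>j<t. multiplier H (N i j)"
    "\<forall>i<s. \<forall>j<t. extends_multiplier H (N i j) ?J (M i j)" "matrix_opnorm H s t N \<le> r"
    by blast+
  obtain c' where c': "\<And>i j x. \<lbrakk>i < s; j < t; x \<in> RK H\<rbrakk> \<Longrightarrow> adj H (N i j) x = scl H (c' i j x) x"
    using multiplier_eigenvalues[OF N(1)] by metis
  have "contractive (ip H) (RK H) s t r c'"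
    using N(1,3) c' r by (subst matrix_opnorm_le_contractive[where M = N, symmetric]) (auto simp: multiplier_def)
  moreover have "c' i j x = c i j x" if "i < s" "j < t" "x \<in> S" for i j x
  proof -
    have "adj H (N i j) x = adj ?J (M i j) x"
      using N(2)[rule_format, OF that(1,2)] J.RK_hspace[of x] that(3) unfolding extends_multiplier_def by simp
    then have "scl H (c' i j x) x = scl H (c i j x) x" using c' M(2) that S by auto
    then show ?thesis using RK_nonzero[of x] that(3) S by auto
  qed
  ultimately show ?thesis by blast
qed

text \<open>Extension without increase of the norm gives equality, since a matrix of multipliers
  never has smaller norm than the matrix it extends.\<close>

lemma CPP_I:
  assumes H: "H \<in> irreducible_rkhs"
    and ext: "\<And>S s t r c. \<lbrakk>S \<subseteq> RK H; contractive (ip H) S s t r c\<rbrakk> \<Longrightarrow>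
      \<exists>c'. (\<forall>i<s. \<forall>j<t. \<forall>x\<in>S. c' i j x = c i j x) \<and> contractive (ip H) (RK H) s t r c'"
  shows "H \<in> CPP"
proof -
  interpret rkhs H using H by (simp add: irreducible_rkhs_def)
  have "\<exists>N. (\<forall>i<s. \<forall>j<t. multiplier H (N i j) \<and> extends_multiplier H (N i j) (regular_subspace H S) (M i j)) \<and>
      matrix_opnorm H s t N = matrix_opnorm (regular_subspace H S) s t M"
    if S: "S \<subseteq> RK H" and M: "\<forall>i<s. \<forall>j<t. multiplier (regular_subspace H S) (M i j)" for S s t M
  proof -
    let ?J = "regular_subspace H S"
    interpret J: rkhs ?J using S by (rule rkhs_regular_subspace)
    have Ml: "\<forall>i<s. \<forall>j<t. linear_operator ?J (M i j)" using M by (auto simp: multiplier_def)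
    \<comment> \<open>The extension hypothesis is applied with the exact norm of \<open>M\<close> as
      its bound.\<close>
    define r where "r = matrix_opnorm ?J s t M"
    have r: "0 \<le> r" unfolding r_def by (rule J.matrix_opnorm_nonneg[OF Ml])
    obtain c where c: "\<And>i j x. \<lbrakk>i < s; j < t; x \<in> S\<rbrakk> \<Longrightarrow> adj ?J (M i j) x = scl H (c i j x) x"
      using multiplier_eigenvalues[OF M] by (metis regular_subspace_simps)
    have J_iff: "matrix_opnorm ?J s t M \<le> q \<longleftrightarrow> contractive (ip H) S s t q c" if "0 \<le> q" for q
      using J.matrix_opnorm_le_contractive[OF Ml that, of c] c by simp
    obtain c' where c': "\<forall>i<s. \<forall>j<t. \<forall>x\<in>S. c' i j x = c i j x" "contractive (ip H) (RK H) s t r c'"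
      using ext[OF S] J_iff[OF r] by (metis order_refl r_def)
    have "\<forall>i j. \<exists>N. multiplier H N \<and> (\<forall>x\<in>RK H. adj H N x = scl H (c' i j x) x)"
      using ex_multiplier by blast
    then obtain N where N: "\<And>i j. multiplier H (N i j)"
      "\<And>i j x. x \<in> RK H \<Longrightarrow> adj H (N i j) x = scl H (c' i j x) x"
      by metis
    have Nl: "\<forall>i<s. \<forall>j<t. linear_operator H (N i j)" using N(1) by (auto simp: multiplier_def)
    have N_iff: "matrix_opnorm H s t N \<le> q \<longleftrightarrow> contractive (ip H) (RK H) s t q c'" if "0 \<le> q" for q
      using matrix_opnorm_le_contractive[OF Nl that, of c'] N(2) by simp
    define q where "q = matrix_opnorm H s t N"
    have q: "0 \<le> q" unfolding q_def by (rule matrix_opnorm_nonneg[OF Nl])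
    have "contractive (ip H) (RK H) s t q c'" using N_iff[OF q] by (simp add: q_def)
    \<comment> \<open>Restricting the semidefinite condition to \<open>S\<close> yields the reverse
      inequality \<open>r \<le> q\<close>.\<close>
    then have "contractive (ip H) S s t q c'" using S finite_RK by (rule contractive_subset)
    then have "contractive (ip H) S s t q c" using contractive_cong[of s t S c' c] c'(1) by blast
    then have "r \<le> q" using J_iff[OF q] by (simp add: r_def)
    moreover have "q \<le> r" using N_iff[OF r] c'(2) by (simp add: q_def)
    ultimately have "q = r" by simp
    moreover have "extends_multiplier H (N i j) ?J (M i j)" if ij: "i < s" "j < t" for i j
      unfolding extends_multiplier_def
    proof
      fix v assume v: "v \<in> hspace ?J"
      have vJ: "v = (\<Sum>x\<in>S. scl H (J.coef v x) x)"
        using J.comb_coef[OF v] by (simp add: J.comb_def)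
      have "adj H (N i j) v = (\<Sum>x\<in>S. scl H (J.coef v x) (adj H (N i j) x))"
        by (subst vJ, rule linear_operator_sum[OF linear_operator_adj])
           (use Nl ij S RK_hspace finite_subset[OF S finite_RK] in auto)
      also have "\<dots> = (\<Sum>x\<in>S. scl H (J.coef v x) (adj ?J (M i j) x))"
        using N(2) c c'(1) ij S by (intro sum.cong) auto
      also have "\<dots> = adj ?J (M i j) v"
        using J.linear_operator_comb[OF J.linear_operator_adj, of "M i j" "J.coef v"] Ml ij J.comb_coef[OF v]
        by simp
      finally show "adj H (N i j) v = adj ?J (M i j) v" .
    qed
    ultimately show ?thesis using N(1) unfolding q_def r_def by blast
  qed
  then show ?thesis unfolding CPP_def using H by blast
qed

section \<open>The complete Pick property and the kernel\<close>

lemma sform_contractive_row: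
  "qform A (\<lambda>x y. (1 - (\<Sum>k<m::nat. g x k * cnj (g y k))) * K x y) a =
   qform A K a - (\<Sum>k<m. qform A K (\<lambda>x. a x * g x k))"
proof -
  have "qform A (\<lambda>x y. (1 - (\<Sum>k<m. g x k * cnj (g y k))) * K x y) a =
      qform A (\<lambda>x y. K x y - (\<Sum>k<m. g x k * cnj (g y k) * K x y)) a"
    by (intro sform_cong) (simp_all add: left_diff_distrib sum_distrib_right)
  then show ?thesis by (simp only: sform_kernel_diff sform_kernel_sum sform_kernel_conj)
qed

text \<open>With one row the index pair reduces to its first component, and the bound
  \<open>1\<close> makes the diagonal term \<open>1\<close>.\<close>

lemma contractive_row_iff:
  assumes "hermitian A K"
  shows "contractive K A 1 m 1 c \<longleftrightarrow> psd A (\<lambda>x y. (1 - (\<Sum>k<m. c 0 k x * cnj (c 0 k y))) * K x y)"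
proof -
  have "hermitian A (\<lambda>x y. (1 - (\<Sum>k<m. c 0 k x * cnj (c 0 k y))) * K x y)"
    unfolding hermitian_def by (auto simp: mult.commute simp flip: hermitianD[OF assms])
  then have "psd A (\<lambda>x y. (1 - (\<Sum>k<m. c 0 k x * cnj (c 0 k y))) * K x y) \<longleftrightarrow>
     (\<forall>a. (\<Sum>k<m. Re (qform A K (\<lambda>x. a x * c 0 k x))) \<le> Re (qform A K a))"
    unfolding psd_def sform_contractive_row[where g = "\<lambda>x k. c 0 k x"] by simp
  moreover have "contractive K A 1 m 1 c \<longleftrightarrow>
     (\<forall>a :: nat \<Rightarrow> 'a \<Rightarrow> complex. (\<Sum>k<m. Re (qform A K (\<lambda>x. a 0 x * c 0 k x))) \<le> Re (qform A K (a 0)))"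
    unfolding contractive_iff[OF assms] by simp
  moreover have "\<dots> \<longleftrightarrow> (\<forall>a. (\<Sum>k<m. Re (qform A K (\<lambda>x. a x * c 0 k x))) \<le> Re (qform A K a))"
    (is "(\<forall>a. ?P (a 0)) \<longleftrightarrow> (\<forall>a. ?P a)")
  proof
    assume *: "\<forall>a :: nat \<Rightarrow> 'a \<Rightarrow> complex. ?P (a 0)"
    show "\<forall>a. ?P a"
    proof
      fix a show "?P a" using *[rule_format, of "\<lambda>_. a"] .
    qed
  qed simp
  ultimately show ?thesis by simp
qed

lemma CPP_nonzero: "\<lbrakk>H \<in> CPP; h \<in> RK H; h' \<in> RK H\<rbrakk> \<Longrightarrow> ip H h h' \<noteq> 0"
  unfolding CPP_def irreducible_rkhs_def mem_Collect_eq by blast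

text \<open>The extension property is tested on the row \<open>g\<close> which represents \<open>K\<close> on \<open>T\<close>:
  \<open>(1 - \<langle>g, g\<rangle>) K\<close> has rank one there, so that contractivity of an extension of \<open>g\<close> to the
  new point \<open>e\<close> says that \<open>1 - 1/K\<close>, with \<open>K\<close> normalized at \<open>e\<close>, is positive semidefinite.\<close>

lemma pick_step:
  fixes K :: "'a \<Rightarrow> 'a \<Rightarrow> complex" and g :: "'a \<Rightarrow> nat \<Rightarrow> complex"
  assumes fin: "finite T" "e \<notin> T" and pd: "pd (insert e T) K"
    and nz: "\<And>x y. \<lbrakk>x \<in> insert e T; y \<in> insert e T\<rbrakk> \<Longrightarrow> K x y \<noteq> 0"
    and \<delta>: "\<And>x. x \<in> T \<Longrightarrow> \<delta> x \<noteq> 0"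
    and g: "\<And>x y. \<lbrakk>x \<in> T; y \<in> T\<rbrakk> \<Longrightarrow> K x y * (1 - (\<Sum>k<m. g x k * cnj (g y k))) = \<delta> x * cnj (\<delta> y)"
    and c: "\<And>x k. \<lbrakk>x \<in> T; k < m\<rbrakk> \<Longrightarrow> c x k = g x k"
    and psd: "psd (insert e T) (\<lambda>x y. (1 - (\<Sum>k<m. c x k * cnj (c y k))) * K x y)"
  shows "psd T (\<lambda>x y. schur e K x y / K x y)"
proof -
  have h: "hermitian (insert e T) K" using pd by (rule pd_hermitian)
  have hT: "hermitian T (schur e K)" using h by (rule hermitian_schur)
  have "pd {e} K" using pd by (rule pd_subset) (use fin in auto)
  from pd_pos[OF this, of "\<lambda>_. 1"] have K00: "0 < Re (K e e)" by (simp add: sform_def)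
  then have K0: "K e e \<noteq> 0" by auto
  have main: "0 \<le> Re (qform T (\<lambda>x y. (1 - (\<Sum>k<m. g x k * cnj (g y k))) * schur e K x y) a)" for a
  proof -
    \<comment> \<open>This coefficient at \<open>e\<close> turns the full form into the Schur
      complement. The unknown values \<open>c e k\<close> enter only through squares, which
      \<open>sform_schur_le\<close> drops.\<close>
    define a' where "a' = a(e := - (\<Sum>x\<in>T. a x * K x e) / K e e)"
    have "0 \<le> Re (qform (insert e T) (\<lambda>x y. (1 - (\<Sum>k<m. c x k * cnj (c y k))) * K x y) a')"
      by (rule psd_nonneg[OF psd])
    also have "\<dots> = Re (qform T (schur e K) a) -
        (\<Sum>k<m. Re (qform (insert e T) K (\<lambda>x. a' x * c x k)))"
      unfolding sform_contractive_row sform_schur[OF fin h K0] a'_def by simp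
    also have "\<dots> \<le> Re (qform T (schur e K) a) -
        (\<Sum>k<m. Re (qform T (schur e K) (\<lambda>x. a' x * c x k)))"
      by (intro diff_left_mono sum_mono sform_schur_le fin h K00)
    also have "(\<Sum>k<m. Re (qform T (schur e K) (\<lambda>x. a' x * c x k))) =
        (\<Sum>k<m. Re (qform T (schur e K) (\<lambda>x. a x * g x k)))"
      using fin(2) c by (intro sum.cong refl arg_cong[where f = Re] sform_cong) (auto simp: a'_def)
    finally show ?thesis unfolding sform_contractive_row by simp
  qed
  have "0 \<le> Re (qform T (\<lambda>x y. schur e K x y / K x y) a)" for a
  proof -
    \<comment> \<open>The factor built from \<open>g\<close> equals
      \<open>\<delta> x * cnj (\<delta> y) / K x y\<close>; dividing the coefficients by
      \<open>\<delta>\<close> leaves the quotient \<open>schur e K x y / K x y\<close>.\<close>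
    have "qform T (\<lambda>x y. (1 - (\<Sum>k<m. g x k * cnj (g y k))) * schur e K x y) (\<lambda>x. a x / \<delta> x) =
        qform T (\<lambda>x y. \<delta> x * cnj (\<delta> y) * (schur e K x y / K x y)) (\<lambda>x. a x / \<delta> x)"
    proof (intro sform_cong refl)
      fix x y assume xy: "x \<in> T" "y \<in> T"
      show "(1 - (\<Sum>k<m. g x k * cnj (g y k))) * schur e K x y = \<delta> x * cnj (\<delta> y) * (schur e K x y / K x y)"
        unfolding g[OF xy, symmetric] using nz[of x y] xy by simp
    qed
    also have "\<dots> = qform T (\<lambda>x y. schur e K x y / K x y) a"
      unfolding sform_kernel_conj using \<delta> by (intro sform_cong) auto
    finally have "qform T (\<lambda>x y. schur e K x y / K x y) a =
        qform T (\<lambda>x y. (1 - (\<Sum>k<m. g x k * cnj (g y k))) * schur e K x y) (\<lambda>x. a x / \<delta> x)" ..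
    then show ?thesis using main[of "\<lambda>x. a x / \<delta> x"] by (simp only:)
  qed
  moreover have "hermitian T (\<lambda>x y. schur e K x y / K x y)"
    unfolding hermitian_def
  proof (intro ballI)
    fix x y assume "x \<in> T" "y \<in> T"
    then have "schur e K y x = cnj (schur e K x y)" "K y x = cnj (K x y)"
      using hermitianD[OF hT, of x y] hermitianD[OF h, of x y] by auto
    then show "schur e K y x / K y x = cnj (schur e K x y / K x y)" by (simp only: complex_cnj_divide)
  qed
  ultimately show ?thesis by (simp add: psd_def)
qed

text \<open>Necessity half of the McCullough-Quiggin theorem. The representation found on
  \<open>T\<close> serves as a row to be extended to \<open>e\<close>; the kernel that
  \<open>pick_step\<close> shows to be semidefinite is then factored anew. The condition
  \<open>m\<ge>1\<close> provides the \<open>t\<ge>1\<close> in the Pick property.\<close>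

lemma pick_kernel:
  assumes H: "H \<in> CPP" and T: "T \<subseteq> RK H" "finite T" "T \<noteq> {}"
  shows "\<exists>m\<ge>1. \<exists>(g :: 'v::ab_group_add \<Rightarrow> nat \<Rightarrow> complex) \<delta>. (\<forall>x\<in>T. \<delta> x \<noteq> 0) \<and>
    (\<forall>x\<in>T. \<forall>y\<in>T. ip H x y * (1 - (\<Sum>k<m. g x k * cnj (g y k))) = \<delta> x * cnj (\<delta> y))"
  using T(2,3,1)
proof (induction T rule: finite_ne_induct)
  case (singleton x)
  interpret rkhs H using H by (simp add: CPP_def irreducible_rkhs_def)
  have x: "x \<in> RK H" using singleton by simp
  have p: "0 < Re (ip H x x)" "ip H x x = of_real (Re (ip H x x))"
    by (rule ip_pos[OF RK_hspace[OF x] RK_nonzero[OF x]], rule ip_self_real[OF RK_hspace[OF x]])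
  let ?d = "complex_of_real (sqrt (Re (ip H x x)))"
  have "?d * cnj ?d = ip H x x" using p by (simp flip: of_real_mult)
  then have "(\<forall>z\<in>{x}. ?d \<noteq> 0) \<and> (\<forall>z\<in>{x}. \<forall>y\<in>{x}. ip H z y * (1 - (\<Sum>k<1. 0 * cnj 0)) = ?d * cnj ?d)"
    using p(1) by simp
  then show ?case by (intro exI[of _ 1] exI[of _ "\<lambda>_ _. 0"] exI[of _ "\<lambda>_. ?d"] conjI) auto
next
  case (insert e T)
  interpret rkhs H using H by (simp add: CPP_def irreducible_rkhs_def)
  have sub: "insert e T \<subseteq> RK H" and T: "T \<subseteq> RK H" using insert.prems by auto
  from insert.IH[OF T] obtain m :: nat and g \<delta> where m: "m \<ge> 1" and \<delta>0: "\<forall>x\<in>T. \<delta> x \<noteq> 0" and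
    g0: "\<forall>x\<in>T. \<forall>y\<in>T. ip H x y * (1 - (\<Sum>k<m. g x k * cnj (g y k))) = \<delta> x * cnj (\<delta> y)"
    by blast
  note \<delta> = bspec[OF \<delta>0] and g = bspec[OF bspec[OF g0]]
  have pd: "pd (insert e T) (ip H)" using pd_gram sub finite_RK by (rule pd_subset)
  have h: "hermitian (insert e T) (ip H)" using pd by (rule pd_hermitian)
  have nz: "ip H x y \<noteq> 0" if "x \<in> insert e T" "y \<in> insert e T" for x y
    using that sub by (intro CPP_nonzero[OF H]) blast+
  have "psd T (\<lambda>x y. \<Sum>k<1::nat. \<delta> x * cnj (\<delta> y))" by (rule psd_gram[where g = "\<lambda>x _. \<delta> x"])
  then have "psd T (\<lambda>x y. (1 - (\<Sum>k<m. g x k * cnj (g y k))) * ip H x y)"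
    by (rule psd_cong[THEN iffD1, rotated]) (simp add: g mult.commute)
  then have "contractive (ip H) T 1 m 1 (\<lambda>_ k x. g x k)"
    by (subst contractive_row_iff[OF hermitian_subset[OF h]]) auto
  then obtain c where c: "\<forall>i<1. \<forall>k<m. \<forall>x\<in>T. c i k x = g x k" "contractive (ip H) (RK H) 1 m 1 c"
    using CPP_extend[OF H T _ m, of 1 1 "\<lambda>_ k x. g x k"] by auto
  have "contractive (ip H) (insert e T) 1 m 1 c" using c(2) sub finite_RK by (rule contractive_subset)
  then have "psd (insert e T) (\<lambda>x y. (1 - (\<Sum>k<m. c 0 k x * cnj (c 0 k y))) * ip H x y)"
    by (simp only: contractive_row_iff[OF h])
  then have "psd T (\<lambda>x y. schur e (ip H) x y / ip H x y)"
    using c(1) by (intro pick_step[where \<delta> = \<delta> and g = g and m = m and c = "\<lambda>x k. c 0 k x"] insert.hyps pd nz \<delta> g) auto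
  from psd_factor[OF insert.hyps(1) this] obtain m' g' where
    g': "\<forall>x\<in>T. \<forall>y\<in>T. schur e (ip H) x y / ip H x y = (\<Sum>k<(m'::nat). g' x k * cnj (g' y k))"
    by (elim exE)
  have e: "e \<in> RK H" using sub by simp
  have p: "0 < Re (ip H e e)" "ip H e e = of_real (Re (ip H e e))"
    by (rule ip_pos[OF RK_hspace[OF e] RK_nonzero[OF e]], rule ip_self_real[OF RK_hspace[OF e]])
  define w where "w = complex_of_real (sqrt (Re (ip H e e)))"
  have w: "w \<noteq> 0" "w * w = ip H e e" "cnj w = w" using p by (simp_all add: w_def flip: of_real_mult)
  \<comment> \<open>The point \<open>e\<close> is sent to the origin. One more coordinate,
    constantly zero, ensures that there is at least one even when \<open>m' = 0\<close>.\<close>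
  define G where "G x k = (if x = e \<or> m' \<le> k then 0 else g' x k)" for x k
  \<comment> \<open>The new \<open>\<delta>\<close> is the column of \<open>e\<close> divided by the
    square root \<open>w\<close> of its diagonal entry; its rank one matrix is what
    \<open>schur\<close> subtracts from \<open>ip H\<close>.\<close>
  have "ip H x y * (1 - (\<Sum>k<Suc m'. G x k * cnj (G y k))) = ip H x e / w * cnj (ip H y e / w)"
    if xy: "x \<in> insert e T" "y \<in> insert e T" for x y
  proof -
    have "cnj (ip H y e) = ip H e y" using hermitianD[OF h, of y e] xy by simp
    then have r: "ip H x e / w * cnj (ip H y e / w) = ip H x e * ip H e y / ip H e e"
      by (simp add: w(3) flip: w(2))
    show ?thesis
    proof (cases "x = e \<or> y = e")
      case True
      then show ?thesis unfolding r using nz[of e e] by (auto simp: G_def)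
    next
      case False
      then have "(\<Sum>k<Suc m'. G x k * cnj (G y k)) = (\<Sum>k<m'. g' x k * cnj (g' y k))"
        by (simp add: G_def)
      also have "\<dots> = schur e (ip H) x y / ip H x y" using g' False xy by auto
      finally show ?thesis unfolding r schur_def using nz[OF xy] by (simp add: field_simps)
    qed
  qed
  moreover have "ip H x e / w \<noteq> 0" if "x \<in> insert e T" for x using nz[of x e] that w by simp
  ultimately show ?case by (intro exI[of _ "Suc m'"] exI[of _ G] exI[of _ "\<lambda>x. ip H x e / w"] conjI) auto
qed

text \<open>Parrott's extension argument: with \<open>K\<close> normalized at \<open>e\<close>, only the component of the extended
  adjoint operator along the kernel function of \<open>e\<close> has to be chosen.\<close>

lemma contractive_extend_one:
  fixes K :: "'a \<Rightarrow> 'a \<Rightarrow> complex" and g :: "'a \<Rightarrow> nat \<Rightarrow> complex"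
  assumes fin: "finite S" "e \<notin> S" and h: "hermitian (insert e S) K" and pos: "0 < Re (K e e)"
    and g: "\<And>x y. \<lbrakk>x \<in> S; y \<in> S\<rbrakk> \<Longrightarrow> schur e K x y = (\<Sum>k<m. g x k * cnj (g y k)) * K x y"
    and c: "contractive K S s t r c"
  shows "\<exists>c'. (\<forall>i j. \<forall>x\<in>S. c' i j x = c i j x) \<and> contractive K (insert e S) s t r c'"
proof -
  define w where "w = complex_of_real (sqrt (Re (K e e)))"
  have Kee: "K e e = of_real (Re (K e e))" by (rule hermitian_diag_real[OF h]) simp
  have w: "w * w = K e e" "w \<noteq> 0" "cnj w = w"
  proof -
    have "w * w = of_real (Re (K e e))" using pos by (simp add: w_def flip: of_real_mult)
    then show "w * w = K e e" by (simp only: Kee[symmetric])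
  qed (use pos in \<open>auto simp: w_def\<close>)
  have K0: "K e e \<noteq> 0" using pos by auto
  \<comment> \<open>Component along the kernel function of \<open>e\<close>: \<open>K\<close> is the
    sum of \<open>schur e K\<close> and the rank one matrix of \<open>u\<close>.\<close>
  define u where "u x = K x e / w" for x
  have u: "u x * cnj (u y) = K x e * K e y / K e e" if "x \<in> insert e S" "y \<in> insert e S" for x y
  proof -
    have "cnj (K y e) = K e y" using hermitianD[OF h, of y e] that by simp
    then show ?thesis by (simp add: u_def w(3) flip: w(1))
  qed
  have ue: "u e = w" using w by (simp add: u_def flip: w(1))
  define R where "R p q = (if snd p = snd q then complex_of_real (r\<^sup>2) else 0)" for p q :: "'a \<times> nat"
  define C where "C p q = (\<Sum>j<t. c (snd p) j (fst p) * cnj (c (snd q) j (fst q)))" for p q :: "'a \<times> nat"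
  \<comment> \<open>The part of the contractivity form orthogonal to \<open>e\<close>. On
    \<open>S\<close> it is the given form times a Gram matrix, hence semidefinite; at
    \<open>e\<close> it vanishes whatever eigenvalues are chosen there.\<close>
  define P where "P p q = (R p q - C p q) * schur e K (fst p) (fst q)" for p q :: "'a \<times> nat"
  define U where "U p q = R p q * (u (fst p) * cnj (u (fst q)))" for p q :: "'a \<times> nat"
  let ?A = "S \<times> {..<s}" and ?E = "{e} \<times> {..<s}"
  have split: "insert e S \<times> {..<s} = ?A \<union> ?E" by auto
  have psdP: "psd (insert e S \<times> {..<s}) P"
  proof (rule psd_extend_zero)
    have "psd ?A (\<lambda>p q. (R p q - C p q) * K (fst p) (fst q))"
      using c unfolding contractive_def R_def C_def .
    then have "psd ?A (\<lambda>p q. (\<Sum>k<m. g (fst p) k * cnj (g (fst q) k)) * ((R p q - C p q) * K (fst p) (fst q)))"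
      by (rule psd_gram_mult)
    then show "psd ?A P"
      by (rule psd_cong[THEN iffD1, rotated]) (auto simp: P_def g)
    fix p q assume "p \<in> insert e S \<times> {..<s}" "q \<in> insert e S \<times> {..<s}" "p \<notin> ?A \<or> q \<notin> ?A"
    then have "fst p = e \<or> fst q = e" by auto
    then show "P p q = 0" using K0 by (auto simp: P_def schur_def)
  qed (use fin in auto)
  have psdU: "psd (insert e S \<times> {..<s}) U"
  proof -
    have "psd (insert e S \<times> {..<s}) (\<lambda>p q. \<Sum>k<s. (u (fst p) * (if snd p = k then of_real r else 0)) *
        cnj (u (fst q) * (if snd q = k then complex_of_real r else 0)))"
      by (rule psd_gram)
    then show ?thesis
    proof (rule psd_cong[THEN iffD1, rotated])
      fix p q assume "p \<in> insert e S \<times> {..<s}"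
      then show "(\<Sum>k<s. (u (fst p) * (if snd p = k then of_real r else 0)) *
        cnj (u (fst q) * (if snd q = k then complex_of_real r else 0))) = U p q"
        unfolding U_def R_def by (subst diagonal_gram) (simp_all add: sum_distrib_left sum_distrib_right mult_ac)
    qed
  qed
  have psdQ: "psd (?A \<union> ?E) (\<lambda>p q. U p q + P p q)"
    using psd_add[OF psdU psdP] unfolding split .
  \<comment> \<open>On \<open>S\<close> the contractivity form is \<open>U + P\<close> minus the
    Gram matrix of these rows, so an extension of \<open>l\<close> dominated by \<open>U + P\<close>
    amounts to an extension of \<open>c\<close>.\<close>
  define l where "l p j = c (snd p) j (fst p) * u (fst p)" for p :: "'a \<times> nat" and j
  have "psd ?A (\<lambda>p q. U p q + P p q - (\<Sum>j<t. l p j * cnj (l q j)))"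
  proof (rule psd_cong[THEN iffD1])
    show "psd ?A (\<lambda>p q. (R p q - C p q) * K (fst p) (fst q))"
      using c unfolding contractive_def R_def C_def .
    fix p q assume pq: "p \<in> ?A" "q \<in> ?A"
    have "(\<Sum>j<t. l p j * cnj (l q j)) = C p q * (u (fst p) * cnj (u (fst q)))"
      by (simp add: l_def C_def sum_distrib_left sum_distrib_right mult_ac)
    moreover have "K (fst p) (fst q) = schur e K (fst p) (fst q) + u (fst p) * cnj (u (fst q))"
      using u[of "fst p" "fst q"] pq by (auto simp: schur_def)
    ultimately show "(R p q - C p q) * K (fst p) (fst q) = U p q + P p q - (\<Sum>j<t. l p j * cnj (l q j))"
      by (simp add: U_def P_def algebra_simps)
  qed
  note psdl = this
  have disj: "?A \<inter> ?E = {}" using fin by auto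
  have "finite ?E" "finite ?A" using fin by simp_all
  from psd_extend[OF this disj psdQ psdl] obtain l' where l'0: "\<forall>p\<in>?A. l' p = l p"
    "psd (?A \<union> ?E) (\<lambda>p q. U p q + P p q - (\<Sum>j<t. l' p j * cnj (l' q j)))"
    by (elim exE conjE)
  note l' = bspec[OF l'0(1)] l'0(2)
  \<comment> \<open>Since \<open>u e = w\<close> is nonzero, the extended rows at \<open>e\<close>
    can be divided back into eigenvalues.\<close>
  define c' where "c' i j x = (if x = e then l' (e, i) j / w else c i j x)" for i j x
  have cl: "c' (snd p) j (fst p) * u (fst p) = l' p j" if "p \<in> insert e S \<times> {..<s}" for p j
    using that l'(1)[of p] w fin(2) by (auto simp: c'_def ue l_def)
  have "contractive K (insert e S) s t r c'"
    unfolding contractive_def split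
  proof (rule psd_cong[THEN iffD1])
    show "psd (?A \<union> ?E) (\<lambda>p q. U p q + P p q - (\<Sum>j<t. l' p j * cnj (l' q j)))" by (rule l'(2))
    fix p q assume "p \<in> ?A \<union> ?E" "q \<in> ?A \<union> ?E"
    then have pq: "p \<in> insert e S \<times> {..<s}" "q \<in> insert e S \<times> {..<s}" by auto
    define D where "D = (\<Sum>j<t. c' (snd p) j (fst p) * cnj (c' (snd q) j (fst q)))"
    have 1: "(\<Sum>j<t. l' p j * cnj (l' q j)) = D * (u (fst p) * cnj (u (fst q)))"
      unfolding cl[OF pq(1), symmetric] cl[OF pq(2), symmetric] D_def
      by (simp add: sum_distrib_left sum_distrib_right mult_ac)
    have 2: "K (fst p) (fst q) = schur e K (fst p) (fst q) + u (fst p) * cnj (u (fst q))"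
      using u[of "fst p" "fst q"] pq by (auto simp: schur_def)
    have 3: "C p q * schur e K (fst p) (fst q) = D * schur e K (fst p) (fst q)"
    proof (cases "fst p = e \<or> fst q = e")
      case True then show ?thesis using K0 by (auto simp: schur_def)
    next
      case False then show ?thesis by (simp add: C_def D_def c'_def)
    qed
    show "U p q + P p q - (\<Sum>j<t. l' p j * cnj (l' q j)) =
      ((if snd p = snd q then of_real (r\<^sup>2) else 0) - (\<Sum>j<t. c' (snd p) j (fst p) * cnj (c' (snd q) j (fst q)))) * K (fst p) (fst q)"
      unfolding 1 2 D_def[symmetric] R_def[symmetric] U_def P_def using 3 by (auto simp: algebra_simps)
  qed
  moreover have "\<forall>i j. \<forall>x\<in>S. c' i j x = c i j x" using fin(2) by (auto simp: c'_def)
  ultimately show ?thesis by blast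
qed

text \<open>The factorization is assumed at every base point because the inductive step uses it at
  the point just added.\<close>

lemma contractive_extend:
  fixes K :: "'a \<Rightarrow> 'a \<Rightarrow> complex"
  assumes "finite E" "finite S" "S \<inter> E = {}" "hermitian (S \<union> E) K"
    and "\<And>x. x \<in> S \<union> E \<Longrightarrow> 0 < Re (K x x)"
    and "\<And>e. e \<in> S \<union> E \<Longrightarrow> \<exists>m (g :: 'a \<Rightarrow> nat \<Rightarrow> complex). \<forall>x\<in>S \<union> E. \<forall>y\<in>S \<union> E.
      schur e K x y = (\<Sum>k<m. g x k * cnj (g y k)) * K x y"
    and "contractive K S s t r c"
  shows "\<exists>c'. (\<forall>i j. \<forall>x\<in>S. c' i j x = c i j x) \<and> contractive K (S \<union> E) s t r c'"
  using assms
proof (induction E rule: finite_induct)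
  case empty then show ?case by auto
next
  case (insert e E)
  have sub: "S \<union> E \<subseteq> S \<union> insert e E" by auto
  have "\<exists>c'. (\<forall>i j. \<forall>x\<in>S. c' i j x = c i j x) \<and> contractive K (S \<union> E) s t r c'"
  proof (rule insert.IH)
    show "hermitian (S \<union> E) K" using insert.prems(3) sub by (rule hermitian_subset)
    show "\<exists>m (g :: 'a \<Rightarrow> nat \<Rightarrow> complex). \<forall>x\<in>S \<union> E. \<forall>y\<in>S \<union> E.
      schur f K x y = (\<Sum>k<m. g x k * cnj (g y k)) * K x y" if "f \<in> S \<union> E" for f
      using insert.prems(5)[of f] that sub by (meson subsetD)
  qed (use insert.prems in auto)
  then obtain c' where c': "\<forall>i j. \<forall>x\<in>S. c' i j x = c i j x" "contractive K (S \<union> E) s t r c'" by blast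
  have "e \<in> S \<union> insert e E" by simp
  from insert.prems(5)[OF this] obtain m and g :: "'a \<Rightarrow> nat \<Rightarrow> complex" where
    g: "\<forall>x\<in>S \<union> insert e E. \<forall>y\<in>S \<union> insert e E. schur e K x y = (\<Sum>k<m. g x k * cnj (g y k)) * K x y"
    by (elim exE)
  have "\<exists>c''. (\<forall>i j. \<forall>x\<in>S \<union> E. c'' i j x = c' i j x) \<and> contractive K (insert e (S \<union> E)) s t r c''"
  proof (rule contractive_extend_one[OF _ _ _ _ _ c'(2)])
    show "hermitian (insert e (S \<union> E)) K" using insert.prems(3) by simp
    show "schur e K x y = (\<Sum>k<m. g x k * cnj (g y k)) * K x y" if "x \<in> S \<union> E" "y \<in> S \<union> E" for x y
      using g that by auto
  qed (use insert in auto)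
  then obtain c'' where "\<forall>i j. \<forall>x\<in>S \<union> E. c'' i j x = c' i j x" "contractive K (insert e (S \<union> E)) s t r c''" by blast
  then show ?case using c'(1) by (intro exI[of _ c'']) auto
qed

text \<open>Sufficiency half of the McCullough-Quiggin theorem: the complement of \<open>S\<close>
  is added point by point.\<close>

lemma CPP_pick_kernelI:
  fixes H :: "'v::ab_group_add rkhs_data"
  assumes H: "H \<in> irreducible_rkhs"
    and g: "\<And>e. e \<in> RK H \<Longrightarrow> \<exists>m (g :: 'v \<Rightarrow> nat \<Rightarrow> complex). \<forall>x\<in>RK H. \<forall>y\<in>RK H.
      schur e (ip H) x y = (\<Sum>k<m. g x k * cnj (g y k)) * ip H x y"
  shows "H \<in> CPP"
proof (rule CPP_I[OF H])
  interpret rkhs H using H by (simp add: irreducible_rkhs_def)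
  fix S s t r and c :: "nat \<Rightarrow> nat \<Rightarrow> 'v \<Rightarrow> complex"
  assume S: "S \<subseteq> RK H" and c: "contractive (ip H) S s t r c"
  have SE: "S \<union> (RK H - S) = RK H" using S by auto
  have "\<exists>c'. (\<forall>i j. \<forall>x\<in>S. c' i j x = c i j x) \<and> contractive (ip H) (S \<union> (RK H - S)) s t r c'"
    by (rule contractive_extend)
       (use c g finite_RK finite_subset[OF S finite_RK] hermitian_gram ip_pos[OF RK_hspace RK_nonzero] in
        \<open>auto simp only: SE\<close>)
  then show "\<exists>c'. (\<forall>i<s. \<forall>j<t. \<forall>x\<in>S. c' i j x = c i j x) \<and> contractive (ip H) (RK H) s t r c'"
    unfolding SE by blast
qed

section \<open>Holomorphic maps of the ball\<close>

lemma pnorm_L2: "pnorm n z = L2_set (\<lambda>i. cmod (z i)) {..<n}"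
  by (simp add: pnorm_def L2_set_def)

lemma pnorm_nonneg: "0 \<le> pnorm n z"
  by (simp add: pnorm_L2 L2_set_nonneg)

lemma norm_le_pnorm: "i < n \<Longrightarrow> cmod (z i) \<le> pnorm n z"
  unfolding pnorm_L2 by (rule member_le_L2_set) auto

lemma pnorm_triangle: "pnorm n (\<lambda>i. z i + w i) \<le> pnorm n z + pnorm n w"
proof -
  have "pnorm n (\<lambda>i. z i + w i) \<le> L2_set (\<lambda>i. cmod (z i) + cmod (w i)) {..<n}"
    unfolding pnorm_L2 by (intro L2_set_mono) (auto intro: norm_triangle_ineq)
  also have "\<dots> \<le> pnorm n z + pnorm n w" unfolding pnorm_L2 by (rule L2_set_triangle_ineq)
  finally show ?thesis .
qed

lemma pnorm_scale: "pnorm n (\<lambda>i. c * z i) = cmod c * pnorm n z"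
  by (simp add: pnorm_L2 norm_mult L2_set_right_distrib)

lemma pnorm_le_sum: "pnorm n z \<le> (\<Sum>i<n. cmod (z i))"
  unfolding pnorm_L2 by (rule L2_set_le_sum) auto

lemma norm_sum_le_pnorm: "cmod (\<Sum>i<n. a i * h i) \<le> (\<Sum>i<n. cmod (a i)) * pnorm n h"
proof -
  have "cmod (\<Sum>i<n. a i * h i) \<le> (\<Sum>i<n. cmod (a i) * pnorm n h)"
    by (rule sum_norm_le) (auto simp: norm_mult intro!: mult_left_mono norm_le_pnorm)
  then show ?thesis by (simp add: sum_distrib_right)
qed

lemma pnorm_cong: "(\<And>i. i < n \<Longrightarrow> z i = w i) \<Longrightarrow> pnorm n z = pnorm n w"
  by (simp add: pnorm_def)

lemma pnorm_zero: "pnorm n (\<lambda>_. 0) = 0"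
  by (simp add: pnorm_def)

lemma pnorm_eq_0: "pnorm n z = 0 \<Longrightarrow> i < n \<Longrightarrow> z i = 0"
  using norm_le_pnorm[of i n z] by simp

lemma hinner_self: "hinner n z z = of_real ((pnorm n z)\<^sup>2)"
proof -
  have "0 \<le> (\<Sum>i<n. (cmod (z i))\<^sup>2)" by (intro sum_nonneg) auto
  then show ?thesis by (simp add: hinner_def pnorm_def complex_norm_square del: of_real_power)
qed

lemma hinner_cnj: "hinner n w z = cnj (hinner n z w)"
  by (simp add: hinner_def mult.commute)

lemma hinner_add_left: "hinner n (\<lambda>i. z i + w i) v = hinner n z v + hinner n w v"
  by (simp add: hinner_def algebra_simps sum.distrib)

lemma hinner_diff_left: "hinner n (\<lambda>i. z i - w i) v = hinner n z v - hinner n w v"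
  by (simp add: hinner_def algebra_simps sum_subtractf)

lemma hinner_scale_left: "hinner n (\<lambda>i. c * z i) v = c * hinner n z v"
  by (simp add: hinner_def sum_distrib_left mult_ac)

lemma hinner_diff_right: "hinner n v (\<lambda>i. z i - w i) = hinner n v z - hinner n v w"
  by (simp add: hinner_def algebra_simps sum_subtractf)

lemma hinner_add_right: "hinner n v (\<lambda>i. z i + w i) = hinner n v z + hinner n v w"
  by (simp add: hinner_def algebra_simps sum.distrib)

lemma hinner_scale_right: "hinner n v (\<lambda>i. c * z i) = cnj c * hinner n v z"
  by (simp add: hinner_def sum_distrib_left mult_ac)

lemma hinner_bound: "cmod (hinner n z w) \<le> pnorm n z * pnorm n w"
proof -
  have "cmod (hinner n z w) \<le> (\<Sum>i<n. \<bar>cmod (z i)\<bar> * \<bar>cmod (w i)\<bar>)"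
    unfolding hinner_def by (rule sum_norm_le) (simp add: norm_mult)
  also have "\<dots> \<le> pnorm n z * pnorm n w" unfolding pnorm_L2 by (rule L2_set_mult_ineq)
  finally show ?thesis .
qed

lemma hinner_ball_less_1:
  assumes "z \<in> complex_ball n" "w \<in> complex_ball n" shows "cmod (hinner n z w) < 1"
proof -
  have "pnorm n z * pnorm n w < 1 * 1"
    using assms pnorm_nonneg by (intro mult_strict_mono) (auto simp: complex_ball_def)
  then show ?thesis using hinner_bound[of n z w] by simp
qed

lemma one_minus_hinner_nonzero:
  "\<lbrakk>z \<in> complex_ball n; w \<in> complex_ball n\<rbrakk> \<Longrightarrow> 1 - hinner n z w \<noteq> 0"
  using hinner_ball_less_1[of z n w] by auto

lemma complex_ball_outside: "z \<in> complex_ball n \<Longrightarrow> n \<le> i \<Longrightarrow> z i = 0"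
  by (auto simp: complex_ball_def)

lemma zero_in_ball: "(\<lambda>_. 0) \<in> complex_ball n"
  by (simp add: complex_ball_def pnorm_zero)

lemma complex_ball_eqI:
  "\<lbrakk>z \<in> complex_ball n; w \<in> complex_ball n; \<And>i. i < n \<Longrightarrow> z i = w i\<rbrakk> \<Longrightarrow> z = w"
  using complex_ball_outside by (intro ext) (metis not_le)

text \<open>Kernels do not see the dimension of the ambient ball; this permits comparing tuples from
  balls of different dimensions.\<close>

lemma hinner_mono:
  assumes "z \<in> complex_ball n" "n \<le> N" shows "hinner N z w = hinner n z w"
  unfolding hinner_def
  by (rule sum.mono_neutral_right) (use assms complex_ball_outside in auto)

lemma complex_ball_iff: "z \<in> complex_ball n \<longleftrightarrow> (\<forall>i\<ge>n. z i = 0) \<and> Re (hinner n z z) < 1"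
  unfolding complex_ball_def hinner_self using pnorm_nonneg[of n z] by (auto simp: abs_square_less_1)

lemma complex_ball_mono: "n \<le> N \<Longrightarrow> complex_ball n \<subseteq> complex_ball N"
proof
  fix z assume "n \<le> N" and z: "z \<in> complex_ball n"
  then have "hinner N z z = hinner n z z" by (intro hinner_mono)
  then show "z \<in> complex_ball N" using z \<open>n \<le> N\<close> by (simp add: complex_ball_iff)
qed

section \<open>Derivatives and the chain rule\<close>

definition hderiv :: "nat \<Rightarrow> (point \<Rightarrow> complex) \<Rightarrow> point \<Rightarrow> (nat \<Rightarrow> complex) \<Rightarrow> bool" where
  "hderiv n f z a \<longleftrightarrow> (\<forall>e>0. \<exists>d>0. \<forall>w\<in>complex_ball n. pnorm n (w - z) < d \<longrightarrow>
     cmod (f w - f z - (\<Sum>i<n. a i * (w i - z i))) \<le> e * pnorm n (w - z))"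

lemma holomorphic_on_ball_iff:
  "holomorphic_on_ball n f \<longleftrightarrow> (\<forall>z\<in>complex_ball n. \<exists>a. hderiv n f z a)"
  unfolding holomorphic_on_ball_def hderiv_def ..

lemma hderivE:
  assumes "hderiv n f z a" "e > 0"
  obtains d where "d > 0" "\<And>w. \<lbrakk>w \<in> complex_ball n; pnorm n (w - z) < d\<rbrakk> \<Longrightarrow>
     cmod (f w - f z - (\<Sum>i<n. a i * (w i - z i))) \<le> e * pnorm n (w - z)"
  using assms unfolding hderiv_def by blast

definition hol_map :: "nat \<Rightarrow> (point \<Rightarrow> point) \<Rightarrow> bool" where
  "hol_map n F \<longleftrightarrow> F ` complex_ball n \<subseteq> complex_ball n \<and> (\<forall>i<n. holomorphic_on_ball n (\<lambda>z. F z i))"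

lemma holomorphic_on_ball_cong:
  assumes "\<And>z. z \<in> complex_ball n \<Longrightarrow> f z = g z"
  shows "holomorphic_on_ball n f \<longleftrightarrow> holomorphic_on_ball n g"
  unfolding holomorphic_on_ball_def using assms by (simp cong: ball_cong)

lemma hol_map_cong:
  assumes "\<And>z. z \<in> complex_ball n \<Longrightarrow> F z = G z" and "hol_map n F"
  shows "hol_map n G"
proof -
  have "G ` complex_ball n \<subseteq> complex_ball n" using assms by (force simp: hol_map_def)
  moreover have "holomorphic_on_ball n (\<lambda>z. G z i)" if "i < n" for i
    using holomorphic_on_ball_cong[of n "\<lambda>z. F z i" "\<lambda>z. G z i"] assms that by (auto simp: hol_map_def)
  ultimately show ?thesis by (simp add: hol_map_def)
qed

lemma holomorphic_on_ball_comp: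
  assumes F: "holomorphic_on_ball n f" and G: "hol_map n G"
  shows "holomorphic_on_ball n (\<lambda>z. f (G z))"
  unfolding holomorphic_on_ball_iff
proof
  fix z assume z: "z \<in> complex_ball n"
  have Gz: "G w \<in> complex_ball n" if "w \<in> complex_ball n" for w using G that by (auto simp: hol_map_def)
  obtain a where a: "hderiv n f (G z) a"
    using F Gz[OF z] unfolding holomorphic_on_ball_iff by blast
  have "\<forall>i\<in>{..<n}. \<exists>b. hderiv n (\<lambda>z. G z i) z b"
    using G z unfolding hol_map_def holomorphic_on_ball_iff by blast
  from bchoice[OF this] obtain b where b: "\<forall>i\<in>{..<n}. hderiv n (\<lambda>z. G z i) z (b i)" ..
  define A where "A = (\<Sum>i<n. cmod (a i))"
  \<comment> \<open>Lipschitz bound for \<open>G\<close> near \<open>z\<close>: the inner sums bound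
    the linear part, and each \<open>+ 1\<close> the remainder, because \<open>e2 \<le> 1\<close>
    below.\<close>
  define L where "L = (\<Sum>i<n. (\<Sum>k<n. cmod (b i k)) + 1)"
  have A: "A \<ge> 0" and L: "L \<ge> 0" unfolding A_def L_def by (auto intro!: sum_nonneg add_nonneg_nonneg)
  \<comment> \<open>One radius for all coordinates, the minimum of finitely many; the inserted
    \<open>1\<close> covers \<open>n = 0\<close>.\<close>
  have bu: "\<exists>d>0. \<forall>i<n. \<forall>w\<in>complex_ball n. pnorm n (w - z) < d \<longrightarrow>
      cmod (G w i - G z i - (\<Sum>k<n. b i k * (w k - z k))) \<le> e * pnorm n (w - z)" if e: "e > 0" for e
  proof -
    define Q where "Q i d \<longleftrightarrow> d > 0 \<and> (\<forall>w\<in>complex_ball n. pnorm n (w - z) < d \<longrightarrow>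
      cmod (G w i - G z i - (\<Sum>k<n. b i k * (w k - z k))) \<le> e * pnorm n (w - z))" for i d
    have "\<forall>i\<in>{..<n}. \<exists>d. Q i d"
      using b e unfolding hderiv_def Q_def by simp
    from bchoice[OF this] obtain d where d: "\<And>i. i < n \<Longrightarrow> Q i (d i)" by auto
    define m where "m = Min (insert 1 (d ` {..<n}))"
    have "m > 0" unfolding m_def using d by (subst Min_gr_iff) (auto simp: Q_def)
    moreover have "m \<le> d i" if "i < n" for i unfolding m_def using that by (intro Min_le) auto
    moreover have "Q i m" if "i < n" "m \<le> d i" for i
      using d[OF that(1)] that(2) \<open>m > 0\<close> by (auto simp: Q_def)
    ultimately have "m > 0 \<and> (\<forall>i<n. Q i m)" by blast
    then show ?thesis unfolding Q_def by (intro exI[of _ m]) simp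
  qed
  have "hderiv n (\<lambda>z. f (G z)) z (\<lambda>k. \<Sum>i<n. a i * b i k)"
    unfolding hderiv_def
  proof (intro allI impI)
    fix e :: real assume e: "e > 0"
    \<comment> \<open>Chosen such that \<open>e1 * L\<close> and \<open>A * e2\<close> are each at
      most \<open>e / 2\<close>; the \<open>+ 1\<close> in the denominators avoids division by
      zero.\<close>
    define e1 where "e1 = e / (2 * (L + 1))"
    define e2 where "e2 = min 1 (e / (2 * (A + 1)))"
    have e1: "e1 > 0" and e2: "e2 > 0" "e2 \<le> 1" using e A L by (auto simp: e1_def e2_def)
    have le1: "e1 * L \<le> e / 2" using e L by (simp add: e1_def field_simps)
    have le2: "A * e2 \<le> e / 2"
    proof -
      have "A * e2 \<le> A * (e / (2 * (A + 1)))" using A by (intro mult_left_mono) (auto simp: e2_def)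
      also have "\<dots> \<le> e / 2" using e A by (simp add: field_simps)
      finally show ?thesis .
    qed
    obtain d1 where d1: "d1 > 0" "\<And>w. \<lbrakk>w \<in> complex_ball n; pnorm n (w - G z) < d1\<rbrakk> \<Longrightarrow>
      cmod (f w - f (G z) - (\<Sum>i<n. a i * (w i - G z i))) \<le> e1 * pnorm n (w - G z)"
      by (rule hderivE[OF a e1]) (rule that)
    obtain d2 where d2: "d2 > 0" "\<And>i w. \<lbrakk>i < n; w \<in> complex_ball n; pnorm n (w - z) < d2\<rbrakk> \<Longrightarrow>
      cmod (G w i - G z i - (\<Sum>k<n. b i k * (w k - z k))) \<le> e2 * pnorm n (w - z)"
      using bu[OF e2(1)] by blast
    define d where "d = min d2 (d1 / (L + 1))"
    have d: "d > 0" using d1 d2 L by (simp add: d_def)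
    show "\<exists>d>0. \<forall>w\<in>complex_ball n. pnorm n (w - z) < d \<longrightarrow>
      cmod (f (G w) - f (G z) - (\<Sum>k<n. (\<Sum>i<n. a i * b i k) * (w k - z k))) \<le> e * pnorm n (w - z)"
    proof (intro exI[of _ d] conjI ballI impI d)
      fix w assume w: "w \<in> complex_ball n" and wd: "pnorm n (w - z) < d"
      define h where "h = pnorm n (w - z)"
      have h: "0 \<le> h" "h < d2" "h < d1 / (L + 1)" using wd pnorm_nonneg by (auto simp: d_def h_def)
      define R where "R i = G w i - G z i - (\<Sum>k<n. b i k * (w k - z k))" for i
      have R: "cmod (R i) \<le> e2 * h" if "i < n" for i
        unfolding R_def h_def using d2(2)[OF that w] h(2) by (simp add: h_def)
      have Lip: "pnorm n (G w - G z) \<le> L * h"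
      proof -
        have "cmod (G w i - G z i) \<le> ((\<Sum>k<n. cmod (b i k)) + 1) * h" if i: "i < n" for i
        proof -
          have "G w i - G z i = R i + (\<Sum>k<n. b i k * (w - z) k)" by (simp add: R_def)
          then have "cmod (G w i - G z i) \<le> cmod (R i) + cmod (\<Sum>k<n. b i k * (w - z) k)"
            using norm_triangle_ineq by metis
          also have "\<dots> \<le> 1 * h + (\<Sum>k<n. cmod (b i k)) * h"
            unfolding h_def using R[OF i] mult_right_mono[OF e2(2) h(1)]
            by (intro add_mono norm_sum_le_pnorm) (auto simp: h_def)
          finally show ?thesis by (simp add: algebra_simps)
        qed
        then have "(\<Sum>i<n. cmod ((G w - G z) i)) \<le> (\<Sum>i<n. ((\<Sum>k<n. cmod (b i k)) + 1) * h)"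
          by (intro sum_mono) auto
        then show ?thesis using pnorm_le_sum[of n "G w - G z"] by (simp add: L_def sum_distrib_right)
      qed
      have "L * h \<le> (L + 1) * h" using h(1) by (intro mult_right_mono) auto
      also have "\<dots> < d1" using h(3) L by (simp add: field_simps)
      finally have "pnorm n (G w - G z) < d1" using Lip by simp
      then have 1: "cmod (f (G w) - f (G z) - (\<Sum>i<n. a i * (G w i - G z i))) \<le> e1 * (L * h)"
        using d1(2)[OF Gz[OF w]] mult_left_mono[OF Lip less_imp_le[OF e1]] by linarith
      have 2: "cmod (\<Sum>i<n. a i * R i) \<le> A * (e2 * h)"
      proof -
        have "cmod (\<Sum>i<n. a i * R i) \<le> (\<Sum>i<n. cmod (a i) * (e2 * h))"
          using R by (intro sum_norm_le) (auto simp: norm_mult intro: mult_left_mono)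
        then show ?thesis by (simp add: A_def sum_distrib_right)
      qed
      have swap: "(\<Sum>k<n. (\<Sum>i<n. a i * b i k) * (w k - z k)) = (\<Sum>i<n. a i * (\<Sum>k<n. b i k * (w k - z k)))"
        unfolding sum_distrib_left sum_distrib_right by (subst sum.swap) (simp add: mult.assoc)
      have eq: "f (G w) - f (G z) - (\<Sum>k<n. (\<Sum>i<n. a i * b i k) * (w k - z k)) =
          (f (G w) - f (G z) - (\<Sum>i<n. a i * (G w i - G z i))) + (\<Sum>i<n. a i * R i)"
      proof -
        have "(\<Sum>i<n. a i * R i) = (\<Sum>i<n. a i * (G w i - G z i)) - (\<Sum>i<n. a i * (\<Sum>k<n. b i k * (w k - z k)))"
          by (simp only: R_def right_diff_distrib sum_subtractf)
        then show ?thesis using swap by simp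
      qed
      have "cmod (f (G w) - f (G z) - (\<Sum>k<n. (\<Sum>i<n. a i * b i k) * (w k - z k))) \<le> e1 * (L * h) + A * (e2 * h)"
        unfolding eq using norm_triangle_ineq 1 2 by (rule order_trans[OF _ add_mono])
      also have "\<dots> = (e1 * L + A * e2) * h" by (simp add: algebra_simps)
      also have "\<dots> \<le> e * h" using le1 le2 h(1) by (intro mult_right_mono) auto
      finally show "cmod (f (G w) - f (G z) - (\<Sum>k<n. (\<Sum>i<n. a i * b i k) * (w k - z k))) \<le> e * pnorm n (w - z)"
        by (simp add: h_def)
    qed
  qed
  then show "\<exists>c. hderiv n (\<lambda>z. f (G z)) z c" by (rule exI[where x = "\<lambda>k. \<Sum>i<n. a i * b i k"])
qed

lemma hol_map_comp:
  assumes "hol_map n F" "hol_map n G" shows "hol_map n (\<lambda>z. F (G z))"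
  unfolding hol_map_def
proof (intro conjI allI impI)
  show "(\<lambda>z. F (G z)) ` complex_ball n \<subseteq> complex_ball n"
    using assms unfolding hol_map_def image_subset_iff by simp
  fix i assume "i < n"
  then have "holomorphic_on_ball n (\<lambda>z. F z i)" using assms(1) by (simp add: hol_map_def)
  then show "holomorphic_on_ball n (\<lambda>z. F (G z) i)" by (rule holomorphic_on_ball_comp[OF _ assms(2)])
qed

section \<open>Automorphisms as pairs of inverse maps\<close>

definition inverse_on_ball :: "nat \<Rightarrow> (point \<Rightarrow> point) \<Rightarrow> (point \<Rightarrow> point) \<Rightarrow> bool" where
  "inverse_on_ball n f g \<longleftrightarrow> (\<forall>z\<in>complex_ball n. g (f z) = z \<and> f (g z) = z)"

text \<open>\<open>inv_into\<close> agrees with \<open>g\<close> on the ball and so inherits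
  holomorphy; values outside the ball do not enter \<open>hol_map_cong\<close>.\<close>

lemma ball_automorphismI:
  assumes f: "hol_map n f" and g: "hol_map n g" and inv: "inverse_on_ball n f g"
  shows "ball_automorphism n f"
proof -
  have maps: "f z \<in> complex_ball n" "g z \<in> complex_ball n" if "z \<in> complex_ball n" for z
    using f g that by (auto simp: hol_map_def)
  have bij: "bij_betw f (complex_ball n) (complex_ball n)"
    by (rule bij_betw_byWitness[where f' = g]) (use maps inv in \<open>auto simp: inverse_on_ball_def\<close>)
  have "g z = inv_into (complex_ball n) f z" if z: "z \<in> complex_ball n" for z
  proof (rule inv_into_f_eq[symmetric])
    show "inj_on f (complex_ball n)" using bij by (rule bij_betw_imp_inj_on)
    show "g z \<in> complex_ball n" by (rule maps(2)[OF z])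
    show "f (g z) = z" using inv z by (simp add: inverse_on_ball_def)
  qed
  then have "hol_map n (inv_into (complex_ball n) f)" using g by (rule hol_map_cong)
  then show "ball_automorphism n f" using bij f by (simp add: ball_automorphism_def hol_map_def)
qed

lemma ball_automorphism_inverse:
  assumes f: "ball_automorphism n f"
  obtains g where "hol_map n f" "hol_map n g" "inverse_on_ball n f g"
proof -
  let ?g = "inv_into (complex_ball n) f"
  have bij: "bij_betw f (complex_ball n) (complex_ball n)" using f by (simp add: ball_automorphism_def)
  then have "bij_betw ?g (complex_ball n) (complex_ball n)" by (rule bij_betw_inv_into)
  then have "hol_map n f" "hol_map n ?g"
    using f bij by (simp_all add: ball_automorphism_def hol_map_def bij_betw_def)
  moreover have "inverse_on_ball n f ?g"
    using bij_betw_inv_into_left[OF bij] bij_betw_inv_into_right[OF bij] by (simp add: inverse_on_ball_def)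
  ultimately show ?thesis by (rule that)
qed

lemma inverse_on_ball_sym: "inverse_on_ball n f g \<Longrightarrow> inverse_on_ball n g f"
  by (auto simp: inverse_on_ball_def)

lemma hol_map_ball: "hol_map n f \<Longrightarrow> z \<in> complex_ball n \<Longrightarrow> f z \<in> complex_ball n"
  by (auto simp: hol_map_def)

lemma ball_automorphism_comp:
  assumes "ball_automorphism n f" "ball_automorphism n g"
  shows "ball_automorphism n (\<lambda>z. f (g z))"
proof -
  obtain f' where f: "hol_map n f" "hol_map n f'" "inverse_on_ball n f f'"
    using assms(1) by (rule ball_automorphism_inverse)
  obtain g' where g: "hol_map n g" "hol_map n g'" "inverse_on_ball n g g'"
    using assms(2) by (rule ball_automorphism_inverse)
  show ?thesis
  proof (rule ball_automorphismI)
    show "hol_map n (\<lambda>z. f (g z))" using f(1) g(1) by (rule hol_map_comp)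
    show "hol_map n (\<lambda>z. g' (f' z))" using g(2) f(2) by (rule hol_map_comp)
    show "inverse_on_ball n (\<lambda>z. f (g z)) (\<lambda>z. g' (f' z))"
      using f g hol_map_ball[OF g(1)] hol_map_ball[OF f(2)] by (simp add: inverse_on_ball_def)
  qed
qed

lemma ball_automorphism_ball: "ball_automorphism n f \<Longrightarrow> z \<in> complex_ball n \<Longrightarrow> f z \<in> complex_ball n"
  by (auto simp: ball_automorphism_def bij_betw_def)

section \<open>The Schwarz lemma and maps fixing the origin\<close>

text \<open>Along a complex line through the origin the map becomes a function of one variable, to
  which the classical Schwarz lemma applies.\<close>

lemma holomorphic_on_disc_slice:
  assumes f: "holomorphic_on_ball n f" and u: "pnorm n u \<le> 1" "\<And>i. n \<le> i \<Longrightarrow> u i = 0"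
  shows "(\<lambda>c. f (\<lambda>i. c * u i)) holomorphic_on ball 0 1"
proof -
  have uball: "(\<lambda>i. c * u i) \<in> complex_ball n" if "cmod c < 1" for c
  proof -
    have "cmod c * pnorm n u \<le> cmod c * 1" using u(1) by (intro mult_left_mono) auto
    then show ?thesis using that u(2) by (simp add: complex_ball_def pnorm_scale)
  qed
  have "\<exists>D. ((\<lambda>c. f (\<lambda>i. c * u i)) has_field_derivative D) (at c)" if c: "cmod c < 1" for c
  proof -
    let ?p = "\<lambda>c i. c * u i"
    obtain a where a: "hderiv n f (?p c) a"
      using f uball[OF c] unfolding holomorphic_on_ball_iff by blast
    define D where "D = (\<Sum>i<n. a i * u i)"
    have "((\<lambda>y. (f (?p y) - f (?p c)) / (y - c)) \<longlongrightarrow> D) (at c)"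
    proof (rule tendstoI)
      fix e :: real assume e: "e > 0"
      obtain d where d: "d > 0" "\<And>w. \<lbrakk>w \<in> complex_ball n; pnorm n (w - ?p c) < d\<rbrakk> \<Longrightarrow>
          cmod (f w - f (?p c) - (\<Sum>i<n. a i * (w i - ?p c i))) \<le> e / 2 * pnorm n (w - ?p c)"
        by (rule hderivE[OF a half_gt_zero[OF e]]) (rule that)
      have "dist ((f (?p y) - f (?p c)) / (y - c)) D < e"
        if y: "y \<noteq> c" "dist y c < min d (1 - cmod c)" for y
      proof -
        have yc: "cmod (y - c) < d" "cmod y < 1"
          using y(2) norm_triangle_ineq2[of y c] by (auto simp: dist_norm)
        have eq: "?p y - ?p c = (\<lambda>i. (y - c) * u i)" by (auto simp: algebra_simps)
        have n1: "pnorm n (?p y - ?p c) \<le> cmod (y - c)"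
          unfolding eq pnorm_scale using u(1) by (simp add: mult_left_le)
        have "(\<Sum>i<n. a i * (?p y i - ?p c i)) = (y - c) * D"
          unfolding D_def sum_distrib_left by (intro sum.cong) (auto simp: algebra_simps)
        moreover have "pnorm n (?p y - ?p c) < d" using n1 yc by linarith
        ultimately have "cmod (f (?p y) - f (?p c) - (y - c) * D) \<le> e / 2 * pnorm n (?p y - ?p c)"
          using d(2)[OF uball[OF yc(2)]] by simp
        also have "\<dots> \<le> e / 2 * cmod (y - c)" using n1 e by (intro mult_left_mono) auto
        finally have "cmod (f (?p y) - f (?p c) - (y - c) * D) / cmod (y - c) \<le> e / 2"
          using y(1) by (simp add: divide_le_eq)
        moreover have "(f (?p y) - f (?p c)) / (y - c) - D = (f (?p y) - f (?p c) - (y - c) * D) / (y - c)"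
          using y(1) by (simp add: field_simps)
        ultimately have "dist ((f (?p y) - f (?p c)) / (y - c)) D \<le> e / 2"
          by (simp only: dist_norm norm_divide)
        then show ?thesis using e by linarith
      qed
      moreover have "min d (1 - cmod c) > 0" using d(1) c by simp
      ultimately show "\<forall>\<^sub>F y in at c. dist ((f (?p y) - f (?p c)) / (y - c)) D < e"
        unfolding eventually_at by blast
    qed
    then show ?thesis unfolding has_field_derivative_iff by blast
  qed
  then show ?thesis by (auto simp: holomorphic_on_open)
qed

lemma ball_scale:
  assumes "z \<in> complex_ball n" "cmod c \<le> 1" shows "(\<lambda>i. c * z i) \<in> complex_ball n"
proof -
  have "cmod c * pnorm n z \<le> 1 * pnorm n z" using assms pnorm_nonneg by (intro mult_right_mono)
  then show ?thesis using assms by (simp add: complex_ball_def pnorm_scale)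
qed

lemma pnorm_unit:
  assumes "z \<in> complex_ball n" "pnorm n z \<noteq> 0"
  shows "pnorm n (\<lambda>i. z i / of_real (pnorm n z)) = 1" "\<And>i. n \<le> i \<Longrightarrow> z i / of_real (pnorm n z) = 0"
  using pnorm_scale[of n "1 / of_real (pnorm n z)" z] assms pnorm_nonneg[of n z]
  by (simp_all add: norm_divide complex_ball_outside)

lemma ball_unit_scale:
  assumes "pnorm n u = 1" "\<And>i. n \<le> i \<Longrightarrow> u i = 0" "cmod c < 1"
  shows "(\<lambda>i. c * u i) \<in> complex_ball n"
  using assms by (simp add: complex_ball_def pnorm_scale)

lemma hol_map_slice:
  assumes G: "hol_map n G" and u: "pnorm n u = 1" "\<And>i. n \<le> i \<Longrightarrow> u i = 0"
  shows "(\<lambda>c. hinner n (G (\<lambda>i. c * u i)) v) holomorphic_on ball 0 1"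
proof -
  have "(\<lambda>c. G (\<lambda>i. c * u i) k) holomorphic_on ball 0 1" if "k < n" for k
    using G that u by (intro holomorphic_on_disc_slice[of n "\<lambda>z. G z k"]) (auto simp: hol_map_def)
  then show ?thesis unfolding hinner_def by (intro holomorphic_intros) auto
qed

lemma pnorm_ball_less_1: "z \<in> complex_ball n \<Longrightarrow> pnorm n z < 1"
  by (simp add: complex_ball_def)

lemma pnorm_pos: "z \<in> complex_ball n \<Longrightarrow> z \<noteq> (\<lambda>_. 0) \<Longrightarrow> 0 < pnorm n z"
  using pnorm_eq_0[of n z] complex_ball_eqI[OF _ zero_in_ball, of z n] pnorm_nonneg[of n z] by fastforce

text \<open>Pairing with a unit vector \<open>v\<close> keeps the values in the disc, by
  Cauchy-Schwarz.\<close>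

lemma hol_map_slice_Schwarz:
  assumes G: "hol_map n G" and G0: "G (\<lambda>_. 0) = (\<lambda>_. 0)"
    and u: "pnorm n u = 1" "\<And>i. n \<le> i \<Longrightarrow> u i = 0" and v: "pnorm n v = 1"
  defines "f c \<equiv> hinner n (G (\<lambda>i. c * u i)) v"
  shows "f holomorphic_on ball 0 1" "f 0 = 0" "\<And>c. cmod c < 1 \<Longrightarrow> cmod (f c) < 1"
proof -
  show "f holomorphic_on ball 0 1" unfolding f_def by (rule hol_map_slice[OF G u])
  show "f 0 = 0" by (simp add: f_def G0 hinner_def)
  fix c assume c: "cmod c < 1"
  have "cmod (f c) \<le> pnorm n (G (\<lambda>i. c * u i)) * pnorm n v" unfolding f_def by (rule hinner_bound)
  also have "\<dots> < 1" using pnorm_ball_less_1[OF hol_map_ball[OF G ball_unit_scale[OF u c]]] v by simp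
  finally show "cmod (f c) < 1" .
qed

text \<open>The disc is taken through \<open>z\<close> and paired with the direction of
  \<open>G z\<close>, so that the scalar function has the value \<open>pnorm n (G z)\<close> at
  \<open>pnorm n z\<close>.\<close>

lemma hol_map_pnorm_le:
  assumes G: "hol_map n G" and G0: "G (\<lambda>_. 0) = (\<lambda>_. 0)" and z: "z \<in> complex_ball n"
  shows "pnorm n (G z) \<le> pnorm n z"
proof (cases "pnorm n (G z) = 0 \<or> z = (\<lambda>_. 0)")
  case True then show ?thesis using G0 pnorm_nonneg[of n z] by (auto simp: pnorm_zero)
next
  case False
  define t where "t = pnorm n z"
  have t: "0 < t" "t < 1" using pnorm_pos[OF z] pnorm_ball_less_1[OF z] False by (auto simp: t_def)
  define u where "u i = z i / of_real t" for i
  have u: "pnorm n u = 1" "\<And>i. n \<le> i \<Longrightarrow> u i = 0"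
    using pnorm_unit[OF z] t unfolding u_def t_def by auto
  have Gz: "G z \<in> complex_ball n" using hol_map_ball[OF G z] .
  define v where "v i = G z i / of_real (pnorm n (G z))" for i
  have v: "pnorm n v = 1" using pnorm_unit(1)[OF Gz] False unfolding v_def by auto
  define f where "f c = hinner n (G (\<lambda>i. c * u i)) v" for c
  note f = hol_map_slice_Schwarz[OF G G0 u v, folded f_def]
  have "cmod (f (of_real t)) \<le> cmod (of_real t)"
    using t by (intro Schwarz_Lemma(1)[OF f]) auto
  moreover have "f (of_real t) = of_real (pnorm n (G z))"
  proof -
    have "(\<lambda>i. of_real t * u i) = z" using t by (auto simp: u_def)
    moreover have "v = (\<lambda>i. (1 / of_real (pnorm n (G z))) * G z i)" by (auto simp: v_def)
    ultimately have "f (of_real t) = hinner n (G z) (\<lambda>i. (1 / of_real (pnorm n (G z))) * G z i)"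
      by (simp only: f_def)
    then show ?thesis unfolding hinner_scale_right hinner_self using False by (simp add: power2_eq_square)
  qed
  ultimately show ?thesis using t pnorm_nonneg[of n "G z"] by (simp add: t_def)
qed

text \<open>The equality case of the Schwarz lemma, on the disc through \<open>z\<close>, shows that an automorphism
  fixing the origin is homogeneous; then it coincides with its derivative at the origin.\<close>

lemma hol_map_isometry_homogeneous:
  assumes G: "hol_map n G" and iso: "\<forall>z\<in>complex_ball n. pnorm n (G z) = pnorm n z"
    and z: "z \<in> complex_ball n" and c: "cmod c \<le> 1"
  shows "G (\<lambda>i. c * z i) = (\<lambda>i. c * G z i)"
proof -
  have G0: "G (\<lambda>_. 0) = (\<lambda>_. 0)"
    using bspec[OF iso zero_in_ball] pnorm_pos[OF hol_map_ball[OF G zero_in_ball]] by (auto simp: pnorm_zero)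
  show ?thesis
  proof (cases "z = (\<lambda>_. 0)")
    case True then show ?thesis using G0 by simp
  next
    case False
    define t where "t = pnorm n z"
    have t: "0 < t" "t < 1" using pnorm_pos[OF z] pnorm_ball_less_1[OF z] False by (auto simp: t_def)
    define u where "u i = z i / of_real t" for i
    have u: "pnorm n u = 1" "\<And>i. n \<le> i \<Longrightarrow> u i = 0"
      using pnorm_unit[OF z] t unfolding u_def t_def by auto
    have tu: "(\<lambda>i. of_real t * u i) = z" using t by (auto simp: u_def)
    have Gz: "G z \<in> complex_ball n" "pnorm n (G z) = t" using hol_map_ball[OF G z] bspec[OF iso z] by (simp_all add: t_def)
    define v where "v i = G z i / of_real t" for i
    have v: "pnorm n v = 1" using pnorm_unit(1)[OF Gz(1)] t Gz(2) unfolding v_def by auto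
    define f where "f c = hinner n (G (\<lambda>i. c * u i)) v" for c
    note f = hol_map_slice_Schwarz[OF G G0 u v, folded f_def]
    have ft: "f (of_real t) = of_real t"
    proof -
      have "v = (\<lambda>i. (1 / of_real t) * G z i)" by (auto simp: v_def)
      then have "f (of_real t) = hinner n (G z) (\<lambda>i. (1 / of_real t) * G z i)"
        by (simp only: f_def tu)
      then show ?thesis unfolding hinner_scale_right hinner_self Gz(2) using t by (simp add: power2_eq_square)
    qed
    \<comment> \<open>Since \<open>v\<close> points along \<open>G z\<close>, equality holds in the
      Schwarz lemma at \<open>t\<close>, and the rotation factor turns out to be
      \<open>1\<close>.\<close>
    have "\<exists>\<alpha>. (\<forall>z. cmod z < 1 \<longrightarrow> f z = \<alpha> * z) \<and> cmod \<alpha> = 1"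
      by (rule Schwarz_Lemma(3)[OF f, of 0])
         (use t ft in \<open>auto intro!: exI[of _ "of_real t"]\<close>)
    then obtain \<alpha> where \<alpha>: "\<And>z. cmod z < 1 \<Longrightarrow> f z = \<alpha> * z" by blast
    have "\<alpha> = 1" using \<alpha>[of "of_real t"] ft t by simp
    then have fz: "f d = d" if "cmod d < 1" for d using \<alpha>[OF that] by simp
    define d where "d = c * of_real t"
    have "cmod d = cmod c * t" using t by (simp add: d_def norm_mult)
    also have "\<dots> \<le> 1 * t" using c t by (intro mult_right_mono) auto
    finally have d: "cmod d < 1" using t by simp
    have du: "(\<lambda>i. d * u i) = (\<lambda>i. c * z i)" using t by (auto simp: d_def u_def)
    let ?w = "G (\<lambda>i. c * z i)"
    have cz: "(\<lambda>i. c * z i) \<in> complex_ball n" by (rule ball_scale[OF z c])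
    have wv: "hinner n ?w v = d" using fz[OF d] by (simp add: f_def du)
    have "pnorm n ?w = cmod d" using bspec[OF iso cz] by (simp add: pnorm_scale d_def norm_mult t_def pnorm_nonneg)
    \<comment> \<open>Equality in Cauchy-Schwarz: \<open>?w\<close> has norm \<open>cmod d\<close>
      and its pairing with the unit vector \<open>v\<close> is \<open>d\<close>, so it is
      \<open>d\<close> times \<open>v\<close>.\<close>
    then have "hinner n (\<lambda>i. ?w i - d * v i) (\<lambda>i. ?w i - d * v i) = 0"
      using wv hinner_cnj[of n v ?w] v
      by (simp add: hinner_diff_left hinner_diff_right hinner_scale_left hinner_scale_right hinner_self complex_norm_square flip: of_real_power)
    then have "pnorm n (\<lambda>i. ?w i - d * v i) = 0" by (simp add: hinner_self)
    then have "?w i = d * v i" if "i < n" for i using pnorm_eq_0[OF _ that] by fastforce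
    then have "?w i = c * G z i" if "i < n" for i using that t by (simp add: d_def v_def)
    then show ?thesis
      by (intro complex_ball_eqI[of _ n] hol_map_ball[OF G] cz ball_scale Gz c) auto
  qed
qed

text \<open>By homogeneity the error of the linear approximation at \<open>t z\<close> is
  \<open>t\<close> times the error at \<open>z\<close>, while differentiability at the origin makes
  it small compared with \<open>t\<close>. So the error at \<open>z\<close> is zero.\<close>

lemma hol_map_isometry_linear:
  assumes G: "hol_map n G" and iso: "\<forall>z\<in>complex_ball n. pnorm n (G z) = pnorm n z"
  obtains a where "\<And>z i. \<lbrakk>z \<in> complex_ball n; i < n\<rbrakk> \<Longrightarrow> G z i = (\<Sum>k<n. a i k * z k)"
proof -
  have "\<forall>i\<in>{..<n}. \<exists>b. hderiv n (\<lambda>z. G z i) (\<lambda>_. 0) b"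
    using G zero_in_ball unfolding hol_map_def holomorphic_on_ball_iff by blast
  from bchoice[OF this] obtain a where a: "\<forall>i\<in>{..<n}. hderiv n (\<lambda>z. G z i) (\<lambda>_. 0) (a i)" ..
  have G0: "G (\<lambda>_. 0) = (\<lambda>_. 0)"
    using bspec[OF iso zero_in_ball] pnorm_pos[OF hol_map_ball[OF G zero_in_ball]] by (auto simp: pnorm_zero)
  have "G z i = (\<Sum>k<n. a i k * z k)" if z: "z \<in> complex_ball n" and i: "i < n" for z i
  proof -
    have "cmod (G z i - (\<Sum>k<n. a i k * z k)) \<le> e" if e: "e > 0" for e
    proof -
      obtain d where d: "d > 0" "\<And>w. \<lbrakk>w \<in> complex_ball n; pnorm n (w - (\<lambda>_. 0)) < d\<rbrakk> \<Longrightarrow>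
          cmod (G w i - G (\<lambda>_. 0) i - (\<Sum>k<n. a i k * (w k - 0))) \<le> e * pnorm n (w - (\<lambda>_. 0))"
        by (rule hderivE[OF bspec[OF a] e]) (use i in simp, rule that)
      define t where "t = min 1 (d / 2)"
      have t: "0 < t" "t \<le> 1" "t < d" using d(1) by (auto simp: t_def)
      let ?w = "\<lambda>k. of_real t * z k"
      have w: "?w \<in> complex_ball n" using ball_scale[OF z, of "of_real t"] t by simp
      have wn: "pnorm n ?w = t * pnorm n z" using t by (simp add: pnorm_scale)
      have "t * pnorm n z \<le> t * 1" using pnorm_ball_less_1[OF z] t by (intro mult_left_mono) auto
      then have le: "pnorm n ?w \<le> t" by (simp add: wn)
      have sub0: "w - (\<lambda>_. 0) = w" for w :: point by auto
      have "cmod (G ?w i - (\<Sum>k<n. a i k * ?w k)) \<le> e * pnorm n ?w"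
        using d(2)[OF w] le t(3) by (simp add: sub0 G0)
      moreover have "G ?w i - (\<Sum>k<n. a i k * ?w k) = of_real t * (G z i - (\<Sum>k<n. a i k * z k))"
      proof -
        have "G ?w = (\<lambda>k. of_real t * G z k)"
          using t by (intro hol_map_isometry_homogeneous[OF G iso z]) auto
        then show ?thesis by (simp add: right_diff_distrib sum_distrib_left mult_ac)
      qed
      ultimately have "cmod (of_real t * (G z i - (\<Sum>k<n. a i k * z k))) \<le> e * pnorm n ?w"
        by (simp only:)
      then have "t * cmod (G z i - (\<Sum>k<n. a i k * z k)) \<le> e * pnorm n ?w"
        using t unfolding norm_mult by simp
      also have "\<dots> \<le> e * t" using le e by (intro mult_left_mono) auto
      finally show ?thesis using t by (simp add: mult.commute)
    qed
    then have "cmod (G z i - (\<Sum>k<n. a i k * z k)) \<le> 0" by (rule field_le_epsilon) simp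
    then show ?thesis by simp
  qed
  then show ?thesis by (rule that)
qed

text \<open>Polarization; linearity is required because \<open>G\<close> is evaluated at
  sums.\<close>

lemma hol_map_isometry_hinner:
  assumes G: "hol_map n G" and iso: "\<forall>z\<in>complex_ball n. pnorm n (G z) = pnorm n z"
    and z: "z \<in> complex_ball n" and w: "w \<in> complex_ball n"
  shows "hinner n (G z) (G w) = hinner n z w"
proof -
  obtain a where a: "\<And>z i. \<lbrakk>z \<in> complex_ball n; i < n\<rbrakk> \<Longrightarrow> G z i = (\<Sum>k<n. a i k * z k)"
    by (rule hol_map_isometry_linear[OF G iso]) (rule that)
  have re: "Re (cnj c * hinner n (G z) (G w)) = Re (cnj c * hinner n z w)" if c: "cmod c = 1" for c
  proof -
    \<comment> \<open>The factor \<open>1/2\<close> keeps the sum in the ball.\<close>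
    let ?v = "\<lambda>i. (1/2) * (z i + c * w i)"
    have "pnorm n (\<lambda>i. z i + c * w i) \<le> pnorm n z + pnorm n (\<lambda>i. c * w i)" by (rule pnorm_triangle)
    then have "pnorm n (\<lambda>i. z i + c * w i) < 2"
      using pnorm_ball_less_1[OF z] pnorm_ball_less_1[OF w] c by (simp add: pnorm_scale)
    then have v: "?v \<in> complex_ball n"
      using z w unfolding complex_ball_def mem_Collect_eq pnorm_scale by (simp add: norm_divide)
    have "G ?v i = (1/2) * (G z i + c * G w i)" if i: "i < n" for i
      unfolding a[OF v i] a[OF z i] a[OF w i]
      by (simp add: sum_distrib_left sum.distrib[symmetric] algebra_simps sum_divide_distrib add_divide_distrib)
    then have "pnorm n (\<lambda>i. (1/2) * (G z i + c * G w i)) = pnorm n ?v"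
      using bspec[OF iso v] pnorm_cong[of n "G ?v" "\<lambda>i. (1/2) * (G z i + c * G w i)"] by simp
    then have "pnorm n (\<lambda>i. G z i + c * G w i) = pnorm n (\<lambda>i. z i + c * w i)"
      unfolding pnorm_scale by simp
    then have "hinner n (\<lambda>i. G z i + c * G w i) (\<lambda>i. G z i + c * G w i) = hinner n (\<lambda>i. z i + c * w i) (\<lambda>i. z i + c * w i)"
      by (simp only: hinner_self)
    moreover have "hinner n (\<lambda>i. p i + c * q i) (\<lambda>i. p i + c * q i) =
        of_real ((pnorm n p)\<^sup>2) + of_real ((pnorm n q)\<^sup>2) + (cnj c * hinner n p q + cnj (cnj c * hinner n p q))" for p q
    proof -
      have "hinner n (\<lambda>i. p i + c * q i) (\<lambda>i. p i + c * q i) =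
          hinner n p p + c * cnj c * hinner n q q + (cnj c * hinner n p q + c * hinner n q p)"
        by (simp add: hinner_add_left hinner_add_right hinner_scale_left hinner_scale_right algebra_simps)
      moreover have "c * cnj c = 1" using c complex_norm_square[of c] by simp
      ultimately show ?thesis using hinner_cnj[of n q p] by (simp add: hinner_self)
    qed
    ultimately have "cnj c * hinner n (G z) (G w) + cnj (cnj c * hinner n (G z) (G w)) =
        cnj c * hinner n z w + cnj (cnj c * hinner n z w)"
      using bspec[OF iso z] bspec[OF iso w] by simp
    from arg_cong[OF this, of Re] show ?thesis by simp
  qed
  \<comment> \<open>\<open>c = 1\<close> yields the real part, \<open>c = \<i>\<close> the imaginary
    part.\<close>
  from re[of 1] re[of \<i>] show ?thesis by (simp add: complex_eq_iff)
qed

text \<open>Neither the map nor its inverse increases the norm, so the norm is preserved and the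
  preceding rigidity applies.\<close>

lemma ball_automorphism_fixing_zero:
  assumes f: "ball_automorphism n f" and f0: "f (\<lambda>_. 0) = (\<lambda>_. 0)"
    and z: "z \<in> complex_ball n" and w: "w \<in> complex_ball n"
  shows "hinner n (f z) (f w) = hinner n z w"
proof -
  obtain g where fg: "hol_map n f" "hol_map n g" "inverse_on_ball n f g"
    using f by (rule ball_automorphism_inverse)
  have "g (f (\<lambda>_. 0)) = (\<lambda>_. 0)" using fg(3) zero_in_ball by (simp add: inverse_on_ball_def)
  then have g0: "g (\<lambda>_. 0) = (\<lambda>_. 0)" by (simp only: f0)
  have "\<forall>z\<in>complex_ball n. pnorm n (f z) = pnorm n z"
  proof (intro ballI antisym)
    fix z assume z: "z \<in> complex_ball n"
    show "pnorm n (f z) \<le> pnorm n z" by (rule hol_map_pnorm_le[OF fg(1) f0 z])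
    have "pnorm n (g (f z)) \<le> pnorm n (f z)"
      by (rule hol_map_pnorm_le[OF fg(2) g0 hol_map_ball[OF fg(1) z]])
    then show "pnorm n z \<le> pnorm n (f z)" using fg(3) z by (simp add: inverse_on_ball_def)
  qed
  then show ?thesis by (rule hol_map_isometry_hinner[OF fg(1) _ z w])
qed

section \<open>Automorphisms of the ball\<close>

lemma norm_affine_bound: "cmod (\<Sum>i<n. a i * (w i - z i)) \<le> (\<Sum>i<n. cmod (a i)) * pnorm n (w - z)"
  using norm_sum_le_pnorm[of a "w - z" n] by simp

text \<open>Reflections act on the ball by quotients of affine functions. The derivative is that of
  the quotient rule, and the error is an explicit fraction of second order.\<close>

lemma holomorphic_on_ball_quotient:
  fixes a b :: "nat \<Rightarrow> complex"
  assumes nz: "\<And>z. z \<in> complex_ball n \<Longrightarrow> b0 + (\<Sum>i<n. b i * z i) \<noteq> 0"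
  shows "holomorphic_on_ball n (\<lambda>z. (a0 + (\<Sum>i<n. a i * z i)) / (b0 + (\<Sum>i<n. b i * z i)))"
  unfolding holomorphic_on_ball_iff
proof
  fix z assume z: "z \<in> complex_ball n"
  define p q where "p = a0 + (\<Sum>i<n. a i * z i)" and "q = b0 + (\<Sum>i<n. b i * z i)"
  have q: "q \<noteq> 0" using nz[OF z] by (simp add: q_def)
  define A B where "A = (\<Sum>i<n. cmod (a i))" and "B = (\<Sum>i<n. cmod (b i))"
  have A: "A \<ge> 0" and B: "B \<ge> 0" unfolding A_def B_def by (auto intro: sum_nonneg)
  \<comment> \<open>When the denominator at \<open>w\<close> is at least half of
    \<open>cmod q\<close> in modulus, the error is at most \<open>C * h * h\<close>.\<close>
  define C where "C = 2 * (A * cmod q + cmod p * B) * B / cmod q ^ 3"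
  have C: "C \<ge> 0" using A B by (simp add: C_def)
  have "hderiv n (\<lambda>z. (a0 + (\<Sum>i<n. a i * z i)) / (b0 + (\<Sum>i<n. b i * z i))) z
      (\<lambda>i. (a i * q - p * b i) / q\<^sup>2)"
    unfolding hderiv_def
  proof (intro allI impI)
    fix e :: real assume e: "e > 0"
    \<comment> \<open>The first bound keeps the denominator at \<open>w\<close> away from zero, the
      second makes \<open>C * h\<close> at most \<open>e\<close>.\<close>
    define d where "d = min (cmod q / (2 * (B + 1))) (e / (C + 1))"
    have d: "d > 0" using q e B C by (simp add: d_def)
    show "\<exists>d>0. \<forall>w\<in>complex_ball n. pnorm n (w - z) < d \<longrightarrow>
      cmod ((a0 + (\<Sum>i<n. a i * w i)) / (b0 + (\<Sum>i<n. b i * w i)) -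
            (a0 + (\<Sum>i<n. a i * z i)) / (b0 + (\<Sum>i<n. b i * z i)) -
            (\<Sum>i<n. (a i * q - p * b i) / q\<^sup>2 * (w i - z i))) \<le> e * pnorm n (w - z)"
    proof (intro exI[of _ d] conjI ballI impI d)
      fix w assume w: "w \<in> complex_ball n" and wd: "pnorm n (w - z) < d"
      define h where "h = pnorm n (w - z)"
      have h: "0 \<le> h" "h < cmod q / (2 * (B + 1))" "h < e / (C + 1)"
        using wd pnorm_nonneg by (auto simp: h_def d_def)
      define P Q where "P = (\<Sum>i<n. a i * (w i - z i))" and "Q = (\<Sum>i<n. b i * (w i - z i))"
      have P: "cmod P \<le> A * h" and Q: "cmod Q \<le> B * h"
        unfolding P_def Q_def A_def B_def h_def by (rule norm_affine_bound)+
      have pw: "a0 + (\<Sum>i<n. a i * w i) = p + P" and qw: "b0 + (\<Sum>i<n. b i * w i) = q + Q"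
        by (simp_all add: p_def q_def P_def Q_def algebra_simps sum_subtractf)
      have qQ: "q + Q \<noteq> 0" using nz[OF w] by (simp add: qw)
      have "B * h \<le> (B + 1) * h" using h by (intro mult_right_mono) auto
      also have "\<dots> \<le> cmod q / 2" using h(2) B by (simp add: field_simps)
      finally have "cmod Q \<le> cmod q / 2" using Q by simp
      then have lb: "cmod q / 2 \<le> cmod (q + Q)" using norm_triangle_ineq2[of q "- Q"] by simp
      have "(\<Sum>i<n. (a i * q - p * b i) / q\<^sup>2 * (w i - z i)) = (P * q - p * Q) / q\<^sup>2"
        by (simp add: P_def Q_def sum_distrib_left sum_distrib_right sum_subtractf[symmetric] sum_divide_distrib algebra_simps)
      moreover have "(p + P) / (q + Q) - p / q - (P * q - p * Q) / q\<^sup>2 = - ((P * q - p * Q) * Q) / (q\<^sup>2 * (q + Q))"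
        using q qQ by (simp add: divide_simps power2_eq_square) (simp add: algebra_simps)
      ultimately have "cmod ((p + P) / (q + Q) - p / q - (\<Sum>i<n. (a i * q - p * b i) / q\<^sup>2 * (w i - z i))) =
          cmod (P * q - p * Q) * cmod Q / ((cmod q)\<^sup>2 * cmod (q + Q))"
        by (simp add: norm_divide norm_mult norm_power)
      also have "\<dots> \<le> ((A * cmod q + cmod p * B) * h) * (B * h) / ((cmod q)\<^sup>2 * (cmod q / 2))"
      proof (intro frac_le mult_mono)
        have "cmod (P * q - p * Q) \<le> cmod P * cmod q + cmod p * cmod Q"
          using norm_triangle_ineq4[of "P * q" "p * Q"] by (simp add: norm_mult)
        also have "\<dots> \<le> (A * h) * cmod q + cmod p * (B * h)"
          using P Q A B h by (intro add_mono mult_mono) auto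
        finally show "cmod (P * q - p * Q) \<le> (A * cmod q + cmod p * B) * h" by (simp add: algebra_simps)
      qed (use Q lb q A B h in auto)
      also have "\<dots> = C * h * h" using q by (simp add: C_def power2_eq_square power3_eq_cube)
      also have "\<dots> \<le> e * h"
      proof (rule mult_right_mono[OF _ h(1)])
        have "C * h \<le> (C + 1) * h" using h by (intro mult_right_mono) auto
        also have "\<dots> \<le> e" using h(3) C by (simp add: field_simps)
        finally show "C * h \<le> e" .
      qed
      finally show "cmod ((a0 + (\<Sum>i<n. a i * w i)) / (b0 + (\<Sum>i<n. b i * w i)) -
            (a0 + (\<Sum>i<n. a i * z i)) / (b0 + (\<Sum>i<n. b i * z i)) -
            (\<Sum>i<n. (a i * q - p * b i) / q\<^sup>2 * (w i - z i))) \<le> e * pnorm n (w - z)"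
        by (simp only: pw qw p_def[symmetric] q_def[symmetric] h_def[symmetric])
    qed
  qed
  then show "\<exists>c. hderiv n (\<lambda>z. (a0 + (\<Sum>i<n. a i * z i)) / (b0 + (\<Sum>i<n. b i * z i))) z c"
    by (rule exI[where x = "\<lambda>i. (a i * q - p * b i) / q\<^sup>2"])
qed

text \<open>The ball is the set of lines through \<open>(1, z)\<close> on which the form \<open>\<bar>z\<^sub>0\<bar>\<^sup>2 - \<langle>z, z\<rangle>\<close> is positive.
  The map below is induced by \<open>V \<mapsto> V - \<tau> [V, W] W\<close> with \<open>W = (w\<^sub>0, w)\<close>, which preserves the form
  under the condition on \<open>\<tau>\<close>; its inverse is given by \<open>cnj \<tau>\<close>.\<close>

definition refl_coef :: "nat \<Rightarrow> complex \<Rightarrow> complex \<Rightarrow> point \<Rightarrow> point \<Rightarrow> complex" where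
  "refl_coef n \<tau> w0 w z = \<tau> * (cnj w0 - hinner n z w)"

definition ball_refl :: "nat \<Rightarrow> complex \<Rightarrow> complex \<Rightarrow> point \<Rightarrow> point \<Rightarrow> point" where
  "ball_refl n \<tau> w0 w z = (\<lambda>i. (z i - refl_coef n \<tau> w0 w z * w i) / (1 - refl_coef n \<tau> w0 w z * w0))"

definition refl_param :: "nat \<Rightarrow> complex \<Rightarrow> complex \<Rightarrow> point \<Rightarrow> bool" where
  "refl_param n \<tau> w0 w \<longleftrightarrow> (\<forall>i\<ge>n. w i = 0) \<and> \<tau> + cnj \<tau> = \<tau> * cnj \<tau> * (w0 * cnj w0 - hinner n w w)"

lemma refl_param_cnj: "refl_param n \<tau> w0 w \<Longrightarrow> refl_param n (cnj \<tau>) w0 w"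
  by (simp add: refl_param_def add.commute mult.commute)

text \<open>Invariance of the form of signature \<open>(1, n)\<close> on the vectors
  \<open>(1, z)\<close> and \<open>(1, z')\<close>; the relation in \<open>refl_param\<close> is
  exactly what cancels the extra terms.\<close>

lemma refl_form:
  assumes "refl_param n \<tau> w0 w"
  defines "c \<equiv> refl_coef n \<tau> w0 w"
  shows "(1 - c z * w0) * cnj (1 - c z' * w0) - hinner n (\<lambda>i. z i - c z * w i) (\<lambda>i. z' i - c z' * w i) =
    1 - hinner n z z'"
proof -
  define k where "k z = cnj w0 - hinner n z w" for z
  have c: "c z = \<tau> * k z" for z by (simp add: c_def refl_coef_def k_def)
  have wz: "hinner n w z' = w0 - cnj (k z')" using hinner_cnj[of n w z'] by (simp add: k_def)
  have zw: "hinner n z w = cnj w0 - k z" by (simp add: k_def)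
  have "(1 - c z * w0) * cnj (1 - c z' * w0) - hinner n (\<lambda>i. z i - c z * w i) (\<lambda>i. z' i - c z' * w i) =
     1 - hinner n z z' - c z * cnj (k z') - cnj (c z') * k z + c z * cnj (c z') * (w0 * cnj w0 - hinner n w w)"
    unfolding hinner_diff_left hinner_diff_right hinner_scale_left hinner_scale_right wz zw
    by (simp add: algebra_simps)
  also have "\<dots> = 1 - hinner n z z' - k z * cnj (k z') * (\<tau> + cnj \<tau> - \<tau> * cnj \<tau> * (w0 * cnj w0 - hinner n w w))"
    by (simp add: c algebra_simps)
  also have "\<dots> = 1 - hinner n z z'" using assms(1) by (simp add: refl_param_def)
  finally show ?thesis .
qed

text \<open>A zero denominator would mean that the image of \<open>(1, z)\<close> has first
  coordinate zero. The form would be nonpositive there, but it is invariant and positive on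
  \<open>(1, z)\<close>.\<close>

lemma refl_denom_nonzero:
  assumes "refl_param n \<tau> w0 w" "z \<in> complex_ball n"
  shows "1 - refl_coef n \<tau> w0 w z * w0 \<noteq> 0"
proof
  let ?c = "refl_coef n \<tau> w0 w z"
  assume 0: "1 - ?c * w0 = 0"
  have "- hinner n (\<lambda>i. z i - ?c * w i) (\<lambda>i. z i - ?c * w i) = 1 - hinner n z z"
    using refl_form[OF assms(1), of z z] by (simp add: 0)
  then have "1 - (pnorm n z)\<^sup>2 = - (pnorm n (\<lambda>i. z i - ?c * w i))\<^sup>2"
    unfolding hinner_self complex_eq_iff by simp
  moreover have "0 \<le> (pnorm n (\<lambda>i. z i - ?c * w i))\<^sup>2" by simp
  ultimately have "1 \<le> (pnorm n z)\<^sup>2" by linarith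
  then have "Re (hinner n z z) \<ge> 1" by (simp add: hinner_self)
  then show False using assms(2) by (simp add: complex_ball_iff)
qed

lemma refl_kernel:
  assumes "refl_param n \<tau> w0 w" "z \<in> complex_ball n" "z' \<in> complex_ball n"
  shows "1 - hinner n (ball_refl n \<tau> w0 w z) (ball_refl n \<tau> w0 w z') = (1 - hinner n z z') /
    ((1 - refl_coef n \<tau> w0 w z * w0) * cnj (1 - refl_coef n \<tau> w0 w z' * w0))"
proof -
  let ?c = "refl_coef n \<tau> w0 w"
  define d where "d z = 1 - ?c z * w0" for z
  have d: "d z \<noteq> 0" "d z' \<noteq> 0" using refl_denom_nonzero[OF assms(1)] assms unfolding d_def by blast+
  have r: "ball_refl n \<tau> w0 w z = (\<lambda>i. (1 / d z) * (z i - ?c z * w i))" for z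
    by (auto simp: ball_refl_def d_def)
  have "1 - hinner n (ball_refl n \<tau> w0 w z) (ball_refl n \<tau> w0 w z') =
      (d z * cnj (d z') - hinner n (\<lambda>i. z i - ?c z * w i) (\<lambda>i. z' i - ?c z' * w i)) / (d z * cnj (d z'))"
    unfolding r hinner_scale_left hinner_scale_right using d by (simp add: diff_divide_distrib)
  then show ?thesis unfolding d_def refl_form[OF assms(1)] .
qed

lemma refl_ball:
  assumes "refl_param n \<tau> w0 w" "z \<in> complex_ball n"
  shows "ball_refl n \<tau> w0 w z \<in> complex_ball n"
proof -
  let ?d = "1 - refl_coef n \<tau> w0 w z * w0" and ?f = "ball_refl n \<tau> w0 w z"
  have "?d \<noteq> 0" by (rule refl_denom_nonzero[OF assms])
  then have d: "0 < (cmod ?d)\<^sup>2" by simp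
  have "1 - hinner n ?f ?f = (1 - hinner n z z) / of_real ((cmod ?d)\<^sup>2)"
    unfolding refl_kernel[OF assms(1,2,2)] complex_norm_square ..
  then have "1 - Re (hinner n ?f ?f) = (1 - Re (hinner n z z)) / (cmod ?d)\<^sup>2"
    by (metis Re_divide_of_real minus_complex.sel(1) one_complex.sel(1))
  also have "\<dots> > 0" using assms(2) d by (simp add: complex_ball_iff)
  finally have "Re (hinner n ?f ?f) < 1" by simp
  moreover have "\<forall>i\<ge>n. ?f i = 0"
    using assms complex_ball_outside[OF assms(2)] by (simp add: ball_refl_def refl_param_def)
  ultimately show ?thesis by (simp add: complex_ball_iff)
qed

lemma refl_inverse:
  assumes "refl_param n \<tau> w0 w" "z \<in> complex_ball n"
  shows "ball_refl n (cnj \<tau>) w0 w (ball_refl n \<tau> w0 w z) = z"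
proof -
  define c d where "c = refl_coef n \<tau> w0 w z" and "d = 1 - c * w0"
  have d: "d \<noteq> 0" using refl_denom_nonzero[OF assms] by (simp add: d_def c_def)
  define k where "k = cnj w0 - hinner n z w"
  have c: "c = \<tau> * k" by (simp add: c_def refl_coef_def k_def)
  have r: "ball_refl n \<tau> w0 w z = (\<lambda>i. (1 / d) * (z i - c * w i))"
    by (auto simp: ball_refl_def c_def d_def)
  have "refl_coef n (cnj \<tau>) w0 w (ball_refl n \<tau> w0 w z) = cnj \<tau> * (cnj w0 - (1 / d) * (hinner n z w - c * hinner n w w))"
    unfolding refl_coef_def r hinner_scale_left hinner_diff_left ..
  also have "\<dots> = cnj \<tau> * (k - c * (w0 * cnj w0 - hinner n w w)) / d"
    using d by (simp add: k_def field_simps) (simp add: d_def algebra_simps)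
  also have "cnj \<tau> * (k - c * (w0 * cnj w0 - hinner n w w)) = k * (cnj \<tau> - \<tau> * cnj \<tau> * (w0 * cnj w0 - hinner n w w))"
    by (simp add: c algebra_simps)
  also have "\<tau> * cnj \<tau> * (w0 * cnj w0 - hinner n w w) = \<tau> + cnj \<tau>"
    using assms(1) by (simp add: refl_param_def)
  \<comment> \<open>The second map adds back the multiple of \<open>w\<close> that the first one
    took away, up to the division by \<open>d\<close>.\<close>
  finally have c': "refl_coef n (cnj \<tau>) w0 w (ball_refl n \<tau> w0 w z) = - c / d" by (simp add: c mult.commute)
  have "1 - (- c / d) * w0 = 1 / d" using d by (simp add: field_simps) (simp add: d_def)
  moreover have "(1 / d) * (z i - c * w i) - (- c / d) * w i = z i / d" for i
    using d by (simp add: field_simps)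
  ultimately have "ball_refl n (cnj \<tau>) w0 w (ball_refl n \<tau> w0 w z) i = z i" for i
    unfolding ball_refl_def[of n "cnj \<tau>"] c' unfolding r using d by simp
  then show ?thesis by (rule ext)
qed

lemma hol_map_refl:
  assumes "refl_param n \<tau> w0 w" shows "hol_map n (ball_refl n \<tau> w0 w)"
  unfolding hol_map_def
proof (intro conjI allI impI)
  show "ball_refl n \<tau> w0 w ` complex_ball n \<subseteq> complex_ball n"
    using refl_ball[OF assms] by (rule image_subsetI)
  fix i assume i: "i < n"
  let ?an = "- (\<tau> * cnj w0 * w i)" and ?a = "\<lambda>k. (if k = i then 1 else 0) + \<tau> * cnj (w k) * w i"
  let ?bn = "1 - \<tau> * cnj w0 * w0" and ?b = "\<lambda>k. \<tau> * cnj (w k) * w0"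
  have num: "z i - refl_coef n \<tau> w0 w z * w i = ?an + (\<Sum>k<n. ?a k * z k)" for z
  proof -
    have "(\<Sum>k<n. ?a k * z k) = (\<Sum>k<n. if k = i then z k else 0) + (\<Sum>k<n. \<tau> * w i * (z k * cnj (w k)))"
      unfolding sum.distrib[symmetric] by (intro sum.cong) (auto simp: algebra_simps)
    then show ?thesis using i by (simp add: refl_coef_def hinner_def sum_distrib_left algebra_simps)
  qed
  have den: "1 - refl_coef n \<tau> w0 w z * w0 = ?bn + (\<Sum>k<n. ?b k * z k)" for z
    by (simp add: refl_coef_def hinner_def sum_distrib_left sum_distrib_right algebra_simps)
  have "holomorphic_on_ball n (\<lambda>z. (?an + (\<Sum>k<n. ?a k * z k)) / (?bn + (\<Sum>k<n. ?b k * z k)))"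
  proof (rule holomorphic_on_ball_quotient)
    fix z assume "z \<in> complex_ball n"
    then show "?bn + (\<Sum>k<n. ?b k * z k) \<noteq> 0" unfolding den[symmetric] by (rule refl_denom_nonzero[OF assms])
  qed
  then show "holomorphic_on_ball n (\<lambda>z. ball_refl n \<tau> w0 w z i)"
    unfolding ball_refl_def num den .
qed

lemma ball_automorphism_refl:
  assumes "refl_param n \<tau> w0 w" shows "ball_automorphism n (ball_refl n \<tau> w0 w)"
proof (rule ball_automorphismI)
  show "hol_map n (ball_refl n \<tau> w0 w)" "hol_map n (ball_refl n (cnj \<tau>) w0 w)"
    using hol_map_refl assms refl_param_cnj by blast+
  show "inverse_on_ball n (ball_refl n \<tau> w0 w) (ball_refl n (cnj \<tau>) w0 w)"
    using refl_inverse[OF assms] refl_inverse[OF refl_param_cnj[OF assms]] by (simp add: inverse_on_ball_def)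
qed

section \<open>Rescaling factors of automorphisms and matching of tuples\<close>

definition rescales_kernel :: "nat \<Rightarrow> (point \<Rightarrow> point) \<Rightarrow> (point \<Rightarrow> complex) \<Rightarrow> bool" where
  "rescales_kernel n f d \<longleftrightarrow> (\<forall>z\<in>complex_ball n. d z \<noteq> 0) \<and>
     (\<forall>z\<in>complex_ball n. \<forall>w\<in>complex_ball n. 1 - hinner n z w = d z * cnj (d w) * (1 - hinner n (f z) (f w)))"

lemma rescales_kernel_refl:
  assumes "refl_param n \<tau> w0 w"
  shows "rescales_kernel n (ball_refl n \<tau> w0 w) (\<lambda>z. 1 - refl_coef n \<tau> w0 w z * w0)"
  unfolding rescales_kernel_def
proof (intro conjI ballI)
  fix z assume z: "z \<in> complex_ball n"
  show dz: "1 - refl_coef n \<tau> w0 w z * w0 \<noteq> 0" by (rule refl_denom_nonzero[OF assms z])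
  fix z' assume z': "z' \<in> complex_ball n"
  have "1 - refl_coef n \<tau> w0 w z' * w0 \<noteq> 0" by (rule refl_denom_nonzero[OF assms z'])
  then show "1 - hinner n z z' = (1 - refl_coef n \<tau> w0 w z * w0) * cnj (1 - refl_coef n \<tau> w0 w z' * w0) *
      (1 - hinner n (ball_refl n \<tau> w0 w z) (ball_refl n \<tau> w0 w z'))"
    unfolding refl_kernel[OF assms z z'] using dz
    by (metis complex_cnj_zero_iff mult_eq_0_iff nonzero_mult_div_cancel_left times_divide_eq_right)
qed

lemma ball_automorphism_to_zero:
  assumes a: "a \<in> complex_ball n"
  obtains f d where "ball_automorphism n f" "rescales_kernel n f d" "f a = (\<lambda>_. 0)"
proof -
  define s where "s = sqrt (1 - (pnorm n a)\<^sup>2)"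
  have "(pnorm n a)\<^sup>2 < 1" using pnorm_ball_less_1[OF a] pnorm_nonneg[of n a] by (simp add: abs_square_less_1)
  then have s: "s > 0" "s\<^sup>2 = 1 - (pnorm n a)\<^sup>2" by (simp_all add: s_def)
  then have aa: "hinner n a a = of_real (1 - s\<^sup>2)" by (simp add: hinner_self)
  \<comment> \<open>The form takes the value \<open>s\<^sup>2\<close> both at \<open>(1, a)\<close>
    and at \<open>(-s, 0)\<close>. The reflection exchanging them has as direction their difference
    \<open>W = (1 + s, a)\<close>, and \<open>\<tau> = 2 / [W, W]\<close> with
    \<open>[W, W] = 2 * s * (1 + s)\<close>. With \<open>s\<close> in place of \<open>-s\<close> the
    vector \<open>W\<close> would vanish for \<open>a = 0\<close>.\<close>
  define \<tau> w0 where "\<tau> = complex_of_real (1 / (s * (1 + s)))" and "w0 = complex_of_real (1 + s)"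
  have eq: "w0 * cnj w0 - hinner n a a = of_real (2 * (s * (1 + s)))"
  proof -
    have "w0 * cnj w0 - hinner n a a = of_real ((1 + s) * (1 + s) - (1 - s\<^sup>2))"
      unfolding aa w0_def by (simp only: complex_cnj_complex_of_real of_real_mult of_real_diff)
    also have "(1 + s) * (1 + s) - (1 - s\<^sup>2) = 2 * (s * (1 + s))" by (simp add: power2_eq_square algebra_simps)
    finally show ?thesis .
  qed
  have "\<tau> + cnj \<tau> = \<tau> * cnj \<tau> * of_real (2 * (s * (1 + s)))"
  proof -
    have "1 / u + 1 / u = 1 / u * (1 / u) * (2 * u)" if "u \<noteq> 0" for u :: real using that by simp
    from this[of "s * (1 + s)"]
    have "1 / (s * (1 + s)) + 1 / (s * (1 + s)) = 1 / (s * (1 + s)) * (1 / (s * (1 + s))) * (2 * (s * (1 + s)))"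
      using s(1) by simp
    then show ?thesis unfolding \<tau>_def complex_cnj_complex_of_real of_real_mult[symmetric] of_real_add[symmetric]
      by (simp only:)
  qed
  then have par: "refl_param n \<tau> w0 a"
    using complex_ball_outside[OF a] by (simp add: refl_param_def eq)
  have "refl_coef n \<tau> w0 a a = 1"
  proof -
    have "cnj w0 - hinner n a a = of_real (s * (1 + s))"
      unfolding aa w0_def by (simp add: power2_eq_square algebra_simps)
    then show ?thesis using s(1) unfolding refl_coef_def \<tau>_def
      by (simp only: of_real_mult[symmetric]) simp
  qed
  then have "ball_refl n \<tau> w0 a a = (\<lambda>_. 0)" by (simp add: ball_refl_def)
  then show ?thesis using that ball_automorphism_refl[OF par] rescales_kernel_refl[OF par] by blast
qed

text \<open>Followed by an explicit automorphism \<open>g\<close> that returns the image of the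
  origin to the origin, \<open>f\<close> preserves inner products; its factor is then the inverse of
  that of \<open>g\<close>.\<close>

lemma ball_automorphism_rescales:
  assumes f: "ball_automorphism n f"
  obtains d where "rescales_kernel n f d"
proof -
  have f0: "f (\<lambda>_. 0) \<in> complex_ball n" using f zero_in_ball by (rule ball_automorphism_ball)
  obtain g d where g: "ball_automorphism n g" "rescales_kernel n g d" "g (f (\<lambda>_. 0)) = (\<lambda>_. 0)"
    using f0 by (rule ball_automorphism_to_zero)
  have "rescales_kernel n f (\<lambda>z. 1 / d (f z))"
    unfolding rescales_kernel_def
  proof (intro conjI ballI)
    fix z assume z: "z \<in> complex_ball n"
    have fz: "f z \<in> complex_ball n" using f z by (rule ball_automorphism_ball)
    then show "1 / d (f z) \<noteq> 0" using g(2) by (simp add: rescales_kernel_def)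
    fix w assume w: "w \<in> complex_ball n"
    have fw: "f w \<in> complex_ball n" using f w by (rule ball_automorphism_ball)
    have "hinner n (g (f z)) (g (f w)) = hinner n z w"
      by (rule ball_automorphism_fixing_zero[OF ball_automorphism_comp[OF g(1) f] g(3) z w])
    moreover have "1 - hinner n (f z) (f w) = d (f z) * cnj (d (f w)) * (1 - hinner n (g (f z)) (g (f w)))"
      using g(2) fz fw unfolding rescales_kernel_def by blast
    moreover have "d (f z) \<noteq> 0" "d (f w) \<noteq> 0" using g(2) fz fw unfolding rescales_kernel_def by blast+
    ultimately show "1 - hinner n z w = 1 / d (f z) * cnj (1 / d (f w)) * (1 - hinner n (f z) (f w))"
      by simp
  qed
  then show ?thesis by (rule that)
qed

text \<open>Witt extension by Householder reflections, that is \<open>w0 = 0\<close>. There is at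
  most one reflection per point: its direction is the difference of the current and the desired
  position, to which the points already placed are orthogonal.\<close>

lemma unitary_matching:
  assumes "finite I" and x: "\<And>r. r \<in> I \<Longrightarrow> x r \<in> complex_ball n" and y: "\<And>r. r \<in> I \<Longrightarrow> y r \<in> complex_ball n"
    and xy: "\<And>r s. \<lbrakk>r \<in> I; s \<in> I\<rbrakk> \<Longrightarrow> hinner n (x r) (x s) = hinner n (y r) (y s)"
  shows "\<exists>f. ball_automorphism n f \<and> (\<forall>z\<in>complex_ball n. \<forall>w\<in>complex_ball n. hinner n (f z) (f w) = hinner n z w)
    \<and> (\<forall>r\<in>I. f (x r) = y r)"
  using assms
proof (induction I rule: finite_induct)
  case empty
  \<comment> \<open>The identity, obtained as the reflection with \<open>\<tau> = 0\<close>.\<close>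
  have "hol_map n (ball_refl n 0 0 (\<lambda>_. 0))" by (rule hol_map_refl) (simp add: refl_param_def)
  then have "hol_map n (\<lambda>z. z)" by (rule hol_map_cong[rotated]) (simp add: ball_refl_def refl_coef_def)
  then have "ball_automorphism n (\<lambda>z. z)" by (rule ball_automorphismI[where g = "\<lambda>z. z"]) (simp_all add: inverse_on_ball_def \<open>hol_map n (\<lambda>z. z)\<close>)
  then show ?case by auto
next
  case (insert e I)
  have "\<exists>f. ball_automorphism n f \<and> (\<forall>z\<in>complex_ball n. \<forall>w\<in>complex_ball n. hinner n (f z) (f w) = hinner n z w)
    \<and> (\<forall>r\<in>I. f (x r) = y r)"
    by (rule insert.IH) (use insert.prems in auto)
  then obtain f where f: "ball_automorphism n f"
    "\<forall>z\<in>complex_ball n. \<forall>w\<in>complex_ball n. hinner n (f z) (f w) = hinner n z w" "\<forall>r\<in>I. f (x r) = y r"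
    by blast
  define p q where "p = f (x e)" and "q = y e"
  have xe: "x e \<in> complex_ball n" and q: "q \<in> complex_ball n" using insert.prems by (auto simp: q_def)
  have p: "p \<in> complex_ball n" unfolding p_def using f(1) xe by (rule ball_automorphism_ball)
  show ?case
  proof (cases "p = q")
    case True
    then show ?thesis using f by (intro exI[of _ f]) (auto simp: p_def q_def)
  next
    case False
    define w where "w i = p i - q i" for i
    have w_out: "\<forall>i\<ge>n. w i = 0" using p q by (auto simp: w_def complex_ball_outside)
    have pp: "hinner n p p = hinner n q q"
      using f(2) xe insert.prems(3)[of e e] by (simp add: p_def q_def)
    define P where "P = hinner n p w"
    have Pe: "P = hinner n p p - hinner n p q" by (simp add: P_def w_def[abs_def] hinner_diff_right)
    have ww: "hinner n w w = P + cnj P"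
      using hinner_cnj[of n q p] hinner_cnj[of n p p] unfolding Pe
      by (simp add: w_def[abs_def] hinner_diff_left hinner_diff_right pp)
    have P0: "P \<noteq> 0"
    proof
      assume "P = 0"
      then have "hinner n w w = 0" using ww by simp
      then have "pnorm n w = 0" by (simp add: hinner_self)
      then have "p i = q i" if "i < n" for i using pnorm_eq_0[of n w i] that by (simp add: w_def)
      then have "p = q" by (rule complex_ball_eqI[OF p q])
      then show False using False by simp
    qed
    \<comment> \<open>The usual Householder coefficient is \<open>-2 / hinner n w w\<close>. As
      \<open>hinner n p q\<close> need not be real, \<open>P\<close> takes the place of half of
      \<open>hinner n w w\<close>, and \<open>ww\<close> shows that \<open>refl_param\<close> still
      holds.\<close>
    define \<tau> where "\<tau> = - 1 / P"
    have par: "refl_param n \<tau> 0 w"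
      unfolding refl_param_def using w_out P0 by (simp add: ww \<tau>_def field_simps)
    let ?R = "ball_refl n \<tau> 0 w"
    have R: "?R z = (\<lambda>i. z i - hinner n z w / P * w i)" for z
      by (simp add: ball_refl_def refl_coef_def \<tau>_def)
    have Rp: "?R p = q" using P0 by (simp add: R P_def[symmetric] w_def)
    have Ry: "?R (y r) = y r" if r: "r \<in> I" for r
    proof -
      have "hinner n (y r) p = hinner n (y r) q"
        using f(2,3) r xe insert.prems by (metis insertCI p_def q_def)
      then have "hinner n (y r) w = 0" by (simp add: w_def[abs_def] hinner_diff_right)
      then show ?thesis by (simp add: R)
    qed
    have Rh: "hinner n (?R z) (?R z') = hinner n z z'" if "z \<in> complex_ball n" "z' \<in> complex_ball n" for z z'
      using refl_kernel[OF par that] by simp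
    have "ball_automorphism n (\<lambda>z. ?R (f z))"
      by (rule ball_automorphism_comp[OF ball_automorphism_refl[OF par] f(1)])
    moreover have "\<forall>z\<in>complex_ball n. \<forall>w\<in>complex_ball n. hinner n (?R (f z)) (?R (f w)) = hinner n z w"
      using f(2) Rh ball_automorphism_ball[OF f(1)] by simp
    moreover have "\<forall>r\<in>insert e I. ?R (f (x r)) = y r"
      using f(3) Ry Rp by (simp add: p_def q_def)
    ultimately show ?thesis by (intro exI[of _ "\<lambda>z. ?R (f z)"]) blast
  qed
qed

section \<open>Congruence, rescaling and the spaces DA(Z)\<close>

text \<open>Moving the base points \<open>x p\<close> and \<open>y p\<close> to the origin
  normalizes both matrices and leaves a single constant of modulus one as factor. Inner products
  then agree, and a unitary map completes the matching.\<close>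

lemma automorphism_matching:
  assumes fin: "finite I" and x: "\<forall>r\<in>I. x r \<in> complex_ball n" and y: "\<forall>r\<in>I. y r \<in> complex_ball n"
    and \<delta>: "\<forall>r\<in>I. \<delta> r \<noteq> 0"
    and xy: "\<forall>r\<in>I. \<forall>s\<in>I. 1 - hinner n (x r) (x s) = \<delta> r * cnj (\<delta> s) * (1 - hinner n (y r) (y s))"
  shows "\<exists>f. ball_automorphism n f \<and> (\<forall>r\<in>I. f (x r) = y r)"
proof (cases "I = {}")
  case True
  then show ?thesis using unitary_matching[of "{}" x n y] by auto
next
  case False
  then obtain p where p: "p \<in> I" by blast
  obtain f d where f: "ball_automorphism n f" "rescales_kernel n f d" "f (x p) = (\<lambda>_. 0)"
    using x p by (blast intro: ball_automorphism_to_zero)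
  obtain g e where g: "ball_automorphism n g" "rescales_kernel n g e" "g (y p) = (\<lambda>_. 0)"
    using y p by (blast intro: ball_automorphism_to_zero)
  obtain g' where g': "hol_map n g" "hol_map n g'" "inverse_on_ball n g g'"
    using g(1) by (rule ball_automorphism_inverse)
  define \<eta> where "\<eta> r = \<delta> r * e (y r) / d (x r)" for r
  have nz: "d (x r) \<noteq> 0" "e (y r) \<noteq> 0" if "r \<in> I" for r
    using f(2) g(2) x y that unfolding rescales_kernel_def by blast+
  have \<eta>: "1 - hinner n (f (x r)) (f (x s)) = \<eta> r * cnj (\<eta> s) * (1 - hinner n (g (y r)) (g (y s)))"
    if rs: "r \<in> I" "s \<in> I" for r s
  proof -
    have "d (x r) * cnj (d (x s)) * (1 - hinner n (f (x r)) (f (x s))) = 1 - hinner n (x r) (x s)"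
      using f(2) x rs unfolding rescales_kernel_def by simp
    also have "\<dots> = \<delta> r * cnj (\<delta> s) * (1 - hinner n (y r) (y s))" using xy rs by blast
    also have "1 - hinner n (y r) (y s) = e (y r) * cnj (e (y s)) * (1 - hinner n (g (y r)) (g (y s)))"
      using g(2) y rs unfolding rescales_kernel_def by blast
    finally show ?thesis using nz[OF rs(1)] nz[OF rs(2)] by (simp add: \<eta>_def field_simps)
  qed
  have zero: "hinner n (\<lambda>_. 0) z = 0" "hinner n z (\<lambda>_. 0) = 0" for z by (simp_all add: hinner_def)
  \<comment> \<open>At the origin both \<open>1 - hinner\<close> terms equal \<open>1\<close>, so
    each factor is inverse to the conjugate of \<open>\<eta> p\<close>.\<close>
  have \<eta>0: "\<eta> r * cnj (\<eta> p) = 1" if "r \<in> I" for r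
    using \<eta>[OF that p] by (simp add: f(3) g(3) zero)
  have c: "\<eta> r = \<eta> p" if "r \<in> I" for r
  proof -
    have "\<eta> r * cnj (\<eta> p) = \<eta> p * cnj (\<eta> p)" "cnj (\<eta> p) \<noteq> 0"
      using \<eta>0[OF that] \<eta>0[OF p] by auto
    then show ?thesis by simp
  qed
  have eq: "hinner n (f (x r)) (f (x s)) = hinner n (g (y r)) (g (y s))" if rs: "r \<in> I" "s \<in> I" for r s
    using \<eta>[OF rs] \<eta>0[OF rs(1)] c[OF rs(2)] by simp
  obtain u where u: "ball_automorphism n u" "\<forall>r\<in>I. u (f (x r)) = g (y r)"
    using unitary_matching[of I "\<lambda>r. f (x r)" n "\<lambda>r. g (y r)"] fin eq x y
      ball_automorphism_ball[OF f(1)] ball_automorphism_ball[OF g(1)] by blast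
  have g'aut: "ball_automorphism n g'"
    using g'(2,1) inverse_on_ball_sym[OF g'(3)] by (rule ball_automorphismI)
  have "ball_automorphism n (\<lambda>z. g' (u (f z)))"
    by (rule ball_automorphism_comp[OF g'aut ball_automorphism_comp[OF u(1) f(1)]])
  moreover have "\<forall>r\<in>I. g' (u (f (x r))) = y r"
    using u(2) g'(3) y by (simp add: inverse_on_ball_def)
  ultimately show ?thesis by blast
qed

section \<open>Equivalence of matrices under rescaling\<close>

definition kernel_equiv :: "'a set \<Rightarrow> ('a \<Rightarrow> 'a \<Rightarrow> complex) \<Rightarrow> ('a \<Rightarrow> 'a \<Rightarrow> complex) \<Rightarrow> bool" where
  "kernel_equiv I K L \<longleftrightarrow> (\<exists>\<gamma>. (\<forall>r\<in>I. \<gamma> r \<noteq> 0) \<and> (\<forall>r\<in>I. \<forall>s\<in>I. K r s = \<gamma> r * cnj (\<gamma> s) * L r s))"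

lemma kernel_equiv_sym:
  assumes "kernel_equiv I K L" shows "kernel_equiv I L K"
proof -
  obtain \<gamma> where \<gamma>: "\<forall>r\<in>I. \<gamma> r \<noteq> 0" "\<forall>r\<in>I. \<forall>s\<in>I. K r s = \<gamma> r * cnj (\<gamma> s) * L r s"
    using assms unfolding kernel_equiv_def by blast
  show ?thesis unfolding kernel_equiv_def
    by (rule exI[of _ "\<lambda>r. 1 / \<gamma> r"]) (use \<gamma> in simp)
qed

lemma kernel_equiv_trans:
  assumes "kernel_equiv I K L" "kernel_equiv I L M" shows "kernel_equiv I K M"
proof -
  obtain \<gamma> where \<gamma>: "\<forall>r\<in>I. \<gamma> r \<noteq> 0" "\<forall>r\<in>I. \<forall>s\<in>I. K r s = \<gamma> r * cnj (\<gamma> s) * L r s"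
    using assms(1) unfolding kernel_equiv_def by blast
  obtain \<delta> where \<delta>: "\<forall>r\<in>I. \<delta> r \<noteq> 0" "\<forall>r\<in>I. \<forall>s\<in>I. L r s = \<delta> r * cnj (\<delta> s) * M r s"
    using assms(2) unfolding kernel_equiv_def by blast
  show ?thesis unfolding kernel_equiv_def
    by (rule exI[of _ "\<lambda>r. \<gamma> r * \<delta> r"]) (use \<gamma> \<delta> in simp)
qed

lemma kernel_equiv_subset: "\<lbrakk>kernel_equiv I K L; A \<subseteq> I\<rbrakk> \<Longrightarrow> kernel_equiv A K L"
  unfolding kernel_equiv_def by (meson subsetD)

text \<open>Normalizing at \<open>p\<close> leaves invariants of three points, \<open>p\<close> among them.\<close>

lemma kernel_equiv_local:
  assumes p: "p \<in> I" and hK: "hermitian I K" and hL: "hermitian I L"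
    and pos: "0 < Re (K p p)" "0 < Re (L p p)"
    and nz: "\<forall>r\<in>I. \<forall>s\<in>I. K r s \<noteq> 0 \<and> L r s \<noteq> 0"
    and loc: "\<forall>r\<in>I. \<forall>s\<in>I. kernel_equiv {p, r, s} K L"
  shows "kernel_equiv I K L"
proof -
  \<comment> \<open>With a positive factor at \<open>p\<close>, the diagonal entry forces
    \<open>\<gamma> p = 1 / q\<close>; the column of \<open>p\<close> then forces
    \<open>\<gamma> r = K r p / L r p * q\<close>.\<close>
  define q where "q = complex_of_real (sqrt (Re (L p p) / Re (K p p)))"
  have q: "q \<noteq> 0" "cnj q = q" using pos by (simp_all add: q_def)
  have "q * q = of_real (Re (L p p) / Re (K p p))" using pos unfolding q_def of_real_mult[symmetric] by simp
  also have "\<dots> = L p p / K p p"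
    unfolding of_real_divide using hermitian_diag_real[OF hK p] hermitian_diag_real[OF hL p] by simp
  finally have qq: "q * q = L p p / K p p" .
  define \<gamma> where "\<gamma> r = K r p / L r p * q" for r
  have "K r s = \<gamma> r * cnj (\<gamma> s) * L r s" if rs: "r \<in> I" "s \<in> I" for r s
  proof -
    \<comment> \<open>The local factors depend on the triple, but
      \<open>\<delta> r * cnj (\<delta> s)\<close> does not: the contributions of
      \<open>\<delta> p\<close> cancel in \<open>K r p * K p s / K p p\<close>.\<close>
    obtain \<delta> where \<delta>: "\<forall>a\<in>{p, r, s}. \<delta> a \<noteq> 0" "\<forall>a\<in>{p, r, s}. \<forall>b\<in>{p, r, s}. K a b = \<delta> a * cnj (\<delta> b) * L a b"
      using loc rs unfolding kernel_equiv_def by blast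
    have d0: "\<delta> p \<noteq> 0" "\<delta> r \<noteq> 0" "\<delta> s \<noteq> 0" using \<delta>(1) by auto
    have L0: "L p p \<noteq> 0" "L r p \<noteq> 0" "L p s \<noteq> 0" using nz p rs by blast+
    have K: "K r s = \<delta> r * cnj (\<delta> s) * L r s" "K r p = \<delta> r * cnj (\<delta> p) * L r p"
      "K p s = \<delta> p * cnj (\<delta> s) * L p s" "K p p = \<delta> p * cnj (\<delta> p) * L p p"
      using \<delta>(2) by auto
    have "cnj (K s p) = K p s" "cnj (L s p) = L p s"
      using hermitianD[OF hK rs(2) p] hermitianD[OF hL rs(2) p] by simp_all
    then have "\<gamma> r * cnj (\<gamma> s) = K r p / L r p * (K p s / L p s) * (q * q)"
      by (simp add: \<gamma>_def q(2))
    also have "\<dots> = \<delta> r * cnj (\<delta> s)"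
      unfolding qq K using d0 L0 by (simp add: field_simps)
    finally show ?thesis using K(1) by simp
  qed
  moreover have "\<forall>r\<in>I. \<gamma> r \<noteq> 0" using nz p q(1) by (simp add: \<gamma>_def)
  ultimately show ?thesis unfolding kernel_equiv_def by blast
qed

text \<open>The bijection \<open>\<theta>\<close> is determined by the labels; with injective
  labellings, rescaling of spaces becomes a statement on matrices over \<open>I\<close>.\<close>

lemma rescaling_matching_iff:
  assumes H: "RK H = h ` I" "inj_on h I" and G: "RK G = g ` I" "inj_on g I"
  shows "rescaling_matching I G g H h \<longleftrightarrow>
    kernel_equiv I (\<lambda>r s. ip H (h r) (h s)) (\<lambda>r s. ip G (g r) (g s))"
proof
  assume "rescaling_matching I G g H h"
  then obtain \<theta> \<gamma> where "\<forall>r\<in>I. \<theta> (h r) = g r" "\<forall>u\<in>RK H. \<gamma> u \<noteq> 0"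
    "\<forall>u\<in>RK H. \<forall>v\<in>RK H. ip H u v = \<gamma> u * cnj (\<gamma> v) * ip G (\<theta> u) (\<theta> v)"
    unfolding rescaling_matching_def rescaling_via_def by blast
  then show "kernel_equiv I (\<lambda>r s. ip H (h r) (h s)) (\<lambda>r s. ip G (g r) (g s))"
    unfolding kernel_equiv_def by (intro exI[of _ "\<lambda>r. \<gamma> (h r)"]) (simp add: H(1))
next
  assume "kernel_equiv I (\<lambda>r s. ip H (h r) (h s)) (\<lambda>r s. ip G (g r) (g s))"
  then obtain \<gamma> where \<gamma>: "\<forall>r\<in>I. \<gamma> r \<noteq> 0"
    "\<forall>r\<in>I. \<forall>s\<in>I. ip H (h r) (h s) = \<gamma> r * cnj (\<gamma> s) * ip G (g r) (g s)"
    unfolding kernel_equiv_def by blast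
  let ?i = "inv_into I h"
  have i: "?i (h r) = r" if "r \<in> I" for r using H(2) that by (rule inv_into_f_f)
  have bij: "bij_betw (\<lambda>u. g (?i u)) (RK H) (RK G)"
    unfolding bij_betw_def H(1) G(1)
  proof
    show "inj_on (\<lambda>u. g (?i u)) (h ` I)"
      using G(2) by (auto simp: inj_on_def i)
    show "(\<lambda>u. g (?i u)) ` h ` I = g ` I" by (auto simp: i image_iff)
  qed
  have "rescaling_via (\<lambda>u. g (?i u)) G H"
    unfolding rescaling_via_def using \<gamma> by (intro conjI bij exI[of _ "\<lambda>u. \<gamma> (?i u)"]) (auto simp: H(1) i)
  then show "rescaling_matching I G g H h"
    unfolding rescaling_matching_def by (intro exI[of _ "\<lambda>u. g (?i u)"]) (simp add: i)
qed

section \<open>The spaces DA(Z)\<close>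

text \<open>The arguments of \<open>hinner\<close> are exchanged because this is the value at
  \<open>y\<close> of the kernel function of \<open>x\<close>.\<close>

definition kern :: "nat \<Rightarrow> point \<Rightarrow> point \<Rightarrow> complex" where
  "kern n x y = 1 / (1 - hinner n y x)"

lemma DA_kernel_eq: "t \<in> complex_ball n \<Longrightarrow> DA_kernel n s t = kern n s t"
  by (simp add: DA_kernel_def kern_def)

lemma hermitian_kern: "hermitian A (kern n)"
  unfolding hermitian_def kern_def by (simp flip: hinner_cnj)

lemma kern_nonzero: "\<lbrakk>x \<in> complex_ball n; y \<in> complex_ball n\<rbrakk> \<Longrightarrow> kern n x y \<noteq> 0"
  using one_minus_hinner_nonzero[of y n x] by (simp add: kern_def)

lemma kern_self_pos: "x \<in> complex_ball n \<Longrightarrow> 0 < Re (kern n x x)"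
proof -
  assume x: "x \<in> complex_ball n"
  have "kern n x x = of_real (1 / (1 - (pnorm n x)\<^sup>2))" by (simp add: kern_def hinner_self)
  moreover have "(pnorm n x)\<^sup>2 < 1" using x by (simp add: complex_ball_iff hinner_self)
  ultimately show ?thesis by simp
qed

text \<open>With \<open>e\<close> moved to the origin by \<open>f\<close>, the rescaled kernel is
  normalized at \<open>e\<close>, and its Schur complement divided by the kernel is the inner
  product of images. The second clause, from injectivity of \<open>f\<close>, provides strict
  positivity in \<open>pd_kern\<close>.\<close>

lemma schur_kern:
  assumes e: "e \<in> complex_ball n"
  obtains g :: "point \<Rightarrow> nat \<Rightarrow> complex" where
    "\<And>x y. \<lbrakk>x \<in> complex_ball n; y \<in> complex_ball n\<rbrakk> \<Longrightarrow>
       schur e (kern n) x y = (\<Sum>k<n. g x k * cnj (g y k)) * kern n x y"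
    "\<And>x. \<lbrakk>x \<in> complex_ball n; x \<noteq> e\<rbrakk> \<Longrightarrow> \<exists>k<n. g x k \<noteq> 0"
proof -
  obtain f d where f: "ball_automorphism n f" "rescales_kernel n f d" "f e = (\<lambda>_. 0)"
    using e by (rule ball_automorphism_to_zero)
  have d: "d x \<noteq> 0" if "x \<in> complex_ball n" for x using f(2) that by (simp add: rescales_kernel_def)
  have k: "kern n x y = 1 / (d y * cnj (d x) * (1 - hinner n (f y) (f x)))"
    if "x \<in> complex_ball n" "y \<in> complex_ball n" for x y
  proof -
    have "1 - hinner n y x = d y * cnj (d x) * (1 - hinner n (f y) (f x))"
      using f(2) that unfolding rescales_kernel_def by blast
    then show ?thesis unfolding kern_def by (simp only:)
  qed
  have zero: "hinner n (\<lambda>_. 0) z = 0" "hinner n z (\<lambda>_. 0) = 0" for z by (simp_all add: hinner_def)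
  show ?thesis
  proof (rule that[of "\<lambda>x k. cnj (f x k)"])
    fix x y assume xy: "x \<in> complex_ball n" "y \<in> complex_ball n"
    have fxy: "1 - hinner n (f y) (f x) \<noteq> 0"
      by (intro one_minus_hinner_nonzero ball_automorphism_ball[OF f(1)] xy)
    have h: "(\<Sum>k<n. cnj (f x k) * cnj (cnj (f y k))) = hinner n (f y) (f x)"
      by (simp add: hinner_def mult.commute)
    have "kern n x e * kern n e y / kern n e e = 1 / (d y * cnj (d x))"
      unfolding k[OF xy(1) e] k[OF e xy(2)] k[OF e e] f(3) zero
      using d[OF xy(1)] d[OF xy(2)] d[OF e] by simp
    then have "schur e (kern n) x y = kern n x y - 1 / (d y * cnj (d x))" by (simp only: schur_def)
    moreover have "1 / (D * (1 - u)) - 1 / D = u * (1 / (D * (1 - u)))"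
      if "D \<noteq> 0" "1 - u \<noteq> 0" for D u :: complex
      using that by (simp add: field_simps)
    from this[of "d y * cnj (d x)", OF _ fxy]
    have "kern n x y - 1 / (d y * cnj (d x)) = hinner n (f y) (f x) * kern n x y"
      unfolding k[OF xy] using d[OF xy(1)] d[OF xy(2)] by simp
    ultimately show "schur e (kern n) x y = (\<Sum>k<n. cnj (f x k) * cnj (cnj (f y k))) * kern n x y"
      unfolding h by (rule trans)
  next
    fix x assume x: "x \<in> complex_ball n" "x \<noteq> e"
    have "f x \<noteq> f e" using f(1) x e by (auto simp: ball_automorphism_def bij_betw_def inj_on_def)
    moreover have "f x \<in> complex_ball n" using f(1) x(1) by (rule ball_automorphism_ball)
    ultimately have "\<not> (\<forall>k<n. f x k = 0)"
      using complex_ball_eqI[OF _ zero_in_ball, of "f x" n] f(3) by auto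
    then have "\<exists>k<n. f x k \<noteq> 0" by simp
    then show "\<exists>k<n. cnj (f x k) \<noteq> 0" by simp
  qed
qed

text \<open>Induction through the Schur complement: it is a sum of conjugates of the kernel on
  \<open>Z\<close> by the coordinates of \<open>g\<close>, and at a point of \<open>Z\<close> where
  \<open>a\<close> is nonzero some coordinate of \<open>g\<close> is nonzero too.\<close>

lemma pd_kern:
  assumes "finite Z" "Z \<subseteq> complex_ball n"
  shows "pd Z (kern n)"
  using assms
proof (induction Z rule: finite_induct)
  case empty then show ?case by (simp add: pd_def hermitian_def)
next
  case (insert e Z)
  have e: "e \<in> complex_ball n" and Z: "Z \<subseteq> complex_ball n" using insert.prems by auto
  have pdZ: "pd Z (kern n)" using insert.IH[OF Z] .
  obtain g where g: "\<And>x y. \<lbrakk>x \<in> complex_ball n; y \<in> complex_ball n\<rbrakk> \<Longrightarrow>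
       schur e (kern n) x y = (\<Sum>k<n. g x k * cnj (g y k)) * kern n x y"
    "\<And>x. \<lbrakk>x \<in> complex_ball n; x \<noteq> e\<rbrakk> \<Longrightarrow> \<exists>k<n. g x k \<noteq> 0"
    by (rule schur_kern[OF e]) (rule that)
  have "0 < Re (qform (insert e Z) (kern n) a)" if a: "\<exists>x\<in>insert e Z. a x \<noteq> 0" for a
  proof (cases "\<exists>x\<in>Z. a x \<noteq> 0")
    case True
    then obtain x where x: "x \<in> Z" "a x \<noteq> 0" by blast
    then have "x \<in> complex_ball n" "x \<noteq> e" using Z insert.hyps by auto
    from g(2)[OF this] obtain k where k: "k < n" "g x k \<noteq> 0" by blast
    have "0 < (\<Sum>k<n. Re (qform Z (kern n) (\<lambda>x. a x * g x k)))"
    proof (rule sum_pos2)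
      show "0 < Re (qform Z (kern n) (\<lambda>x. a x * g x k))"
        using x k by (intro pd_pos[OF pdZ]) auto
      show "0 \<le> Re (qform Z (kern n) (\<lambda>x. a x * g x i))" for i
        by (rule psd_nonneg[OF pd_imp_psd[OF pdZ]])
    qed (use k in auto)
    also have "\<dots> = Re (qform Z (\<lambda>x y. \<Sum>k<n. g x k * cnj (g y k) * kern n x y) a)"
      by (simp only: sform_kernel_sum sform_kernel_conj Re_sum)
    also have "\<dots> = Re (qform Z (schur e (kern n)) a)"
      by (intro arg_cong[where f = Re] sform_cong refl)
         (simp add: g(1)[OF subsetD[OF Z] subsetD[OF Z]] sum_distrib_right)
    also have "\<dots> \<le> Re (qform (insert e Z) (kern n) a)"
      by (intro sform_schur_le insert.hyps hermitian_kern kern_self_pos e)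
    finally show ?thesis .
  next
    case False
    then have a0: "a x = 0" if "x \<in> Z" for x using that by blast
    then have ae: "a e \<noteq> 0" using a by auto
    have "qform (insert e Z) (kern n) a = a e * cnj (a e) * kern n e e"
      unfolding sform_insert[OF insert.hyps] by (simp add: sform_def a0)
    also have "Re \<dots> = (cmod (a e))\<^sup>2 * Re (kern n e e)" by (simp flip: complex_norm_square)
    finally show ?thesis using ae kern_self_pos[OF e] by simp
  qed
  then show ?case using hermitian_kern by (simp add: pd_def)
qed

lemma vector_space_fun_scale: "vector_space (fun_scale :: complex \<Rightarrow> ('a \<Rightarrow> complex) \<Rightarrow> 'a \<Rightarrow> complex)"
  by unfold_locales (auto simp: fun_scale_def algebra_simps)

text \<open>Evaluation of the vanishing combination at the points of \<open>Z\<close> makes the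
  quadratic form of \<open>a\<close> zero, but that form is definite.\<close>

lemma DA_kernel_combination_zero:
  assumes Z: "finite Z" "Z \<subseteq> complex_ball n" and 0: "(\<Sum>s\<in>Z. fun_scale (a s) (DA_kernel n s)) = 0" and z: "z \<in> Z"
  shows "a z = 0"
proof (rule ccontr)
  assume "a z \<noteq> 0"
  then have "0 < Re (qform Z (kern n) a)" using z by (intro pd_pos[OF pd_kern[OF Z]]) auto
  moreover have "(\<Sum>s\<in>Z. a s * kern n s t) = 0" if "t \<in> Z" for t
  proof -
    have "(\<Sum>s\<in>Z. fun_scale (a s) (DA_kernel n s)) t = (\<Sum>s\<in>Z. a s * DA_kernel n s t)"
      using Z(1) by (induction Z rule: finite_induct) (simp_all add: fun_scale_def)
    also have "\<dots> = (\<Sum>s\<in>Z. a s * kern n s t)"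
      using that Z(2) by (intro sum.cong refl) (auto simp: DA_kernel_eq)
    finally show ?thesis using 0 by simp
  qed
  then have "qform Z (kern n) a = 0" by (simp add: sform_right)
  ultimately show False by simp
qed

lemma inj_on_DA_kernel: "inj_on (DA_kernel n) (complex_ball n)"
proof (rule inj_onI, rule ccontr)
  fix s t assume st: "s \<in> complex_ball n" "t \<in> complex_ball n" "DA_kernel n s = DA_kernel n t" "s \<noteq> t"
  have "(\<Sum>u\<in>{s, t}. fun_scale ((if u = s then 1 else - 1)) (DA_kernel n u)) = 0"
    using st by (auto simp: fun_scale_def fun_eq_iff)
  then have "(if s = s then 1 else - 1 :: complex) = 0"
    by (intro DA_kernel_combination_zero[of "{s, t}" n "\<lambda>u. if u = s then 1 else - 1" s]) (use st in auto)
  then show False by simp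
qed

lemma DA_simps [simp]: "scl (DA n Z) = fun_scale" "RK (DA n Z) = DA_kernel n ` Z"
  by (simp_all add: DA_def)

lemma independent_DA_kernel:
  assumes Z: "finite Z" "Z \<subseteq> complex_ball n"
  shows "\<not> module.dependent fun_scale (DA_kernel n ` Z)"
proof -
  interpret vector_space "fun_scale :: complex \<Rightarrow> (point \<Rightarrow> complex) \<Rightarrow> point \<Rightarrow> complex"
    by (rule vector_space_fun_scale)
  have inj: "inj_on (DA_kernel n) Z" using inj_on_DA_kernel Z(2) by (rule inj_on_subset)
  have "u v = 0" if 0: "(\<Sum>v\<in>DA_kernel n ` Z. fun_scale (u v) v) = 0" and v: "v \<in> DA_kernel n ` Z" for u v
  proof -
    have "(\<Sum>s\<in>Z. fun_scale (u (DA_kernel n s)) (DA_kernel n s)) = 0"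
      using 0 by (simp add: sum.reindex[OF inj])
    then show ?thesis using v DA_kernel_combination_zero[OF Z, of "\<lambda>s. u (DA_kernel n s)"] by auto
  qed
  then show ?thesis using Z(1) by (subst dependent_finite) auto
qed

lemma ip_DA_sform:
  assumes "Z \<subseteq> complex_ball n"
  shows "ip (DA n Z) f g = sform Z (kern n)
    (\<lambda>s. module.representation fun_scale (DA_kernel n ` Z) f (DA_kernel n s))
    (\<lambda>s. module.representation fun_scale (DA_kernel n ` Z) g (DA_kernel n s))"
  unfolding DA_def sform_def using assms by (auto simp: Let_def DA_kernel_eq intro!: sum.cong)

lemma ip_DA_kernel:
  assumes Z: "finite Z" "Z \<subseteq> complex_ball n" and st: "s \<in> Z" "t \<in> Z"
  shows "ip (DA n Z) (DA_kernel n s) (DA_kernel n t) = kern n s t"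
proof -
  interpret vector_space "fun_scale :: complex \<Rightarrow> (point \<Rightarrow> complex) \<Rightarrow> point \<Rightarrow> complex"
    by (rule vector_space_fun_scale)
  have rep: "representation (DA_kernel n ` Z) (DA_kernel n u) (DA_kernel n v) = (if v = u then 1 else 0)"
    if "u \<in> Z" "v \<in> Z" for u v
    using that Z(2) inj_on_DA_kernel[of n]
    by (subst representation_basis[OF independent_DA_kernel[OF Z]]) (auto simp: inj_on_eq_iff subset_iff)
  have "ip (DA n Z) (DA_kernel n s) (DA_kernel n t) =
      sform Z (kern n) (\<lambda>x. if x = s then 1 else 0) (\<lambda>x. if x = t then 1 else 0)"
    unfolding ip_DA_sform[OF Z(2)] using st by (intro sform_cong rep refl)
  also have "\<dots> = (\<Sum>x\<in>Z. if x = t then kern n s x else 0)"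
    unfolding sform_indicator(1)[OF Z(1) st(1)] by (auto intro!: sum.cong)
  finally show ?thesis using Z(1) st by simp
qed

lemma rkhs_DA:
  assumes Z: "finite Z" "Z \<subseteq> complex_ball n"
  shows "rkhs (DA n Z)"
proof -
  interpret vector_space "fun_scale :: complex \<Rightarrow> (point \<Rightarrow> complex) \<Rightarrow> point \<Rightarrow> complex"
    by (rule vector_space_fun_scale)
  let ?B = "DA_kernel n ` Z"
  have ind: "independent ?B" by (rule independent_DA_kernel[OF Z])
  note ip = ip_DA_sform[OF Z(2)]
  have hs: "hspace (DA n Z) = span ?B" by (simp add: hspace_def)
  show ?thesis
    unfolding rkhs_def rkhs_axioms_def DA_simps hs
  proof (intro conjI allI impI)
    show "vector_space (fun_scale :: complex \<Rightarrow> (point \<Rightarrow> complex) \<Rightarrow> point \<Rightarrow> complex)"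
      by (rule vector_space_fun_scale)
    show "finite ?B" using Z(1) by simp
    show "independent ?B" by (rule ind)
    fix f g h c assume f: "f \<in> span ?B" and h: "h \<in> span ?B"
    show "ip (DA n Z) (fun_scale c f) h = c * ip (DA n Z) f h"
      unfolding ip representation_scale[OF ind f] sform_scale_left ..
    show "ip (DA n Z) h f = cnj (ip (DA n Z) f h)"
      unfolding ip by (rule sform_cnj[OF hermitian_kern])
  next
    fix f g h assume f: "f \<in> span ?B" and g: "g \<in> span ?B" and h: "h \<in> span ?B"
    show "ip (DA n Z) (f + g) h = ip (DA n Z) f h + ip (DA n Z) g h"
      unfolding ip representation_add[OF ind g f] sform_add_left ..
  next
    fix f assume f: "f \<in> span ?B" and f0: "f \<noteq> 0"
    have "\<exists>s\<in>Z. representation ?B f (DA_kernel n s) \<noteq> 0"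
    proof (rule ccontr)
      assume "\<not> ?thesis"
      then have "(\<Sum>b\<in>?B. fun_scale (representation ?B f b) b) = 0"
        by (intro sum.neutral) auto
      moreover have "(\<Sum>b\<in>?B. fun_scale (representation ?B f b) b) = f"
        using ind f Z(1) by (intro sum_representation_eq) auto
      ultimately show False using f0 by simp
    qed
    then show "0 < Re (ip (DA n Z) f f)" unfolding ip by (rule pd_pos[OF pd_kern[OF Z]])
  qed
qed

text \<open>Any point of the ball can be taken to the origin, so the factorization of the Schur
  complement is available at each kernel function, as sufficiency requires.\<close>

lemma DA_CPP:
  assumes Z: "finite Z" "Z \<subseteq> complex_ball n"
  shows "DA n Z \<in> CPP"
proof (rule CPP_pick_kernelI)
  show "DA n Z \<in> irreducible_rkhs"
    unfolding irreducible_rkhs_def using rkhs_DA[OF Z] kern_nonzero Z by (auto simp: ip_DA_kernel)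
  fix e assume "e \<in> RK (DA n Z)"
  then obtain z where z: "z \<in> Z" "e = DA_kernel n z" by auto
  have zb: "z \<in> complex_ball n" using z Z by auto
  obtain g where g: "\<And>x y. \<lbrakk>x \<in> complex_ball n; y \<in> complex_ball n\<rbrakk> \<Longrightarrow>
       schur z (kern n) x y = (\<Sum>k<n. g x k * cnj (g y k)) * kern n x y"
    by (rule schur_kern[OF zb]) (rule that)
  let ?i = "inv_into Z (DA_kernel n)"
  have inj: "inj_on (DA_kernel n) Z" using inj_on_DA_kernel Z(2) by (rule inj_on_subset)
  have i: "?i (DA_kernel n s) = s" if "s \<in> Z" for s using inj that by (rule inv_into_f_f)
  have "schur e (ip (DA n Z)) x y = (\<Sum>k<n. g (?i x) k * cnj (g (?i y) k)) * ip (DA n Z) x y"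
    if xy: "x \<in> RK (DA n Z)" "y \<in> RK (DA n Z)" for x y
  proof -
    obtain s t where st: "s \<in> Z" "t \<in> Z" "x = DA_kernel n s" "y = DA_kernel n t" using xy by auto
    have "schur e (ip (DA n Z)) x y = schur z (kern n) s t"
      unfolding schur_def st z using st z by (simp add: ip_DA_kernel[OF Z])
    also have "\<dots> = (\<Sum>k<n. g s k * cnj (g t k)) * kern n s t" using g st Z(2) by blast
    finally show ?thesis unfolding st using st by (simp add: i ip_DA_kernel[OF Z])
  qed
  then show "\<exists>m (g :: (point \<Rightarrow> complex) \<Rightarrow> nat \<Rightarrow> complex). \<forall>x\<in>RK (DA n Z). \<forall>y\<in>RK (DA n Z).
      schur e (ip (DA n Z)) x y = (\<Sum>k<m. g x k * cnj (g y k)) * ip (DA n Z) x y"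
    by (intro exI[of _ n] exI[of _ "\<lambda>x. g (?i x)"]) blast
qed

section \<open>From spaces and tuples to matrices\<close>

lemma hdim_eq_card: "rkhs H \<Longrightarrow> hdim H = card (RK H)"
proof -
  assume "rkhs H"
  then interpret rkhs H .
  show ?thesis unfolding hdim_def hspace_def by (rule dim_span_eq_card_independent[OF independent_RK])
qed

lemma CPP_rkhs: "H \<in> CPP \<Longrightarrow> rkhs H"
  unfolding CPP_def irreducible_rkhs_def mem_Collect_eq by blast

lemma CPP_imp_DA:
  assumes H: "H \<in> CPP" and RK: "RK H = h ` I" "inj_on h I" and I: "finite I" "I \<noteq> {}"
  shows "\<exists>m x. distinct_points m I x \<and> kernel_equiv I (\<lambda>r s. ip H (h r) (h s)) (\<lambda>r s. kern m (x r) (x s))"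
proof -
  interpret rkhs H using H by (rule CPP_rkhs)
  obtain m :: nat and g \<delta> where \<delta>0: "\<forall>u\<in>RK H. \<delta> u \<noteq> 0" and
    g0: "\<forall>u\<in>RK H. \<forall>v\<in>RK H. ip H u v * (1 - (\<Sum>k<m. g u k * cnj (g v k))) = \<delta> u * cnj (\<delta> v)"
    using pick_kernel[OF H order_refl finite_RK] I RK(1) by auto
  \<comment> \<open>Conjugation matches the order of arguments in \<open>kern\<close>; coordinates
    from \<open>m\<close> on are set to zero, as the ball demands.\<close>
  define x where "x r k = (if k < m then cnj (g (h r) k) else 0)" for r k
  have hx: "hinner m (x s) (x r) = (\<Sum>k<m. g (h r) k * cnj (g (h s) k))" for r s
    by (simp add: hinner_def x_def mult.commute)
  have g: "ip H (h r) (h s) * (1 - hinner m (x s) (x r)) = \<delta> (h r) * cnj (\<delta> (h s))" if "r \<in> I" "s \<in> I" for r s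
    unfolding hx using g0 that RK(1) by auto
  have \<delta>: "\<delta> (h r) \<noteq> 0" if "r \<in> I" for r using \<delta>0 that RK(1) by auto
  have hr: "h r \<in> RK H" if "r \<in> I" for r using that RK(1) by auto
  have ball: "x r \<in> complex_ball m" if r: "r \<in> I" for r
  proof -
    have K: "0 < Re (ip H (h r) (h r))" "ip H (h r) (h r) = of_real (Re (ip H (h r) (h r)))"
      by (rule ip_pos[OF RK_hspace[OF hr[OF r]] RK_nonzero[OF hr[OF r]]], rule ip_self_real[OF RK_hspace[OF hr[OF r]]])
    \<comment> \<open>On the diagonal the right side is positive because \<open>\<delta>\<close> is
      nonzero; this forces the norm of \<open>x r\<close> below one.\<close>
    have "of_real (Re (ip H (h r) (h r)) * (1 - (pnorm m (x r))\<^sup>2)) = complex_of_real ((cmod (\<delta> (h r)))\<^sup>2)"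
      unfolding complex_norm_square g[OF r r, symmetric] using K(2) by (simp add: hinner_self)
    then have "Re (ip H (h r) (h r)) * (1 - (pnorm m (x r))\<^sup>2) = (cmod (\<delta> (h r)))\<^sup>2"
      by (simp only: of_real_eq_iff)
    moreover have "0 < (cmod (\<delta> (h r)))\<^sup>2" using \<delta>[OF r] by simp
    ultimately have "0 < 1 - (pnorm m (x r))\<^sup>2" using K(1) by (metis zero_less_mult_pos)
    then show ?thesis by (simp add: complex_ball_iff hinner_self x_def)
  qed
  have ip: "ip H (h r) (h s) = \<delta> (h r) * cnj (\<delta> (h s)) * kern m (x r) (x s)" if "r \<in> I" "s \<in> I" for r s
    using g[OF that] one_minus_hinner_nonzero[OF ball[OF that(2)] ball[OF that(1)]]
    by (simp add: kern_def field_simps)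
  have "inj_on x I"
  proof (rule inj_onI, rule ccontr)
    fix r s assume rs: "r \<in> I" "s \<in> I" "x r = x s" "r \<noteq> s"
    have hrs: "h r \<noteq> h s" using rs RK(2) by (auto simp: inj_on_def)
    \<comment> \<open>Equal points would make the two kernel functions proportional, with ratio
      \<open>\<delta> (h r) / \<delta> (h s)\<close>; this combination would then have norm
      zero.\<close>
    let ?a = "\<lambda>u. if u = h r then 1 / \<delta> (h r) else - 1 / \<delta> (h s)"
    have "pd {h r, h s} (ip H)" using pd_gram by (rule pd_subset) (use hr rs finite_RK in auto)
    then have "0 < Re (qform {h r, h s} (ip H) ?a)" by (rule pd_pos) (use \<delta> rs in auto)
    also have "qform {h r, h s} (ip H) ?a = 0"
      unfolding sform_def using hrs rs \<delta>[OF rs(1)] \<delta>[OF rs(2)] by (simp add: ip)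
    finally show False by simp
  qed
  then have "distinct_points m I x" using ball by (auto simp: distinct_points_def)
  moreover have "kernel_equiv I (\<lambda>r s. ip H (h r) (h s)) (\<lambda>r s. kern m (x r) (x s))"
    unfolding kernel_equiv_def by (rule exI[of _ "\<lambda>r. \<delta> (h r)"]) (use \<delta> ip in blast)
  ultimately show ?thesis by blast
qed

text \<open>Both tuples are viewed in a common ball, where inner products are unchanged.
  Automorphisms rescale \<open>1 - hinner\<close>, the reciprocal of \<open>kern\<close> with
  exchanged arguments, which explains the factor \<open>1 / cnj\<close> in both directions.\<close>

lemma congruent_tuples_iff:
  assumes I: "finite I" and x: "x ` I \<subseteq> complex_ball n" and y: "y ` I \<subseteq> complex_ball m"
  shows "congruent_tuples I n x m y \<longleftrightarrow>
    kernel_equiv I (\<lambda>r s. kern n (x r) (x s)) (\<lambda>r s. kern m (y r) (y s))"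
proof
  assume "congruent_tuples I n x m y"
  then obtain N f where N: "n \<le> N" "m \<le> N" and f: "ball_automorphism N f" "\<forall>r\<in>I. f (x r) = y r"
    unfolding congruent_tuples_def by blast
  obtain d where d: "rescales_kernel N f d" using f(1) by (rule ball_automorphism_rescales)
  have xN: "x r \<in> complex_ball N" if "r \<in> I" for r using x that complex_ball_mono[OF N(1)] by blast
  have "kern n (x r) (x s) = 1 / cnj (d (x r)) * cnj (1 / cnj (d (x s))) * kern m (y r) (y s)"
    if rs: "r \<in> I" "s \<in> I" for r s
  proof -
    have "1 - hinner N (x s) (x r) = d (x s) * cnj (d (x r)) * (1 - hinner N (f (x s)) (f (x r)))"
      using d xN rs unfolding rescales_kernel_def by blast
    moreover have "hinner N (x s) (x r) = hinner n (x s) (x r)" "hinner N (y s) (y r) = hinner m (y s) (y r)"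
      using x y rs N by (auto intro!: hinner_mono)
    ultimately show ?thesis using f(2) rs by (simp add: kern_def mult.commute)
  qed
  moreover have "\<forall>r\<in>I. 1 / cnj (d (x r)) \<noteq> 0" using d xN by (simp add: rescales_kernel_def)
  ultimately show "kernel_equiv I (\<lambda>r s. kern n (x r) (x s)) (\<lambda>r s. kern m (y r) (y s))"
    unfolding kernel_equiv_def by (intro exI[of _ "\<lambda>r. 1 / cnj (d (x r))"]) blast
next
  assume "kernel_equiv I (\<lambda>r s. kern n (x r) (x s)) (\<lambda>r s. kern m (y r) (y s))"
  then obtain \<gamma> where \<gamma>: "\<forall>r\<in>I. \<gamma> r \<noteq> 0"
    "\<forall>r\<in>I. \<forall>s\<in>I. kern n (x r) (x s) = \<gamma> r * cnj (\<gamma> s) * kern m (y r) (y s)"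
    unfolding kernel_equiv_def by blast
  define N where "N = max n m"
  have N: "n \<le> N" "m \<le> N" by (simp_all add: N_def)
  have "\<exists>f. ball_automorphism N f \<and> (\<forall>r\<in>I. f (x r) = y r)"
  proof (rule automorphism_matching[OF I])
    show "\<forall>r\<in>I. x r \<in> complex_ball N" "\<forall>r\<in>I. y r \<in> complex_ball N"
      using x y complex_ball_mono[OF N(1)] complex_ball_mono[OF N(2)] by blast+
    show "\<forall>r\<in>I. 1 / cnj (\<gamma> r) \<noteq> 0" using \<gamma>(1) by simp
    show "\<forall>r\<in>I. \<forall>s\<in>I. 1 - hinner N (x r) (x s) =
        1 / cnj (\<gamma> r) * cnj (1 / cnj (\<gamma> s)) * (1 - hinner N (y r) (y s))"
    proof (intro ballI)
      fix r s assume rs: "r \<in> I" "s \<in> I"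
      have h: "hinner N (x r) (x s) = hinner n (x r) (x s)" "hinner N (y r) (y s) = hinner m (y r) (y s)"
        using x y rs N by (auto intro!: hinner_mono)
      have nz: "1 - hinner n (x r) (x s) \<noteq> 0" "1 - hinner m (y r) (y s) \<noteq> 0"
        by (rule one_minus_hinner_nonzero; use x y rs in blast)+
      have "kern n (x s) (x r) = \<gamma> s * cnj (\<gamma> r) * kern m (y s) (y r)" using \<gamma>(2) rs by blast
      moreover have "\<gamma> r \<noteq> 0" "\<gamma> s \<noteq> 0" using \<gamma>(1) rs by auto
      ultimately show "1 - hinner N (x r) (x s) =
        1 / cnj (\<gamma> r) * cnj (1 / cnj (\<gamma> s)) * (1 - hinner N (y r) (y s))"
        unfolding h kern_def using nz by (simp add: field_simps)
    qed
  qed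
  then show "congruent_tuples I n x m y" unfolding congruent_tuples_def using N by blast
qed

section \<open>Faces of the tetrahedron and the equivalence\<close>

lemma card_face: "i \<in> {1..4} \<Longrightarrow> card (face i) = 3"
  by simp

lemma rescaling_DA_iff:
  assumes y: "distinct_points n I y" and I: "finite I" and G: "RK G = g ` I" "inj_on g I"
  shows "rescaling_matching I G g (DA n (y ` I)) (\<lambda>r. DA_kernel n (y r)) \<longleftrightarrow>
    kernel_equiv I (\<lambda>r s. kern n (y r) (y s)) (\<lambda>r s. ip G (g r) (g s))"
    and "rescaling_matching I (DA n (y ` I)) (\<lambda>r. DA_kernel n (y r)) G g \<longleftrightarrow>
    kernel_equiv I (\<lambda>r s. ip G (g r) (g s)) (\<lambda>r s. kern n (y r) (y s))"
proof -
  have y': "inj_on y I" "y ` I \<subseteq> complex_ball n" using y by (auto simp: distinct_points_def)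
  have RK: "RK (DA n (y ` I)) = (\<lambda>r. DA_kernel n (y r)) ` I" by (simp add: image_image)
  have inj: "inj_on (\<lambda>r. DA_kernel n (y r)) I"
    using comp_inj_on[OF y'(1) inj_on_subset[OF inj_on_DA_kernel y'(2)]] by (simp add: comp_def)
  have ip: "ip (DA n (y ` I)) (DA_kernel n (y r)) (DA_kernel n (y s)) = kern n (y r) (y s)"
    if "r \<in> I" "s \<in> I" for r s
    using I y'(2) that by (intro ip_DA_kernel) auto
  have "kernel_equiv I (\<lambda>r s. ip (DA n (y ` I)) (DA_kernel n (y r)) (DA_kernel n (y s))) L \<longleftrightarrow>
      kernel_equiv I (\<lambda>r s. kern n (y r) (y s)) L"
    "kernel_equiv I L (\<lambda>r s. ip (DA n (y ` I)) (DA_kernel n (y r)) (DA_kernel n (y s))) \<longleftrightarrow>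
      kernel_equiv I L (\<lambda>r s. kern n (y r) (y s))" for L
    unfolding kernel_equiv_def using ip by simp_all
  then show "rescaling_matching I G g (DA n (y ` I)) (\<lambda>r. DA_kernel n (y r)) \<longleftrightarrow>
    kernel_equiv I (\<lambda>r s. kern n (y r) (y s)) (\<lambda>r s. ip G (g r) (g s))"
    "rescaling_matching I (DA n (y ` I)) (\<lambda>r. DA_kernel n (y r)) G g \<longleftrightarrow>
    kernel_equiv I (\<lambda>r s. ip G (g r) (g s)) (\<lambda>r s. kern n (y r) (y s))"
    unfolding rescaling_matching_iff[OF RK inj G] rescaling_matching_iff[OF G RK inj] by blast+
qed

text \<open>A base vertex and two more labels leave one of the four labels over, and the face
  opposite to it contains all of them. Here the number of vertices meets the three-point
  invariants.\<close>

lemma faces_cover: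
  fixes r s :: nat assumes "r \<in> {1..4}" "s \<in> {1..4}"
  shows "\<exists>i\<in>{1..4}. {1, r, s} \<subseteq> face i"
proof -
  have "card ({1, r, s} :: nat set) \<le> 3" by (simp add: card_insert_if)
  then have "\<not> {1..4} \<subseteq> {1, r, s}" using card_mono[of "{1, r, s}" "{1..4 :: nat}"] by auto
  then obtain i where "i \<in> {1..4}" "i \<notin> {1, r, s}" by blast
  then have "{1, r, s} \<subseteq> face i" using assms by auto
  then show ?thesis using \<open>i \<in> {1..4}\<close> by blast
qed

lemma kernel_equiv_faces:
  fixes K L :: "nat \<Rightarrow> nat \<Rightarrow> complex"
  assumes hK: "hermitian {1..4} K" and hL: "hermitian {1..4} L"
    and pos: "0 < Re (K 1 1)" "0 < Re (L 1 1)"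
    and nz: "\<forall>r\<in>{1..4}. \<forall>s\<in>{1..4}. K r s \<noteq> 0 \<and> L r s \<noteq> 0"
    and faces: "\<forall>i\<in>{1..4}. kernel_equiv (face i) K L"
  shows "kernel_equiv {1..4} K L"
proof (rule kernel_equiv_local[where p = 1, OF _ hK hL pos nz])
  show "\<forall>r\<in>{1..4}. \<forall>s\<in>{1..4}. kernel_equiv {1, r, s} K L"
    using faces_cover faces kernel_equiv_subset by metis
qed simp

lemma CPP_space_with_facesD:
  assumes "CPP_space_with_faces J j H h"
  shows "H \<in> CPP" "hdim H = 4" "RK H = h ` {1..4}"
    and "\<forall>i\<in>{1..4}. rescaling_matching (face i) (J i) (j i) (regular_subspace H (h ` face i)) h"
proof -
  note c = assms[unfolded CPP_space_with_faces_def]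
  show "H \<in> CPP" "hdim H = 4" "RK H = h ` {1..4}"
    "\<forall>i\<in>{1..4}. rescaling_matching (face i) (J i) (j i) (regular_subspace H (h ` face i)) h"
    by (rule c[THEN conjunct1], rule c[THEN conjunct2, THEN conjunct1],
        rule c[THEN conjunct2, THEN conjunct2, THEN conjunct1],
        rule c[THEN conjunct2, THEN conjunct2, THEN conjunct2])
qed

text \<open>A quantifier cannot range over the types of spaces. In the equivalence \<open>H\<close>
  is sought among functions on points, where DA(X) lives; the second conjunct starts from a space
  over any type \<open>'w\<close>, yields a tetrahedron again and compares \<open>H\<close> with
  every tetrahedron that has the given faces.\<close>

theorem proposition3p4:
  fixes n :: nat
    and y :: "nat \<Rightarrow> nat \<Rightarrow> point"
    and J :: "nat \<Rightarrow> 'v::ab_group_add rkhs_data"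
    and j :: "nat \<Rightarrow> nat \<Rightarrow> 'v"
  assumes triangles: "\<And>i. i \<in> {1..4} \<Longrightarrow> distinct_points n (face i) (y i)"
    and J_CPP: "\<And>i. i \<in> {1..4} \<Longrightarrow> J i \<in> CPP"
    and J_dim: "\<And>i. i \<in> {1..4} \<Longrightarrow> hdim (J i) = 3"
    and J_RK: "\<And>i. i \<in> {1..4} \<Longrightarrow> RK (J i) = j i ` face i"
    and J_rescaling: "\<And>i. i \<in> {1..4} \<Longrightarrow>
          rescaling_matching (face i) (J i) (j i) (DA n (y i ` face i)) (\<lambda>r. DA_kernel n (y i r))"
  shows "((\<exists>m x. tetrahedron_with_faces n y m x) \<longleftrightarrow>
          (\<exists>(H :: (point \<Rightarrow> complex) rkhs_data) h. CPP_space_with_faces J j H h)) \<and>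
         (\<forall>(H :: 'w::ab_group_add rkhs_data) h. CPP_space_with_faces J j H h \<longrightarrow>
            (\<exists>m x. tetrahedron_with_faces n y m x) \<and>
            (\<forall>m x. tetrahedron_with_faces n y m x \<longrightarrow>
               rescaling_matching {1..4} H h (DA m (x ` {1..4})) (\<lambda>r. DA_kernel m (x r))))"
proof -
  let ?KY = "\<lambda>i r s. kern n (y i r) (y i s)" and ?KX = "\<lambda>m x r s. kern m (x r) (x s)"
  let ?KJ = "\<lambda>i r s. ip (J i) (j i r) (j i s)"
  \<comment> \<open>Dimension three means three distinct kernel functions, so the labels are
    injective.\<close>
  have inj_j: "inj_on (j i) (face i)" if i: "i \<in> {1..4}" for i
    using hdim_eq_card[OF CPP_rkhs[OF J_CPP[OF i]]] J_dim[OF i] J_RK[OF i] card_face[OF i]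
    by (intro eq_card_imp_inj_on) auto
  have YJ: "kernel_equiv (face i) (?KY i) (?KJ i)" if i: "i \<in> {1..4}" for i
    using J_rescaling[OF i]
    unfolding rescaling_DA_iff(1)[OF triangles[OF i] finite_Diff[OF finite_atLeastAtMost] J_RK[OF i] inj_j[OF i]] .
  have tetra: "tetrahedron_with_faces n y m x \<longleftrightarrow>
      distinct_points m {1..4} x \<and> (\<forall>i\<in>{1..4}. kernel_equiv (face i) (?KY i) (?KX m x))" for m x
  proof -
    have "congruent_tuples (face i) n (y i) m x \<longleftrightarrow> kernel_equiv (face i) (?KY i) (?KX m x)"
      if "distinct_points m {1..4} x" "i \<in> {1..4}" for i
      using that triangles[OF that(2)] by (intro congruent_tuples_iff) (auto simp: distinct_points_def)
    then show ?thesis unfolding tetrahedron_with_faces_def by blast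
  qed
  \<comment> \<open>\<open>'u\<close> does not occur in the goal, so this and the following facts on
    spaces become polymorphic and serve for functions on points as well as for
    \<open>'w\<close>.\<close>
  have space: "kernel_equiv (face i) (\<lambda>r s. ip H (h r) (h s)) (?KJ i) \<longleftrightarrow>
      rescaling_matching (face i) (J i) (j i) (regular_subspace H (h ` face i)) h"
    if "inj_on h {1..4}" "i \<in> {1..4}" for i and H :: "'u::ab_group_add rkhs_data" and h :: "nat \<Rightarrow> 'u"
    using rescaling_matching_iff[of "regular_subspace H (h ` face i)" h "face i" "J i" "j i"]
      inj_on_subset[OF that(1), of "face i"] J_RK[OF that(2)] inj_j[OF that(2)] by simp
  have inj_h: "inj_on h {1..4}"
    if "H \<in> CPP" "hdim H = 4" "RK H = h ` {1..4}" for H :: "'u::ab_group_add rkhs_data" and h :: "nat \<Rightarrow> 'u"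
    using hdim_eq_card[OF CPP_rkhs[OF that(1)]] that by (intro eq_card_imp_inj_on) auto
  have CPP_faces: "\<forall>i\<in>{1..4}. kernel_equiv (face i) (?KY i) (\<lambda>r s. ip H (h r) (h s))"
    if "CPP_space_with_faces J j H h" for H :: "'u::ab_group_add rkhs_data" and h :: "nat \<Rightarrow> 'u"
  proof
    fix i assume i: "i \<in> {1..4 :: nat}"
    note H = CPP_space_with_facesD[OF that]
    have "kernel_equiv (face i) (\<lambda>r s. ip H (h r) (h s)) (?KJ i)"
      unfolding space[OF inj_h[OF H(1-3)] i] by (rule bspec[OF H(4) i])
    from kernel_equiv_trans[OF YJ[OF i] kernel_equiv_sym[OF this]]
    show "kernel_equiv (face i) (?KY i) (\<lambda>r s. ip H (h r) (h s))" .
  qed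
  have ex_tetra: "\<exists>m x. tetrahedron_with_faces n y m x"
    if sp: "CPP_space_with_faces J j H h" for H :: "'u::ab_group_add rkhs_data" and h :: "nat \<Rightarrow> 'u"
  proof -
    note H = CPP_space_with_facesD(1-3)[OF sp]
    obtain m x where x: "distinct_points m {1..4} x"
      "kernel_equiv {1..4} (\<lambda>r s. ip H (h r) (h s)) (?KX m x)"
      using CPP_imp_DA[OF H(1,3) inj_h[OF H]] by auto
    have "kernel_equiv (face i) (?KY i) (?KX m x)" if i: "i \<in> {1..4}" for i
      by (rule kernel_equiv_trans[OF bspec[OF CPP_faces[OF sp] i] kernel_equiv_subset[OF x(2)]]) auto
    then have "tetrahedron_with_faces n y m x" using x(1) unfolding tetra by simp
    then show ?thesis by (intro exI)
  qed
  have rescaling: "rescaling_matching {1..4} H h (DA m (x ` {1..4})) (\<lambda>r. DA_kernel m (x r))"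
    if sp: "CPP_space_with_faces J j H h" and tx: "tetrahedron_with_faces n y m x"
    for H :: "'u::ab_group_add rkhs_data" and h :: "nat \<Rightarrow> 'u" and m x
  proof -
    note H = CPP_space_with_facesD(1-3)[OF sp]
    interpret rkhs H using H(1) by (rule CPP_rkhs)
    have x: "distinct_points m {1..4} x" "\<forall>i\<in>{1..4}. kernel_equiv (face i) (?KY i) (?KX m x)"
      using tx unfolding tetra by simp_all
    have xb: "x r \<in> complex_ball m" if "r \<in> {1..4}" for r using x(1) that by (auto simp: distinct_points_def)
    have hr: "h r \<in> RK H" if "r \<in> {1..4}" for r using that H(3) by simp
    \<comment> \<open>On each face both matrices are equivalent to that of the triangle, hence to
      each other; the base vertex \<open>1\<close> glues the faces.\<close>
    have "kernel_equiv {1..4} (?KX m x) (\<lambda>r s. ip H (h r) (h s))"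
    proof (rule kernel_equiv_faces)
      show "hermitian {1..4} (?KX m x)"
        unfolding hermitian_def using hermitianD[OF hermitian_kern[of UNIV m]] by blast
      show "hermitian {1..4} (\<lambda>r s. ip H (h r) (h s))"
        unfolding hermitian_def using hermitianD[OF hermitian_gram] hr by blast
      show "0 < Re (kern m (x 1) (x 1))" using xb by (intro kern_self_pos) simp
      show "0 < Re (ip H (h 1) (h 1))" using hr by (intro ip_pos RK_hspace RK_nonzero) simp_all
      show "\<forall>r\<in>{1..4}. \<forall>s\<in>{1..4}. kern m (x r) (x s) \<noteq> 0 \<and> ip H (h r) (h s) \<noteq> 0"
        using kern_nonzero xb CPP_nonzero[OF H(1)] hr by blast
      show "\<forall>i\<in>{1..4}. kernel_equiv (face i) (?KX m x) (\<lambda>r s. ip H (h r) (h s))"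
      proof
        fix i assume i: "i \<in> {1..4 :: nat}"
        show "kernel_equiv (face i) (?KX m x) (\<lambda>r s. ip H (h r) (h s))"
          by (rule kernel_equiv_trans[OF kernel_equiv_sym[OF bspec[OF x(2) i]] bspec[OF CPP_faces[OF sp] i]])
      qed
    qed
    then show ?thesis
      unfolding rescaling_DA_iff(1)[OF x(1) finite_atLeastAtMost H(3) inj_h[OF H]] .
  qed
  have ex_space: "\<exists>(H :: (point \<Rightarrow> complex) rkhs_data) h. CPP_space_with_faces J j H h"
    if "tetrahedron_with_faces n y m x" for m x
  proof -
    have x: "distinct_points m {1..4} x" "\<forall>i\<in>{1..4}. kernel_equiv (face i) (?KY i) (?KX m x)"
      using that unfolding tetra by simp_all
    define Z where "Z = x ` {1..4}"
    have Z: "finite Z" "Z \<subseteq> complex_ball m" "card Z = 4" "inj_on x {1..4}"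
      using x(1) by (auto simp: Z_def distinct_points_def card_image)
    define h where "h r = DA_kernel m (x r)" for r
    have C: "DA m Z \<in> CPP" using Z by (intro DA_CPP)
    have RK: "RK (DA m Z) = h ` {1..4}" by (auto simp: Z_def h_def)
    have "card (DA_kernel m ` Z) = 4"
      using Z(3) card_image[OF inj_on_subset[OF inj_on_DA_kernel Z(2)]] by simp
    then have dim: "hdim (DA m Z) = 4" using hdim_eq_card[OF rkhs_DA[OF Z(1,2)]] by simp
    have "rescaling_matching (face i) (J i) (j i) (regular_subspace (DA m Z) (h ` face i)) h"
      if i: "i \<in> {1..4}" for i
    proof -
      have "ip (DA m Z) (h r) (h s) = ?KX m x r s" if "r \<in> face i" "s \<in> face i" for r s
        unfolding h_def by (rule ip_DA_kernel[OF Z(1,2)]) (use that in \<open>auto simp: Z_def\<close>)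
      then have "kernel_equiv (face i) (\<lambda>r s. ip (DA m Z) (h r) (h s)) (?KX m x)"
        unfolding kernel_equiv_def by (intro exI[of _ "\<lambda>_. 1"]) simp
      moreover have "kernel_equiv (face i) (?KX m x) (?KJ i)"
        by (rule kernel_equiv_trans[OF kernel_equiv_sym[OF bspec[OF x(2) i]] YJ[OF i]])
      ultimately show ?thesis
        unfolding space[OF inj_h[OF C dim RK] i, symmetric] by (rule kernel_equiv_trans)
    qed
    then have "CPP_space_with_faces J j (DA m Z) h"
      unfolding CPP_space_with_faces_def using C dim RK by simp
    then show ?thesis by (intro exI)
  qed
  show ?thesis
  proof (intro conjI iffI allI impI)
    assume "\<exists>m x. tetrahedron_with_faces n y m x"
    then show "\<exists>(H :: (point \<Rightarrow> complex) rkhs_data) h. CPP_space_with_faces J j H h"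
      by (elim exE) (rule ex_space)
  next
    assume "\<exists>(H :: (point \<Rightarrow> complex) rkhs_data) h. CPP_space_with_faces J j H h"
    then show "\<exists>m x. tetrahedron_with_faces n y m x"
      by (elim exE) (rule ex_tetra)
  next
    fix H :: "'w rkhs_data" and h assume sp: "CPP_space_with_faces J j H h"
    then show "\<exists>m x. tetrahedron_with_faces n y m x" by (rule ex_tetra)
    fix m x assume "tetrahedron_with_faces n y m x"
    with sp show "rescaling_matching {1..4} H h (DA m (x ` {1..4})) (\<lambda>r. DA_kernel m (x r))"
      by (rule rescaling)
  qed
qed

end
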